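(* Consider the sequence of $N$-class, $n$-server systems described in the context, under either of the scheduling policies FP or SLQ, with scenarios $s\in\mathfrak S_0$. Then for every $T\in(0,\infty)$ and every $i=1,\dots,N$, $$\gamma^n_i(T):=\sup_{s\in\mathfrak S_0}\ \sup_{t\in[0,T]}\big|\hat Q^{n,s}_i(JT^{n,s}_i(t))-\lambda_i\widehat{WT}^{n,s}_i(t)\big|\longrightarrow0\quad\text{in probability, as }n\to\infty.$$
   Context: Notation: $1$ also denotes the all-ones vector in $\mathbb{R}^N$ and $x\cdot y$ the scalar product. $f(t-)$ is a left limit. Convention $\inf\emptyset=\infty$; the absolute value in the claim is read as $+\infty$ if a time appearing in it is infinite. Primitives. Fix $N\ge1$ (number of customer classes), $\lambda_i>0$, $\mu_i>0$, $\hat\lambda_i\in\mathbb{R}$, and $\rho_i=\lambda_i/\mu_i$ with $\sum_{i=1}^N\rho_i=1$. For $n\in\mathbb{N}$ the $n$th system has $N$ buffers and $n$ identical servers. The arrival rates $\lambda^n_i>0$ satisfy $\lambda^n_i=n\lambda_i+\sqrt n\,\hat\lambda_i+o(\sqrt n)$. On a probability space $(\Omega,\mathcal F,\mathbb P)$, $\{IA_i(l):l\in\mathbb{N}\}$, $i=1,\dots,N$, are independent sequences of strictly positive i.i.d. random variables with mean $1$ and finite variance $C^2_{IA_i}$; $E^n_i(t)=\sup\{l\ge0:\sum_{k=1}^l IA_i(k)/\lambda^n_i\le t\}$ counts class-$i$ arrivals. $S_1,\dots,S_N$ are mutually independent right-continuous Poisson processes with rates $\mu_1,\dots,\mu_N$.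 $Q^n(0),\Psi^n(0)$ are $\mathbb{Z}_+^N$-valued random variables (customers initially in the buffers and in service), with $1\cdot\Psi^n(0)\le n$, and $1\cdot Q^n(0)>0$ implies $1\cdot\Psi^n(0)=n$. For each $n$, $\{E^n_i\}_i$, $\{S_i\}_i$, $(Q^n(0),\Psi^n(0))$ are mutually independent. Moreover $\big(n^{-1/2}Q^n(0),\,n^{-1/2}(\Psi^n(0)-n\rho)\big)$ converges in distribution to $(0,\Psi(0))$, where $\rho=(\rho_i)_i$ and $\Psi(0)$ is an $\mathbb{R}^N$-valued random variable with $\sum_i\Psi_i(0)\le0$. Dynamics. Customer $(i,j)$ is the $j$th class-$i$ customer to arrive after time $0$. Given decisions $\delta=\{\delta_{ij}\}$, $\delta_{ij}\in\{0,1\}$ ($1$ = join, $0$ = leave), let $J^n_i(t)=\sum_{j=1}^{E^n_i(t)}\delta_{ij}$ and $R^n_i(t)=\sum_{j=1}^{E^n_i(t)}(1-\delta_{ij})$. The queue lengths $Q^n_i$, numbers in service $\Psi^n_i$, routing counts $B^n_i$ (number of class-$i$ customers routed to service by time $t$; nondecreasing, $B^n_i(0)=0$) and departure counts $D^n_i$ are right-continuous, $Q^n_i,\Psi^n_i$ are $\mathbb{Z}_+$-valued, $1\cdot\Psi^n\le n$, and $Q^n_i(t)=Q^n_i(0)+E^n_i(t)-B^n_i(t)-R^n_i(t)$, $\Psi^n_i(t)=\Psi^n_i(0)+B^n_i(t)-D^n_i(t)$, $D^n_i(t)=S_i\big(\int_0^t\Psi^n_i(u)\,du\big)$, together with the non-idling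 condition: for every $t$, $1\cdot Q^n(t)>0$ implies $1\cdot\Psi^n(t)=n$. Within each buffer customers are served in order of arrival. The scheduling policy is one of: FP: $\int_{[0,\infty)}\sum_{k=1}^{i-1}Q^n_k(t)\,dB^n_i(t)=0$ for $i=2,\dots,N$ (a freed server takes from the nonempty buffer of least index); SLQ: $\int_{[0,\infty)}1_{\{Q^n_i(t-)<\max_kQ^n_k(t-)\}}\,dB^n_i(t)=0$ for $i=1,\dots,N$ (a freed server takes from a longest queue, ties broken by an arbitrary fixed rule). Under each policy the processes are uniquely determined by the primitives and $\delta$. Times. With $J^n_i(0-)=0$: $JT^n_i(t)=\inf\{s\ge t:J^n_i(s)>J^n_i(t-)\}$ (joining time of the first class-$i$ customer to join at or after $t$), $RT^n_i(t)=\inf\{s>t:B^n_i(s)\ge B^n_i(JT^n_i(t))+Q^n_i(JT^n_i(t))\}$ (time that customer enters service), $WT^n_i(t)=RT^n_i(t)-JT^n_i(t)$ (its waiting time). Strategies and scenarios. $AT^n_{ij}=\inf\{t\ge0:E^n_i(t)\ge j\}$ is the arrival time of $(i,j)$. When a family $\sigma=\{\sigma_{ij}\}$ of maps $\mathbb{Z}_+\to\{0,1\}$ (a strategy profile) is played, the decisions are $\delta_{ij}=\sigma_{ij}(Q^n_i(AT^n_{ij}-))$ with $Q^n$ the queue length under these same decisions (uniquely determined by induction over arrivals). Given are constants $r_i>0$ and functions $h_i:\mathbb{R}_+\to\mathbb{R}_+$, continuous, strictly increasing, $h_i(0)=0$. Let $\sigma^n_{ij}(q)=1$ if $h_i(q/(\sqrt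 n\lambda_i))\le r_i$ and $0$ otherwise, and $\bar\sigma^n_{ij}=1-\sigma^n_{ij}$. Let $\mathfrak S_0=\{0\}\cup(\{1,\dots,N\}\times\mathbb{N})$. Scenario $0$ (the reference scenario) is the dynamics when $\sigma^n$ is played; scenario $s=(i,j)$ is the dynamics when customer $(i,j)$ plays $\bar\sigma^n_{ij}$ and every other customer $(k,l)$ plays $\sigma^n_{kl}$. A superscript $s$ denotes a process under scenario $s$. Scaled processes. $\hat Q^{n,s}_i=Q^{n,s}_i/\sqrt n$, $\widehat{WT}^{n,s}_i=\sqrt n\,WT^{n,s}_i$. *)

theory Defs
  imports "HOL-Probability.Probability" "HOL-Library.Landau_Symbols"
begin

section \<open>Probabilistic notions\<close>

definition gen_events :: "'a measure \<Rightarrow> ('i \<Rightarrow> 'a \<Rightarrow> nat) \<Rightarrow> 'i set \<Rightarrow> 'a set set" where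
  "gen_events M X I = sigma_sets (space M) {X i -` A \<inter> space M | i A. i \<in> I}"

definition (in prob_space) poisson_process :: "real \<Rightarrow> (real \<Rightarrow> 'a \<Rightarrow> nat) \<Rightarrow> bool" where
  "poisson_process \<mu> X \<longleftrightarrow>
     (\<forall>t\<ge>0. random_variable (count_space UNIV) (X t)) \<and>
     (AE \<omega> in M. X 0 \<omega> = 0 \<and> mono_on {0..} (\<lambda>t. X t \<omega>) \<and>
        (\<forall>t\<ge>0. continuous (at_right t) (\<lambda>t. X t \<omega>))) \<and>
     (\<forall>s t. 0 \<le> s \<longrightarrow> s < t \<longrightarrow>
        distr M (count_space UNIV) (\<lambda>\<omega>. X t \<omega> - X s \<omega>) = measure_pmf (poisson_pmf (\<mu> * (t - s)))) \<and>
     (\<forall>\<tau>::nat \<Rightarrow> real. \<forall>m. 0 \<le> \<tau> 0 \<longrightarrow> strict_mono \<tau> \<longrightarrow>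
        indep_vars (\<lambda>_. count_space UNIV) (\<lambda>j \<omega>. X (\<tau> (Suc j)) \<omega> - X (\<tau> j) \<omega>) {..<m})"

text \<open>The limit may live on a probability space of its own.\<close>

definition converges_in_distribution ::
    "'a measure \<Rightarrow> (nat \<Rightarrow> 'a \<Rightarrow> 'b::topological_space) \<Rightarrow> 'c measure \<Rightarrow> ('c \<Rightarrow> 'b) \<Rightarrow> bool" where
  "converges_in_distribution M X M' Y \<longleftrightarrow>
     (\<forall>f::'b \<Rightarrow> real. continuous_on UNIV f \<and> bounded (range f) \<longrightarrow>
        (\<lambda>n. \<integral>\<omega>. f (X n \<omega>) \<partial>M) \<longlonglongrightarrow> (\<integral>\<omega>. f (Y \<omega>) \<partial>M'))"

text \<open>Convergence to 0 in probability of nonnegative, possibly infinite quantities.  The outer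
  measure coincides with the probability on measurable sets; on arbitrary sets it avoids
  the value 0 that \<^const>\<open>measure\<close> assigns to every nonmeasurable set.\<close>

definition converges_to_0_in_probability :: "'a measure \<Rightarrow> (nat \<Rightarrow> 'a \<Rightarrow> ereal) \<Rightarrow> bool" where
  "converges_to_0_in_probability M X \<longleftrightarrow>
     (\<forall>\<epsilon>>0. (\<lambda>n. outer_measure_of M {\<omega> \<in> space M. X n \<omega> > ereal \<epsilon>}) \<longlonglongrightarrow> 0)"

section \<open>Dynamics, for a fixed sample point\<close>

text \<open>Customer indices, and hence the argument of \<open>ia\<close> and the second index of \<open>\<delta>\<close>,
  start at 1.  The supremum is meaningful when the partial sums of \<open>ia\<close> are unbounded.\<close>

definition arrivals :: "(nat \<Rightarrow> real) \<Rightarrow> real \<Rightarrow> real \<Rightarrow> nat" where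
  "arrivals ia rate t = Sup {l. (\<Sum>k=1..l. ia k / rate) \<le> t}"

definition arrival_time :: "(real \<Rightarrow> nat) \<Rightarrow> nat \<Rightarrow> real" where
  "arrival_time e j = Inf {t. 0 \<le> t \<and> j \<le> e t}"

definition left_lim :: "(real \<Rightarrow> 'b::t2_space) \<Rightarrow> real \<Rightarrow> 'b" where
  "left_lim f t = Lim (at_left t) f"

type_synonym 'k process = "'k \<Rightarrow> real \<Rightarrow> nat"
type_synonym 'k profile = "'k \<Rightarrow> nat \<Rightarrow> nat \<Rightarrow> nat" (* class, customer, queue length, decision in {0, 1} *)
type_synonym 'k scenario = "('k \<times> nat) option"

definition decisions :: "'k process \<Rightarrow> 'k profile \<Rightarrow> 'k process \<Rightarrow> 'k \<Rightarrow> nat \<Rightarrow> nat" where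
  "decisions E \<sigma> Q i j = \<sigma> i j (left_lim (Q i) (arrival_time (E i) j))"

definition joins :: "'k process \<Rightarrow> ('k \<Rightarrow> nat \<Rightarrow> nat) \<Rightarrow> 'k process" where
  "joins E \<delta> i t = (\<Sum>j=1..E i t. \<delta> i j)"

definition rejections :: "'k process \<Rightarrow> ('k \<Rightarrow> nat \<Rightarrow> nat) \<Rightarrow> 'k process" where
  "rejections E \<delta> i t = (\<Sum>j=1..E i t. 1 - \<delta> i j)"

datatype scheduling = FP | SLQ

text \<open>The measure \<open>db\<close> on the half line, including a possible atom at 0.\<close>

definition stieltjes :: "(real \<Rightarrow> nat) \<Rightarrow> real measure" where
  "stieltjes b = interval_measure (\<lambda>t. if t < 0 then 0 else real (b t))"

fun schedules :: "scheduling \<Rightarrow> 'k::{finite,linorder} process \<Rightarrow> 'k process \<Rightarrow> bool" where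
  "schedules FP Q B \<longleftrightarrow>
     (\<forall>i. (\<integral>\<^sup>+t\<in>{0..}. (\<Sum>k\<in>{..<i}. of_nat (Q k t)) \<partial>stieltjes (B i)) = 0)"
| "schedules SLQ Q B \<longleftrightarrow>
     (\<forall>i. (\<integral>\<^sup>+t\<in>{0..}. indicator {t. left_lim (Q i) t < (MAX k. left_lim (Q k) t)} t
              \<partial>stieltjes (B i)) = 0)"

text \<open>Under \<^const>\<open>SLQ\<close> every way of breaking ties is admitted.\<close>

definition system_path ::
    "scheduling \<Rightarrow> nat \<Rightarrow> 'k::{finite,linorder} process \<Rightarrow> 'k process \<Rightarrow> ('k \<Rightarrow> nat) \<Rightarrow> ('k \<Rightarrow> nat) \<Rightarrow>
     'k profile \<Rightarrow> 'k process \<Rightarrow> 'k process \<Rightarrow> 'k process \<Rightarrow> 'k process \<Rightarrow> bool" where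
  "system_path pol n E S q\<^sub>0 \<psi>\<^sub>0 \<sigma> Q \<Psi> B D \<longleftrightarrow>
     (\<forall>i. \<forall>t\<ge>0. continuous (at_right t) (Q i) \<and> continuous (at_right t) (\<Psi> i) \<and>
                continuous (at_right t) (B i) \<and> continuous (at_right t) (D i)) \<and>
     (\<forall>i. B i 0 = 0 \<and> mono_on {0..} (B i)) \<and>
     (\<forall>i. \<forall>t\<ge>0. int (Q i t) = int (q\<^sub>0 i) + int (E i t) - int (B i t)
                                - int (rejections E (decisions E \<sigma> Q) i t)) \<and>
     (\<forall>i. \<forall>t\<ge>0. int (\<Psi> i t) = int (\<psi>\<^sub>0 i) + int (B i t) - int (D i t)) \<and>
     (\<forall>i. \<forall>t\<ge>0. D i t = S i (integral {0..t} (\<lambda>u. real (\<Psi> i u)))) \<and>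
     (\<forall>t\<ge>0. (\<Sum>i\<in>UNIV. \<Psi> i t) \<le> n) \<and>
     (\<forall>t\<ge>0. (\<Sum>i\<in>UNIV. Q i t) > 0 \<longrightarrow> (\<Sum>i\<in>UNIV. \<Psi> i t) = n) \<and>
     schedules pol Q B"

section \<open>Joining, service and waiting times\<close>

text \<open>The arguments are the processes of a single class; \<open>b\<close> counts routings to service.\<close>

definition join_time :: "(real \<Rightarrow> nat) \<Rightarrow> real \<Rightarrow> ereal" where
  "join_time J t = Inf {ereal s | s. t \<le> s \<and> J s > (if t = 0 then 0 else left_lim J t)}"

definition service_time :: "(real \<Rightarrow> nat) \<Rightarrow> (real \<Rightarrow> nat) \<Rightarrow> (real \<Rightarrow> nat) \<Rightarrow> real \<Rightarrow> ereal" where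
  "service_time J b q t =
     (if join_time J t = \<infinity> then \<infinity>
      else let u = real_of_ereal (join_time J t) in Inf {ereal s | s. t < s \<and> b s \<ge> b u + q u})"

definition waiting_time :: "(real \<Rightarrow> nat) \<Rightarrow> (real \<Rightarrow> nat) \<Rightarrow> (real \<Rightarrow> nat) \<Rightarrow> real \<Rightarrow> ereal" where
  "waiting_time J b q t = service_time J b q t - join_time J t"

definition deviation ::
    "nat \<Rightarrow> real \<Rightarrow> (real \<Rightarrow> nat) \<Rightarrow> (real \<Rightarrow> nat) \<Rightarrow> (real \<Rightarrow> nat) \<Rightarrow> real \<Rightarrow> ereal" where
  "deviation n lam J b q t =
     (if join_time J t = \<infinity> \<or> service_time J b q t = \<infinity> then \<infinity>
      else ereal \<bar>real (q (real_of_ereal (join_time J t))) / sqrt n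
                   - lam * (sqrt n * real_of_ereal (waiting_time J b q t))\<bar>)"

section \<open>Strategies and scenarios\<close>

definition threshold_profile ::
    "('k \<Rightarrow> real) \<Rightarrow> ('k \<Rightarrow> real) \<Rightarrow> ('k \<Rightarrow> real \<Rightarrow> real) \<Rightarrow> nat \<Rightarrow> 'k profile" where
  "threshold_profile lam r h n i j q = (if h i (real q / (sqrt n * lam i)) \<le> r i then 1 else 0)"

text \<open>\<^const>\<open>None\<close> is the reference scenario.\<close>

definition scenarios :: "'k scenario set" where
  "scenarios = insert None (Some ` (UNIV \<times> {1..}))"

definition scenario_profile :: "'k profile \<Rightarrow> 'k scenario \<Rightarrow> 'k profile" where
  "scenario_profile \<sigma> s i j q = (if s = Some (i, j) then 1 - \<sigma> i j q else \<sigma> i j q)"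

end

theory Submission
  imports Defs "HOL-Real_Asymp.Real_Asymp"
begin

text \<open>
  The probabilistic input consists of events of probability close to 1 on which the arrival and
  service counts deviate from their means by at most \<open>\<epsilon> (sqrt n + n (t - s))\<close> on every interval
  \<open>[s, t]\<close>, and by \<open>O(sqrt n)\<close> overall.  On these events the argument is deterministic and applies
  to every scenario at once, since the single deviating customer shifts any count by at most 1.

  A Gronwall estimate, in which rejections are controlled through the last rejection (at which the
  queue is nonempty), bounds the queues and the deviations of the numbers in service from
  \<open>n rho\<close> by \<open>O(sqrt n)\<close>.  While a queue that should be short stays long, one class receives no
  service and the remaining queues drain at rate \<open>n lam i\<close>; hence the queue vector collapses, up to
  \<open>O(\<epsilon> sqrt n)\<close>, to a function of the total queue: all queues but the last vanish under FP, all
  queues agree under SLQ.  Then rejections only occur when the total queue is near its maximum, so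
  over windows of length \<open>O(1 / sqrt n)\<close> rejections and queue increments are \<open>O(\<epsilon> sqrt n)\<close>, and
  \<open>B i\<close> grows like \<open>n lam i\<close> per unit time.  A customer who finds \<open>q\<close> customers in the buffer
  therefore waits \<open>q / (n lam i)\<close>, up to \<open>O(\<epsilon> / sqrt n)\<close>.
\<close>

section \<open>Partial sums of i.i.d. nonnegative variables\<close>

text \<open>The linear slack in the window bound is what makes it available for all windows at once
  under a second moment only: Hoeffding then beats a union bound over order \<open>n^2\<close>
  windows for truncated variables, and the truncated tail is controlled in blocks of length about
  \<open>sqrt n\<close>. The slack is harmless later: draining queues have a drift that absorbs it,
  and otherwise only windows of length of order \<open>1 / sqrt n\<close> matter.

  The obstacle is a circle of dependencies: window length and rejection thresholds depend on the
  size of the queues, and the admissible noise \<open>eps\<close> depends on both. Two noise levels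
  break it. The level \<open>kap\<close>, possibly large and fixed by tightness alone, yields the a
  priori bound \<open>path_bound\<close>, which does not involve \<open>eps\<close>; thresholds and
  window length come next, then \<open>eps\<close>, and \<open>n\<close> last.

  No limit process or reflection map is used: as the \<open>rho i\<close> sum to 1 and servers do
  not idle, the total queue is the positive part of a process free of routing counts, from which
  rejections can be read off.\<close>

primrec stopped_sum :: "(real \<Rightarrow> bool) \<Rightarrow> (nat \<Rightarrow> real) \<Rightarrow> nat \<Rightarrow> nat \<Rightarrow> real" where
  "stopped_sum P f a 0 = 0"
| "stopped_sum P f a (Suc k) =
     stopped_sum P f a k + (if P (stopped_sum P f a k) then f (a + k) else 0)"

lemma stopped_sum_cong:
  "(\<And>i. a \<le> i \<Longrightarrow> i < a + k \<Longrightarrow> f i = f' i) \<Longrightarrow> stopped_sum P f a k = stopped_sum P f' a k"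
  by (induction k) auto

lemma stopped_sum_eq_sum:
  "(\<And>j. j < k \<Longrightarrow> P (\<Sum>i\<in>{a..<a + j}. f i)) \<Longrightarrow> stopped_sum P f a k = (\<Sum>i\<in>{a..<a + k}. f i)"
  by (induction k) auto

lemma stopped_sum_stays:
  assumes "\<not> P (stopped_sum P f a j)" "j \<le> k"
  shows "stopped_sum P f a k = stopped_sum P f a j"
  using assms(2) by (induction k rule: dec_induct) (use assms(1) in auto)

text \<open>At the first index \<open>j0\<close> where the plain sum violates \<open>P\<close> the
  stopped sum still agrees with it, and from then on it is frozen. Hence a violation anywhere along
  the path is visible in the single variable with index \<open>k\<close>.\<close>

lemma stopped_sum_exit:
  assumes "\<not> P (\<Sum>i\<in>{a..<a + j}. f i)" "j \<le> k"
  shows "\<not> P (stopped_sum P f a k)"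
proof -
  define j0 where "j0 = (LEAST j. \<not> P (\<Sum>i\<in>{a..<a + j}. f i))"
  have j0: "\<not> P (\<Sum>i\<in>{a..<a + j0}. f i)" unfolding j0_def by (rule LeastI) (rule assms(1))
  have "j0 \<le> j" unfolding j0_def by (rule Least_le) (rule assms(1))
  have "stopped_sum P f a j0 = (\<Sum>i\<in>{a..<a + j0}. f i)"
    by (rule stopped_sum_eq_sum) (use not_less_Least in \<open>auto simp: j0_def\<close>)
  then show ?thesis using stopped_sum_stays[of P f a j0 k] j0 \<open>j0 \<le> j\<close> assms(2) by simp
qed

lemma stopped_sum_measurable:
  assumes P: "Measurable.pred borel P" and "k \<le> n"
  shows "(\<lambda>f. stopped_sum P f a k) \<in> borel_measurable (PiM {a..<a + n} (\<lambda>_. borel))"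
  using assms(2)
proof (induction k)
  case (Suc k)
  then have IH [measurable]: "(\<lambda>f. stopped_sum P f a k) \<in> borel_measurable (PiM {a..<a + n} (\<lambda>_. borel))"
    by simp
  have [measurable]: "(\<lambda>f. f (a + k)) \<in> borel_measurable (PiM {a..<a + n} (\<lambda>_. borel))"
    using Suc by (intro measurable_component_singleton) simp
  note P[measurable]
  show ?case by simp
qed simp

context prob_space
begin

text \<open>The stopped sum is a measurable function of the coordinates below \<open>a + k\<close>,
  so grouping the independent family into these and the next coordinate suffices.\<close>

lemma indep_stopped_sum:
  assumes ind: "indep_vars (\<lambda>_. borel) W {a..a + k}" and P: "Measurable.pred borel P"
  shows "indep_var borel (\<lambda>\<omega>. stopped_sum P (\<lambda>i. W i \<omega>) a k) borel (W (a + k))"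
proof -
  have "indep_var borel ((\<lambda>f. stopped_sum P f a k) \<circ> (\<lambda>\<omega>. restrict (\<lambda>i. W i \<omega>) {a..<a + k}))
      borel ((\<lambda>f. f (a + k)) \<circ> (\<lambda>\<omega>. restrict (\<lambda>i. W i \<omega>) {a + k}))"
    by (intro indep_var_compose[OF indep_var_restrict[OF ind]] stopped_sum_measurable P
        measurable_component_singleton) auto
  moreover have "(\<lambda>f. stopped_sum P f a k) \<circ> (\<lambda>\<omega>. restrict (\<lambda>i. W i \<omega>) {a..<a + k}) =
      (\<lambda>\<omega>. stopped_sum P (\<lambda>i. W i \<omega>) a k)"
    unfolding comp_def by (intro ext stopped_sum_cong) simp
  moreover have "(\<lambda>f. f (a + k)) \<circ> (\<lambda>\<omega>. restrict (\<lambda>i. W i \<omega>) {a + k}) = W (a + k)"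
    by (simp add: comp_def)
  ultimately show ?thesis by (simp only:)
qed

text \<open>Optional stopping for second moments: an increment is \<open>W (a + j)\<close> times the
  indicator that the stopped sum still satisfies \<open>P\<close>, an event decided by earlier
  variables. The cross terms therefore have mean zero and the squares add up to at most
  \<open>v\<close> per step.\<close>

lemma stopped_sum_second_moment:
  assumes ind: "indep_vars (\<lambda>_. borel) W {a..<a + k}" and P: "Measurable.pred borel P"
    and W: "\<And>i. i \<in> {a..<a + k} \<Longrightarrow> integrable M (\<lambda>\<omega>. (W i \<omega>)\<^sup>2)"
      "\<And>i. i \<in> {a..<a + k} \<Longrightarrow> expectation (W i) = 0"
      "\<And>i. i \<in> {a..<a + k} \<Longrightarrow> expectation (\<lambda>\<omega>. (W i \<omega>)\<^sup>2) \<le> v"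
  shows "integrable M (\<lambda>\<omega>. (stopped_sum P (\<lambda>i. W i \<omega>) a k)\<^sup>2)"
    and "expectation (\<lambda>\<omega>. (stopped_sum P (\<lambda>i. W i \<omega>) a k)\<^sup>2) \<le> real k * v"
proof -
  have "integrable M (\<lambda>\<omega>. (stopped_sum P (\<lambda>i. W i \<omega>) a j)\<^sup>2) \<and>
    expectation (\<lambda>\<omega>. (stopped_sum P (\<lambda>i. W i \<omega>) a j)\<^sup>2) \<le> real j * v" if "j \<le> k" for j
    using that
  proof (induction j)
    case (Suc j)
    let ?T = "\<lambda>\<omega>. stopped_sum P (\<lambda>i. W i \<omega>) a j"
    let ?W = "W (a + j)"
    have j: "a + j \<in> {a..<a + k}" using Suc by simp
    have IH: "integrable M (\<lambda>\<omega>. (?T \<omega>)\<^sup>2)" "expectation (\<lambda>\<omega>. (?T \<omega>)\<^sup>2) \<le> real j * v"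
      using Suc by auto
    have "indep_vars (\<lambda>_. borel) W {a..a + j}"
      by (rule indep_vars_subset[OF ind]) (use Suc in auto)
    then have indep: "indep_var borel ?T borel ?W" by (rule indep_stopped_sum[OF _ P])
    then have [measurable]: "?T \<in> borel_measurable M" "?W \<in> borel_measurable M"
      by (auto dest: indep_var_rv1 indep_var_rv2)
    note P[measurable]
    \<comment> \<open>Carrying the indicator with the stopped sum makes the cross term a product of
      two independent integrable variables.\<close>
    let ?U = "\<lambda>\<omega>. if P (?T \<omega>) then ?T \<omega> else 0"
    have iT: "integrable M ?T" and iW: "integrable M ?W"
      using IH(1) W(1)[OF j] by (auto intro: square_integrable_imp_integrable)
    have "(\<lambda>x. if P x then x else 0) \<in> borel_measurable borel" by measurable
    from indep_var_compose[OF indep this measurable_ident]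
    have indepU: "indep_var borel ?U borel ?W" by (simp add: comp_def)
    have iU: "integrable M ?U" by (rule Bochner_Integration.integrable_bound[OF iT]) auto
    have UW: "expectation (\<lambda>\<omega>. ?U \<omega> * ?W \<omega>) = 0" "integrable M (\<lambda>\<omega>. ?U \<omega> * ?W \<omega>)"
      using indep_var_lebesgue_integral[OF indepU iU iW] indep_var_integrable[OF indepU iU iW] W(2)[OF j] by auto
    let ?V = "\<lambda>\<omega>. if P (?T \<omega>) then (?W \<omega>)\<^sup>2 else 0"
    have iV: "integrable M ?V"
      by (rule Bochner_Integration.integrable_bound[OF W(1)[OF j]]) auto
    have EV: "expectation ?V \<le> v"
      by (rule order_trans[OF integral_mono[OF iV W(1)[OF j]] W(3)[OF j]]) auto
    have eq: "(stopped_sum P (\<lambda>i. W i \<omega>) a (Suc j))\<^sup>2 = (?T \<omega>)\<^sup>2 + ?V \<omega> + 2 * (?U \<omega> * ?W \<omega>)" for \<omega>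
      by (simp add: power2_sum)
    show ?case
      unfolding eq using IH iV EV UW by (simp add: algebra_simps)
  qed simp
  from this[of k] show "integrable M (\<lambda>\<omega>. (stopped_sum P (\<lambda>i. W i \<omega>) a k)\<^sup>2)"
    and "expectation (\<lambda>\<omega>. (stopped_sum P (\<lambda>i. W i \<omega>) a k)\<^sup>2) \<le> real k * v" by auto
qed

text \<open>With \<open>P\<close> the condition that the absolute value is below \<open>c\<close>,
  the stopped sum remembers whether any partial sum reached \<open>c\<close>; Chebyshev applied to
  this one variable controls the maximum.\<close>

theorem Kolmogorov_inequality:
  assumes ind: "indep_vars (\<lambda>_. borel) W {a..<a + k}"
    and W: "\<And>i. i \<in> {a..<a + k} \<Longrightarrow> integrable M (\<lambda>\<omega>. (W i \<omega>)\<^sup>2)"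
      "\<And>i. i \<in> {a..<a + k} \<Longrightarrow> expectation (W i) = 0"
      "\<And>i. i \<in> {a..<a + k} \<Longrightarrow> expectation (\<lambda>\<omega>. (W i \<omega>)\<^sup>2) \<le> v"
    and c: "c > 0"
  shows "prob {\<omega>\<in>space M. \<exists>j\<le>k. c \<le> \<bar>\<Sum>i\<in>{a..<a + j}. W i \<omega>\<bar>} \<le> real k * v / c\<^sup>2"
proof -
  let ?T = "\<lambda>\<omega>. stopped_sum (\<lambda>x. \<bar>x\<bar> < c) (\<lambda>i. W i \<omega>) a k"
  note mom = stopped_sum_second_moment[OF ind _ W, where P = "\<lambda>x. \<bar>x\<bar> < c"]
  have meas: "W i \<in> borel_measurable M" if "i \<in> {a..<a + k}" for i
    using ind that by (auto simp: indep_vars_def)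
  have T: "?T \<in> borel_measurable M"
  proof -
    have "(\<lambda>\<omega>. restrict (\<lambda>i. W i \<omega>) {a..<a + k}) \<in> measurable M (PiM {a..<a + k} (\<lambda>_. borel))"
      by (intro measurable_restrict meas)
    from measurable_compose[OF this stopped_sum_measurable[of "\<lambda>x. \<bar>x\<bar> < c" k k a]]
    have "(\<lambda>\<omega>. stopped_sum (\<lambda>x. \<bar>x\<bar> < c) (restrict (\<lambda>i. W i \<omega>) {a..<a + k}) a k) \<in> borel_measurable M"
      by simp
    also have "(\<lambda>\<omega>. stopped_sum (\<lambda>x. \<bar>x\<bar> < c) (restrict (\<lambda>i. W i \<omega>) {a..<a + k}) a k) = ?T"
      by (intro ext stopped_sum_cong) simp
    finally show ?thesis .
  qed
  have "prob {\<omega>\<in>space M. \<exists>j\<le>k. c \<le> \<bar>\<Sum>i\<in>{a..<a + j}. W i \<omega>\<bar>} \<le> prob {\<omega>\<in>space M. c \<le> \<bar>?T \<omega>\<bar>}"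
  proof (rule finite_measure_mono)
    show "{\<omega>\<in>space M. \<exists>j\<le>k. c \<le> \<bar>\<Sum>i\<in>{a..<a + j}. W i \<omega>\<bar>} \<subseteq> {\<omega>\<in>space M. c \<le> \<bar>?T \<omega>\<bar>}"
      using stopped_sum_exit[where P = "\<lambda>x. \<bar>x\<bar> < c" and a = a and k = k] by (auto simp: not_less)
    show "{\<omega>\<in>space M. c \<le> \<bar>?T \<omega>\<bar>} \<in> events" using T by measurable
  qed
  also have "\<dots> \<le> expectation (\<lambda>\<omega>. (?T \<omega>)\<^sup>2) / c\<^sup>2"
    by (rule second_moment_method[OF T _ c]) (rule mom, auto)
  also have "\<dots> \<le> real k * v / c\<^sup>2"
    by (intro divide_right_mono mom) auto
  finally show ?thesis .
qed

end

text \<open>Serves both for interarrival times, with mean 1, and for Poisson increments over unit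
  intervals. Nonnegativity means that truncation from above at \<open>L\<close> leaves values in the
  bounded interval from 0 to \<open>L\<close>.\<close>

locale iid_nonneg = prob_space +
  fixes X :: "nat \<Rightarrow> 'a \<Rightarrow> real" and m :: real
  assumes indep: "\<And>k. indep_vars (\<lambda>_. borel) X {..<k}"
    and distr_eq: "\<And>j. distr M borel (X j) = distr M borel (X 0)"
    and nonneg: "\<And>j. AE \<omega> in M. 0 \<le> X j \<omega>"
    and square: "integrable M (\<lambda>\<omega>. (X 0 \<omega>)\<^sup>2)"
    and mean: "expectation (X 0) = m"
begin

lemma rv [measurable]: "X j \<in> borel_measurable M"
proof -
  have "\<forall>i\<in>{..<Suc j}. random_variable borel (X i)"
    using indep[of "Suc j"] unfolding indep_vars_def by (rule conjunct1)
  then show ?thesis by (rule bspec) simp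
qed

lemma transfer_X:
  fixes f :: "real \<Rightarrow> real"
  assumes [measurable]: "f \<in> borel_measurable borel"
  shows "integrable M (\<lambda>\<omega>. f (X j \<omega>)) \<longleftrightarrow> integrable M (\<lambda>\<omega>. f (X 0 \<omega>))"
    "expectation (\<lambda>\<omega>. f (X j \<omega>)) = expectation (\<lambda>\<omega>. f (X 0 \<omega>))"
proof -
  have "integrable (distr M borel (X j)) f \<longleftrightarrow> integrable M (\<lambda>\<omega>. f (X j \<omega>))" for j
    by (rule integrable_distr_eq) auto
  then show "integrable M (\<lambda>\<omega>. f (X j \<omega>)) \<longleftrightarrow> integrable M (\<lambda>\<omega>. f (X 0 \<omega>))"
    using distr_eq[of j] by metis
  have "integral\<^sup>L (distr M borel (X j)) f = expectation (\<lambda>\<omega>. f (X j \<omega>))" for j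
    by (rule integral_distr) auto
  then show "expectation (\<lambda>\<omega>. f (X j \<omega>)) = expectation (\<lambda>\<omega>. f (X 0 \<omega>))"
    using distr_eq[of j] by metis
qed

lemma indep_compose:
  fixes f :: "real \<Rightarrow> real"
  assumes "f \<in> borel_measurable borel" "finite I"
  shows "indep_vars (\<lambda>_. borel) (\<lambda>i \<omega>. f (X i \<omega>)) I"
proof -
  obtain k where "I \<subseteq> {..<k}" using assms(2) finite_nat_iff_bounded by blast
  then have "indep_vars (\<lambda>_. borel) X I" by (rule indep_vars_subset[OF indep])
  then show ?thesis by (rule indep_vars_compose2) (rule assms(1))
qed

lemma integrable_X: "integrable M (X 0)"
  by (rule square_integrable_imp_integrable[OF rv square])

text \<open>Kolmogorov's inequality over about \<open>C * n\<close> terms at level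
  \<open>\<kappa>' * sqrt n\<close> gives \<open>C * v / \<kappa>'^2\<close>, which is free of
  \<open>n\<close>.\<close>

lemma partial_sums_tight:
  assumes "\<delta> > 0" "C \<ge> 0"
  obtains \<kappa> where "\<kappa> \<ge> 1"
    "\<And>\<kappa>' (n::nat). \<kappa> \<le> \<kappa>' \<Longrightarrow> n \<ge> 1 \<Longrightarrow>
      prob {\<omega>\<in>space M. \<exists>l. real l \<le> C * n \<and> \<kappa>' * sqrt n \<le> \<bar>(\<Sum>i<l. X i \<omega>) - m * l\<bar>} \<le> \<delta>"
proof -
  define v where "v = expectation (\<lambda>\<omega>. (X 0 \<omega> - m)\<^sup>2)"
  have v: "v \<ge> 0" by (simp add: v_def)
  \<comment> \<open>The summand 1 makes the level at least 1, so that its square dominates it; the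
    other summand then brings \<open>C * v / \<kappa>'^2\<close> below
    \<open>\<delta>\<close>.\<close>
  define \<kappa> where "\<kappa> = 1 + C * v / \<delta>"
  have \<kappa>: "\<kappa> \<ge> 1" using assms v by (simp add: \<kappa>_def)
  have int0: "integrable M (\<lambda>\<omega>. (X 0 \<omega> - m)\<^sup>2)"
    unfolding power2_diff using square integrable_X by auto
  have main: "prob {\<omega>\<in>space M. \<exists>l. real l \<le> C * n \<and> \<kappa>' * sqrt n \<le> \<bar>(\<Sum>i<l. X i \<omega>) - m * l\<bar>} \<le> \<delta>"
    if \<kappa>': "\<kappa> \<le> \<kappa>'" and n: "n \<ge> 1" for \<kappa>' and n :: nat
  proof -
    define k where "k = nat \<lfloor>C * n\<rfloor>"
    have k: "real l \<le> C * n \<longleftrightarrow> l \<le> k" for l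
      using assms(2) by (simp add: k_def le_nat_iff le_floor_iff)
    have "{\<omega>\<in>space M. \<exists>l. real l \<le> C * n \<and> \<kappa>' * sqrt n \<le> \<bar>(\<Sum>i<l. X i \<omega>) - m * l\<bar>} =
      {\<omega>\<in>space M. \<exists>l\<le>k. \<kappa>' * sqrt n \<le> \<bar>\<Sum>i\<in>{0..<0 + l}. X i \<omega> - m\<bar>}"
      by (simp add: k sum_subtractf atLeast0LessThan mult.commute)
    also have "prob \<dots> \<le> real k * v / (\<kappa>' * sqrt n)\<^sup>2"
    proof (rule Kolmogorov_inequality)
      show "indep_vars (\<lambda>_. borel) (\<lambda>i \<omega>. X i \<omega> - m) {0..<0 + k}"
        by (rule indep_compose) auto
      show "integrable M (\<lambda>\<omega>. (X i \<omega> - m)\<^sup>2)" for i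
        using int0 by (subst transfer_X(1)) auto
      show "expectation (\<lambda>\<omega>. X i \<omega> - m) = 0" for i
        by (subst transfer_X(2)[of "\<lambda>x. x - m"]) (use integrable_X mean in \<open>auto simp: prob_space\<close>)
      show "expectation (\<lambda>\<omega>. (X i \<omega> - m)\<^sup>2) \<le> v" for i
        by (subst transfer_X(2)) (auto simp: v_def)
      show "0 < \<kappa>' * sqrt n" using \<kappa> \<kappa>' n by simp
    qed
    also have "\<dots> \<le> C * n * v / (\<kappa>' * sqrt n)\<^sup>2"
      using k[of k] v by (intro divide_right_mono mult_right_mono) auto
    also have "\<dots> = C * v / \<kappa>'\<^sup>2" using n by (simp add: power_mult_distrib)
    also have "\<dots> \<le> \<delta>"
    proof -
      have "C * v / \<delta> \<le> \<kappa>' * 1" using \<kappa>' \<kappa> by (simp add: \<kappa>_def)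
      also have "\<dots> \<le> \<kappa>' * \<kappa>'" using \<kappa> \<kappa>' by (intro mult_left_mono) auto
      finally show ?thesis using assms(1) \<kappa> \<kappa>' by (simp add: field_simps power2_eq_square)
    qed
    finally show ?thesis .
  qed
  show ?thesis by (rule that[OF \<kappa>]) (rule main, simp_all)
qed

text \<open>Dominated convergence with the square as majorant. The truncation level \<open>L\<close>
  obtained here does not depend on \<open>n\<close>.\<close>

lemma tail_second_moment:
  assumes "\<delta> > 0"
  obtains L where "L \<ge> 1" "expectation (\<lambda>\<omega>. (if X 0 \<omega> \<le> L then 0 else X 0 \<omega>)\<^sup>2) \<le> \<delta>"
proof -
  have "(\<lambda>j. expectation (\<lambda>\<omega>. (if X 0 \<omega> \<le> real j then 0 else X 0 \<omega>)\<^sup>2)) \<longlonglongrightarrow> expectation (\<lambda>\<omega>. 0)"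
  proof (rule integral_dominated_convergence[OF _ _ square])
    show "AE \<omega> in M. (\<lambda>j. (if X 0 \<omega> \<le> real j then 0 else X 0 \<omega>)\<^sup>2) \<longlonglongrightarrow> 0"
    proof (rule AE_I2)
      fix \<omega>
      have "\<forall>\<^sub>F j in sequentially. X 0 \<omega> \<le> real j" by real_asymp
      then have "\<forall>\<^sub>F j in sequentially. (if X 0 \<omega> \<le> real j then 0 else X 0 \<omega>)\<^sup>2 = 0"
        by eventually_elim simp
      then show "(\<lambda>j. (if X 0 \<omega> \<le> real j then 0 else X 0 \<omega>)\<^sup>2) \<longlonglongrightarrow> 0"
        by (rule tendsto_eventually)
    qed
  qed auto
  then have "\<forall>\<^sub>F j in sequentially. expectation (\<lambda>\<omega>. (if X 0 \<omega> \<le> real j then 0 else X 0 \<omega>)\<^sup>2) < \<delta>"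
    using assms by (simp add: order_tendstoD(2))
  then have "\<forall>\<^sub>F j in sequentially. expectation (\<lambda>\<omega>. (if X 0 \<omega> \<le> real j then 0 else X 0 \<omega>)\<^sup>2) < \<delta> \<and> 1 \<le> j"
    using eventually_ge_at_top[of 1] by eventually_elim simp
  then obtain j :: nat where "expectation (\<lambda>\<omega>. (if X 0 \<omega> \<le> real j then 0 else X 0 \<omega>)\<^sup>2) < \<delta>" "1 \<le> j"
    using eventually_happens by force
  then show ?thesis using that[of "real j"] by simp
qed

text \<open>For one window Hoeffding's bound is exponentially small in \<open>sqrt n\<close>,
  uniformly in the window length, and there are only order \<open>n^2\<close> windows. The centring
  uses the mean of the truncated variable, not \<open>m\<close>.\<close>

lemma truncated_window:
  assumes "\<epsilon> > 0" "\<delta> > 0" "C \<ge> 0" "L \<ge> 1"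
  defines "Y \<equiv> \<lambda>i \<omega>. if X i \<omega> \<le> L then X i \<omega> else 0"
  shows "\<forall>\<^sub>F n in sequentially. prob {\<omega>\<in>space M. \<exists>a b. a < b \<and> b \<le> nat \<lfloor>C * real n\<rfloor> \<and>
     \<epsilon> * (sqrt n + real (b - a)) \<le> \<bar>(\<Sum>i\<in>{a..<b}. Y i \<omega>) - real (b - a) * expectation (Y 0)\<bar>} \<le> \<delta>"
proof -
  have single: "prob {\<omega>\<in>space M. \<epsilon> * (sqrt n + real (b - a)) \<le>
      \<bar>(\<Sum>i\<in>{a..<b}. Y i \<omega>) - real (b - a) * expectation (Y 0)\<bar>} \<le> 2 * exp (- 8 * \<epsilon>\<^sup>2 * sqrt n / L\<^sup>2)"
    if "a < b" for a b n :: nat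
  proof -
    have "expectation (Y i) = expectation (Y 0)" for i
      unfolding Y_def by (rule transfer_X(2)[of "\<lambda>x. if x \<le> L then x else 0"]) measurable
    then have Y_mean: "(\<Sum>i\<in>{a..<b}. expectation (Y i)) = real (b - a) * expectation (Y 0)"
      by (subst sum.cong[OF refl, of _ _ "\<lambda>_. expectation (Y 0)"]) auto
    interpret H: Hoeffding_ineq M "{a..<b}" Y "\<lambda>_. 0" "\<lambda>_. L" "\<Sum>i\<in>{a..<b}. expectation (Y i)"
    proof unfold_locales
      show "indep_vars (\<lambda>_. borel) Y {a..<b}"
        unfolding Y_def by (rule indep_compose[of "\<lambda>x. if x \<le> L then x else 0"]) auto
      show "AE \<omega> in M. Y i \<omega> \<in> {0..L}" for i
        using nonneg[of i] by eventually_elim (use \<open>L \<ge> 1\<close> in \<open>auto simp: Y_def\<close>)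
    qed (simp_all only: finite_atLeastLessThan)
    let ?l = "real (b - a)"
    have l: "?l > 0" using that by simp
    have "prob {\<omega>\<in>space M. \<epsilon> * (sqrt n + ?l) \<le> \<bar>(\<Sum>i\<in>{a..<b}. Y i \<omega>) - ?l * expectation (Y 0)\<bar>} \<le>
        2 * exp (- 2 * (\<epsilon> * (sqrt n + ?l))\<^sup>2 / (?l * L\<^sup>2))"
      using H.Hoeffding_ineq_abs_ge[of "\<epsilon> * (sqrt n + ?l)"] that \<open>L \<ge> 1\<close> \<open>\<epsilon> > 0\<close>
      unfolding Y_mean by simp
    also have "\<dots> \<le> 2 * exp (- 8 * \<epsilon>\<^sup>2 * sqrt n / L\<^sup>2)"
    proof -
      \<comment> \<open>The arithmetic-geometric mean inequality cancels the length of the window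
        from the Hoeffding exponent.\<close>
      have "4 * sqrt n * ?l \<le> (sqrt n + ?l)\<^sup>2"
        using sum_squares_bound[of "sqrt n" ?l] by (simp add: power2_sum)
      then have "2 * \<epsilon>\<^sup>2 * (4 * sqrt n * ?l) \<le> 2 * \<epsilon>\<^sup>2 * (sqrt n + ?l)\<^sup>2"
        by (intro mult_left_mono) auto
      then have "2 * \<epsilon>\<^sup>2 * (4 * sqrt n * ?l) / (?l * L\<^sup>2) \<le> 2 * \<epsilon>\<^sup>2 * (sqrt n + ?l)\<^sup>2 / (?l * L\<^sup>2)"
        using l by (intro divide_right_mono) auto
      moreover have "2 * \<epsilon>\<^sup>2 * (4 * sqrt n * ?l) / (?l * L\<^sup>2) = 8 * \<epsilon>\<^sup>2 * sqrt n / L\<^sup>2"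
        using l by simp
      ultimately show ?thesis by (simp add: power_mult_distrib mult.assoc)
    qed
    finally show ?thesis .
  qed
  have bound: "prob {\<omega>\<in>space M. \<exists>a b. a < b \<and> b \<le> nat \<lfloor>C * real n\<rfloor> \<and>
     \<epsilon> * (sqrt n + real (b - a)) \<le> \<bar>(\<Sum>i\<in>{a..<b}. Y i \<omega>) - real (b - a) * expectation (Y 0)\<bar>}
     \<le> 2 * (C * n + 1)\<^sup>2 * exp (- 8 * \<epsilon>\<^sup>2 * sqrt n / L\<^sup>2)" (is "prob ?A \<le> _") for n :: nat
  proof -
    define k where "k = nat \<lfloor>C * real n\<rfloor>"
    define P where "P = {p \<in> {..k} \<times> {..k}. fst p < snd p}"
    define F where "F p = {\<omega>\<in>space M. \<epsilon> * (sqrt n + real (snd p - fst p)) \<le>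
      \<bar>(\<Sum>i\<in>{fst p..<snd p}. Y i \<omega>) - real (snd p - fst p) * expectation (Y 0)\<bar>}" for p
    have [measurable]: "Y i \<in> borel_measurable M" for i unfolding Y_def by measurable
    have F: "F p \<in> events" for p unfolding F_def by measurable
    have fin: "finite P" by (simp add: P_def)
    have "?A \<subseteq> (\<Union>p\<in>P. F p)"
    proof
      fix \<omega> assume "\<omega> \<in> ?A"
      then obtain a b where ab: "\<omega> \<in> space M" "a < b" "b \<le> k"
        "\<epsilon> * (sqrt n + real (b - a)) \<le> \<bar>(\<Sum>i\<in>{a..<b}. Y i \<omega>) - real (b - a) * expectation (Y 0)\<bar>"
        unfolding k_def by blast
      then have "(a, b) \<in> P" "\<omega> \<in> F (a, b)" by (simp_all add: P_def F_def)
      then show "\<omega> \<in> (\<Union>p\<in>P. F p)" by blast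
    qed
    then have "prob ?A \<le> prob (\<Union>p\<in>P. F p)"
      using F fin by (intro finite_measure_mono) auto
    also have "\<dots> \<le> (\<Sum>p\<in>P. prob (F p))"
      using F by (intro finite_measure_subadditive_finite fin) auto
    also have "\<dots> \<le> (\<Sum>p\<in>P. 2 * exp (- 8 * \<epsilon>\<^sup>2 * sqrt n / L\<^sup>2))"
    proof (rule sum_mono)
      fix p assume "p \<in> P"
      then show "prob (F p) \<le> 2 * exp (- 8 * \<epsilon>\<^sup>2 * sqrt n / L\<^sup>2)"
        unfolding F_def by (intro single) (simp add: P_def)
    qed
    also have "\<dots> = card P * (2 * exp (- 8 * \<epsilon>\<^sup>2 * sqrt n / L\<^sup>2))" by simp
    also have "\<dots> \<le> (C * n + 1)\<^sup>2 * (2 * exp (- 8 * \<epsilon>\<^sup>2 * sqrt n / L\<^sup>2))"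
    proof (rule mult_right_mono)
      have "card P \<le> card ({..k} \<times> {..k})" unfolding P_def by (intro card_mono) auto
      then have "card P \<le> (k + 1) * (k + 1)" by simp
      then have "real (card P) \<le> real ((k + 1) * (k + 1))" by (simp only: of_nat_le_iff)
      then have "real (card P) \<le> (real k + 1)\<^sup>2" by (simp add: power2_eq_square algebra_simps)
      also have "\<dots> \<le> (C * n + 1)\<^sup>2"
        using \<open>C \<ge> 0\<close> by (intro power_mono) (auto simp: k_def)
      finally show "real (card P) \<le> (C * n + 1)\<^sup>2" .
    qed simp
    finally show ?thesis by (simp add: mult.assoc mult.left_commute)
  qed
  have "((\<lambda>n. 2 * (C * real n + 1)\<^sup>2 * exp (- 8 * \<epsilon>\<^sup>2 * sqrt n / L\<^sup>2)) \<longlongrightarrow> 0) sequentially"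
  proof -
    define c where "c = 8 * \<epsilon>\<^sup>2 / L\<^sup>2"
    have "c > 0" using assms by (simp add: c_def)
    have "((\<lambda>n. 2 * (C * real n + 1)\<^sup>2 * exp (- c * sqrt n)) \<longlongrightarrow> 0) sequentially"
    proof (cases "C = 0")
      case True
      show ?thesis unfolding True using \<open>c > 0\<close> by real_asymp
    next
      case False
      then have "C > 0" using \<open>C \<ge> 0\<close> by simp
      then show ?thesis using \<open>c > 0\<close> by real_asymp
    qed
    then show ?thesis by (simp add: c_def)
  qed
  then have "\<forall>\<^sub>F n in sequentially. 2 * (C * real n + 1)\<^sup>2 * exp (- 8 * \<epsilon>\<^sup>2 * sqrt n / L\<^sup>2) < \<delta>"
    using \<open>\<delta> > 0\<close> by (rule order_tendstoD(2))
  then show ?thesis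
  proof eventually_elim
    case (elim n)
    then show ?case using bound[of n] by linarith
  qed
qed

end

text \<open>The window is covered by consecutive blocks of length \<open>d\<close>; the summand 2
  pays for the blocks cut by its two ends.\<close>

lemma sum_blocks_le:
  fixes f :: "nat \<Rightarrow> real"
  assumes f: "\<And>i. f i \<ge> 0" and c: "\<And>j. j \<le> k div d \<Longrightarrow> (\<Sum>i\<in>{j * d..<j * d + d}. f i) \<le> c"
    and ab: "a < b" "b \<le> k" and d: "d > 0" and c0: "c \<ge> 0"
  shows "(\<Sum>i\<in>{a..<b}. f i) \<le> (real (b - a) / real d + 2) * c"
proof -
  let ?p = "a div d" and ?q = "b div d"
  have pq: "?p \<le> ?q" using ab by (intro div_le_mono) simp
  have "(\<Sum>i\<in>{a..<b}. f i) \<le> (\<Sum>i\<in>{?p * d..<Suc ?q * d}. f i)"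
  proof (rule sum_mono2)
    have "b < Suc ?q * d" using d by (metis div_less_iff_less_mult lessI)
    moreover have "?p * d \<le> a" by simp
    ultimately show "{a..<b} \<subseteq> {?p * d..<Suc ?q * d}" by auto
  qed (use f in auto)
  also have "\<dots> = (\<Sum>i<Suc ?q * d. f i) - (\<Sum>i<?p * d. f i)"
  proof -
    have "?p * d \<le> Suc ?q * d" using pq by (intro mult_le_mono1) simp
    then show ?thesis using sum.atLeastLessThan_concat[of 0 "?p * d" "Suc ?q * d" f]
      by (simp add: atLeast0LessThan)
  qed
  also have "\<dots> = (\<Sum>j<Suc ?q. \<Sum>i\<in>{j * d..<j * d + d}. f i) - (\<Sum>j<?p. \<Sum>i\<in>{j * d..<j * d + d}. f i)"
    by (simp only: sum.nat_group)
  also have "\<dots> = (\<Sum>j\<in>{?p..<Suc ?q}. \<Sum>i\<in>{j * d..<j * d + d}. f i)"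
    using pq sum.atLeastLessThan_concat[of 0 ?p "Suc ?q" "\<lambda>j. \<Sum>i\<in>{j * d..<j * d + d}. f i"]
    by (simp add: atLeast0LessThan)
  also have "\<dots> \<le> (\<Sum>j\<in>{?p..<Suc ?q}. c)"
  proof (rule sum_mono)
    fix j assume "j \<in> {?p..<Suc ?q}"
    moreover have "?q \<le> k div d" using ab by (intro div_le_mono) simp
    ultimately show "(\<Sum>i\<in>{j * d..<j * d + d}. f i) \<le> c" by (intro c) auto
  qed
  also have "\<dots> = (real ?q - real ?p + 1) * c" using pq by (simp add: of_nat_diff algebra_simps)
  also have "\<dots> \<le> (real (b - a) / real d + 2) * c"
  proof (rule mult_right_mono[OF _ c0])
    have "real ?q \<le> real b / real d" by (rule of_nat_div_le_of_nat)
    moreover have "real a / real d - 1 \<le> real ?p"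
      using floor_divide_of_nat_eq[of a d, where 'a = real] by linarith
    moreover have "real (b - a) / real d = real b / real d - real a / real d"
      using ab by (simp add: of_nat_diff diff_divide_distrib)
    ultimately show "real ?q - real ?p + 1 \<le> real (b - a) / real d + 2" by linarith
  qed
  finally show ?thesis .
qed

context iid_nonneg
begin

text \<open>There are order \<open>sqrt n\<close> blocks, and Kolmogorov's inequality makes each of
  them heavy with probability of order \<open>v / sqrt n\<close>, where \<open>v\<close> is the
  second moment of the tail variable. The factors in \<open>n\<close> cancel exactly, so smallness
  must come from \<open>v\<close>: this is where a second moment, with \<open>L\<close> large,
  suffices.\<close>

lemma tail_blocks:
  assumes "\<epsilon> > 0" "\<epsilon> \<le> 1" "\<delta> > 0" "C \<ge> 0" "L \<ge> 1"
  defines "Z \<equiv> \<lambda>i \<omega>. if X i \<omega> \<le> L then 0 else X i \<omega>"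
  assumes small: "expectation (\<lambda>\<omega>. (Z 0 \<omega>)\<^sup>2) \<le> \<epsilon> / 4"
    "8 * (C + 1) * expectation (\<lambda>\<omega>. (Z 0 \<omega>)\<^sup>2) \<le> \<delta> * \<epsilon>\<^sup>2" and n: "n \<ge> (1::nat)"
  defines "d \<equiv> nat \<lceil>sqrt n\<rceil>"
  shows "prob {\<omega>\<in>space M. \<exists>j\<le>nat \<lfloor>C * real n\<rfloor> div d. \<epsilon> * sqrt n \<le> (\<Sum>i\<in>{j * d..<j * d + d}. Z i \<omega>)} \<le> \<delta>"
proof -
  define v where "v = expectation (\<lambda>\<omega>. (Z 0 \<omega>)\<^sup>2)"
  have v: "0 \<le> v" by (simp add: v_def)
  have [measurable]: "Z i \<in> borel_measurable M" for i unfolding Z_def by measurable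
  have sq: "integrable M (\<lambda>\<omega>. (Z 0 \<omega>)\<^sup>2)"
    by (rule Bochner_Integration.integrable_bound[OF square]) (auto simp: Z_def)
  have int: "integrable M (Z 0)" by (rule square_integrable_imp_integrable[OF _ sq]) measurable
  define e where "e = expectation (Z 0)"
  \<comment> \<open>A tail variable is 0 or exceeds \<open>L \<ge> 1\<close>, so it is bounded by
    its square and its mean by its second moment.\<close>
  have e: "0 \<le> e" "e \<le> v"
  proof -
    show "0 \<le> e" unfolding e_def by (rule Bochner_Integration.integral_nonneg) (use \<open>L \<ge> 1\<close> in \<open>auto simp: Z_def\<close>)
    show "e \<le> v" unfolding e_def v_def
    proof (rule integral_mono[OF int sq])
      fix \<omega>
      show "Z 0 \<omega> \<le> (Z 0 \<omega>)\<^sup>2" using \<open>L \<ge> 1\<close> by (auto simp: Z_def power2_eq_square)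
    qed
  qed
  have Zf: "integrable M (\<lambda>\<omega>. f (Z i \<omega>)) \<longleftrightarrow> integrable M (\<lambda>\<omega>. f (Z 0 \<omega>))"
    "expectation (\<lambda>\<omega>. f (Z i \<omega>)) = expectation (\<lambda>\<omega>. f (Z 0 \<omega>))"
    if "f \<in> borel_measurable borel" for f :: "real \<Rightarrow> real" and i
    unfolding Z_def using that
    by (auto intro!: transfer_X[of "\<lambda>x. f (if x \<le> L then 0 else x)"])
  have d: "sqrt n \<le> d" "d \<le> 2 * sqrt n" "d > 0"
    using n real_sqrt_ge_1_iff[of n] unfolding d_def by linarith+
  have block: "prob {\<omega>\<in>space M. \<epsilon> * sqrt n \<le> (\<Sum>i\<in>{j * d..<j * d + d}. Z i \<omega>)} \<le> 8 * v / (\<epsilon>\<^sup>2 * sqrt n)" for j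
  proof -
    let ?W = "\<lambda>i \<omega>. Z i \<omega> - e"
    have W2: "expectation (\<lambda>\<omega>. (?W i \<omega>)\<^sup>2) \<le> v" for i
    proof -
      have "expectation (\<lambda>\<omega>. (?W i \<omega>)\<^sup>2) = expectation (\<lambda>\<omega>. (?W 0 \<omega>)\<^sup>2)"
        by (rule Zf(2)) measurable
      also have "\<dots> = v - e\<^sup>2"
        unfolding e_def v_def using variance_eq[OF int sq] by simp
      finally show ?thesis by simp
    qed
    \<comment> \<open>The first smallness condition makes the mean of a block at most half the
      level, leaving the other half for fluctuations.\<close>
    have de: "real d * e \<le> \<epsilon> / 2 * sqrt n"
    proof -
      have "real d * e \<le> (2 * sqrt n) * (\<epsilon> / 4)"
        using d e small(1) by (intro mult_mono) (auto simp: v_def)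
      then show ?thesis by simp
    qed
    have "prob {\<omega>\<in>space M. \<epsilon> * sqrt n \<le> (\<Sum>i\<in>{j * d..<j * d + d}. Z i \<omega>)} \<le>
      prob {\<omega>\<in>space M. \<exists>l\<le>d. \<epsilon> / 2 * sqrt n \<le> \<bar>\<Sum>i\<in>{j * d..<j * d + l}. ?W i \<omega>\<bar>}"
    proof (rule finite_measure_mono)
      show "{\<omega>\<in>space M. \<epsilon> * sqrt n \<le> (\<Sum>i\<in>{j * d..<j * d + d}. Z i \<omega>)} \<subseteq>
        {\<omega>\<in>space M. \<exists>l\<le>d. \<epsilon> / 2 * sqrt n \<le> \<bar>\<Sum>i\<in>{j * d..<j * d + l}. ?W i \<omega>\<bar>}"
      proof (intro subsetI, elim CollectE conjE)
        fix \<omega> assume \<omega>: "\<omega> \<in> space M" and *: "\<epsilon> * sqrt n \<le> (\<Sum>i\<in>{j * d..<j * d + d}. Z i \<omega>)"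
        have "(\<Sum>i\<in>{j * d..<j * d + d}. ?W i \<omega>) = (\<Sum>i\<in>{j * d..<j * d + d}. Z i \<omega>) - real d * e"
          by (simp add: sum_subtractf)
        moreover have "\<epsilon> * sqrt n - \<epsilon> / 2 * sqrt n = \<epsilon> / 2 * sqrt n" by simp
        ultimately have "\<epsilon> / 2 * sqrt n \<le> \<bar>\<Sum>i\<in>{j * d..<j * d + d}. ?W i \<omega>\<bar>" using de * by linarith
        then show "\<omega> \<in> {\<omega>\<in>space M. \<exists>l\<le>d. \<epsilon> / 2 * sqrt n \<le> \<bar>\<Sum>i\<in>{j * d..<j * d + l}. ?W i \<omega>\<bar>}"
          using \<omega> by blast
      qed
    qed measurable
    also have "\<dots> \<le> real d * v / (\<epsilon> / 2 * sqrt n)\<^sup>2"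
    proof (rule Kolmogorov_inequality)
      show "indep_vars (\<lambda>_. borel) ?W {j * d..<j * d + d}"
        unfolding Z_def by (rule indep_compose[of "\<lambda>x. (if x \<le> L then 0 else x) - e"]) auto
      show "integrable M (\<lambda>\<omega>. (?W i \<omega>)\<^sup>2)" for i
        by (subst Zf(1)) (use sq int in \<open>auto simp: power2_diff\<close>)
      show "expectation (?W i) = 0" for i
        by (subst Zf(2)[of "\<lambda>x. x - e"]) (use int in \<open>auto simp: e_def prob_space\<close>)
      show "0 < \<epsilon> / 2 * sqrt n" using n \<open>\<epsilon> > 0\<close> by simp
    qed (rule W2)
    also have "\<dots> \<le> (2 * sqrt n) * v / (\<epsilon> / 2 * sqrt n)\<^sup>2"
      using d v by (intro divide_right_mono mult_right_mono) auto
    also have "\<dots> = 8 * v / (\<epsilon>\<^sup>2 * sqrt n)"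
      using n \<open>\<epsilon> > 0\<close> by (simp add: power2_eq_square field_simps)
    finally show ?thesis .
  qed
  define k where "k = nat \<lfloor>C * real n\<rfloor> div d"
  have k: "real k + 1 \<le> (C + 1) * sqrt n"
  proof -
    have "real k \<le> real (nat \<lfloor>C * real n\<rfloor>) / real d" unfolding k_def by (rule of_nat_div_le_of_nat)
    also have "\<dots> \<le> (C * n) / sqrt n"
      using d n \<open>C \<ge> 0\<close> by (intro frac_le) auto
    also have "\<dots> = C * sqrt n" by (metis of_nat_0_le_iff real_div_sqrt times_divide_eq_right)
    finally have "real k \<le> C * sqrt n" .
    moreover have "1 \<le> sqrt n" using n by simp
    ultimately show ?thesis unfolding distrib_right by linarith
  qed
  have "{\<omega>\<in>space M. \<exists>j\<le>k. \<epsilon> * sqrt n \<le> (\<Sum>i\<in>{j * d..<j * d + d}. Z i \<omega>)} =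
      (\<Union>j\<in>{..k}. {\<omega>\<in>space M. \<epsilon> * sqrt n \<le> (\<Sum>i\<in>{j * d..<j * d + d}. Z i \<omega>)})" by auto
  also have "prob \<dots> \<le> (\<Sum>j\<in>{..k}. prob {\<omega>\<in>space M. \<epsilon> * sqrt n \<le> (\<Sum>i\<in>{j * d..<j * d + d}. Z i \<omega>)})"
    by (intro finite_measure_subadditive_finite) auto
  also have "\<dots> \<le> (\<Sum>j\<in>{..k}. 8 * v / (\<epsilon>\<^sup>2 * sqrt n))"
    by (intro sum_mono block)
  also have "\<dots> = (real k + 1) * (8 * v / (\<epsilon>\<^sup>2 * sqrt n))" by simp
  also have "\<dots> \<le> (C + 1) * sqrt n * (8 * v / (\<epsilon>\<^sup>2 * sqrt n))"
    using k v by (intro mult_right_mono) auto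
  also have "\<dots> = 8 * (C + 1) * v / \<epsilon>\<^sup>2"
  proof -
    have "sqrt n \<noteq> 0" using n by simp
    then show ?thesis by simp
  qed
  also have "\<dots> \<le> \<delta>"
    using small(2) \<open>\<epsilon> > 0\<close> by (simp add: pos_divide_le_eq v_def)
  finally show ?thesis by (simp add: k_def)
qed

text \<open>Split at \<open>L\<close>: the truncated part obeys the Hoeffding window bound, the tail
  part is bounded by its blocks, and \<open>m\<close> is the sum of the two means. The blocks
  contribute \<open>\<epsilon>'\<close> per index up to two boundary blocks of weight
  \<open>\<epsilon>' * sqrt n\<close>, which is the form of the claim.\<close>

theorem partial_sums_window:
  assumes "\<epsilon> > 0" "\<delta> > 0" "C \<ge> 0"
  shows "\<forall>\<^sub>F n in sequentially. prob {\<omega>\<in>space M. \<exists>a b. a \<le> b \<and> b \<le> nat \<lfloor>C * real n\<rfloor> \<and>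
     \<epsilon> * (sqrt n + real (b - a)) < \<bar>(\<Sum>i\<in>{a..<b}. X i \<omega>) - m * real (b - a)\<bar>} \<le> \<delta>"
proof -
  \<comment> \<open>The factor 4 covers the total error of at most
    \<open>\<epsilon>' * (3 * sqrt n + 2 * (b - a))\<close>; the cap 1 meets the hypothesis of
    \<open>tail_blocks\<close>.\<close>
  define \<epsilon>' where "\<epsilon>' = min 1 (\<epsilon> / 4)"
  have \<epsilon>': "0 < \<epsilon>'" "\<epsilon>' \<le> 1" "4 * \<epsilon>' \<le> \<epsilon>" using assms by (auto simp: \<epsilon>'_def)
  define \<delta>' where "\<delta>' = min (\<epsilon>' / 4) (\<delta> / 2 * \<epsilon>'\<^sup>2 / (8 * (C + 1)))"
  have "\<delta>' > 0" using \<epsilon>' assms by (auto simp: \<delta>'_def)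
  then obtain L where L: "L \<ge> 1" "expectation (\<lambda>\<omega>. (if X 0 \<omega> \<le> L then 0 else X 0 \<omega>)\<^sup>2) \<le> \<delta>'"
    by (rule tail_second_moment)
  define Y where "Y = (\<lambda>i \<omega>. if X i \<omega> \<le> L then X i \<omega> else 0)"
  define Z where "Z = (\<lambda>i \<omega>. if X i \<omega> \<le> L then 0 else X i \<omega>)"
  have [measurable]: "Y i \<in> borel_measurable M" "Z i \<in> borel_measurable M" for i
    unfolding Y_def Z_def by measurable
  have small: "expectation (\<lambda>\<omega>. (if X 0 \<omega> \<le> L then 0 else X 0 \<omega>)\<^sup>2) \<le> \<epsilon>' / 4"
    "8 * (C + 1) * expectation (\<lambda>\<omega>. (if X 0 \<omega> \<le> L then 0 else X 0 \<omega>)\<^sup>2) \<le> \<delta> / 2 * \<epsilon>'\<^sup>2"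
    using L(2) assms(3) by (auto simp: \<delta>'_def field_simps)
  have sq: "integrable M (\<lambda>\<omega>. (Z 0 \<omega>)\<^sup>2)"
    by (rule Bochner_Integration.integrable_bound[OF square]) (auto simp: Z_def)
  have intZ: "integrable M (Z 0)" by (rule square_integrable_imp_integrable[OF _ sq]) measurable
  have intY: "integrable M (Y 0)"
    by (rule Bochner_Integration.integrable_bound[OF integrable_X]) (auto simp: Y_def)
  have EZ: "0 \<le> expectation (Z 0)" "expectation (Z 0) \<le> \<epsilon>'"
  proof -
    show "0 \<le> expectation (Z 0)"
      by (rule Bochner_Integration.integral_nonneg) (use \<open>L \<ge> 1\<close> in \<open>auto simp: Z_def\<close>)
    have "expectation (Z 0) \<le> expectation (\<lambda>\<omega>. (Z 0 \<omega>)\<^sup>2)"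
    proof (rule integral_mono[OF intZ sq])
      fix \<omega>
      show "Z 0 \<omega> \<le> (Z 0 \<omega>)\<^sup>2" using \<open>L \<ge> 1\<close> by (auto simp: Z_def power2_eq_square)
    qed
    then show "expectation (Z 0) \<le> \<epsilon>'" using small(1) \<epsilon>' by (simp add: Z_def)
  qed
  have YZ: "X i \<omega> = Y i \<omega> + Z i \<omega>" for i \<omega> by (simp add: Y_def Z_def)
  have m: "m = expectation (Y 0) + expectation (Z 0)"
    unfolding mean[symmetric] YZ by (rule Bochner_Integration.integral_add[OF intY intZ])
  define H where "H n = {\<omega>\<in>space M. \<exists>a b. a < b \<and> b \<le> nat \<lfloor>C * real n\<rfloor> \<and>
     \<epsilon>' * (sqrt n + real (b - a)) \<le> \<bar>(\<Sum>i\<in>{a..<b}. Y i \<omega>) - real (b - a) * expectation (Y 0)\<bar>}" for n :: nat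
  define d where "d n = nat \<lceil>sqrt (real n)\<rceil>" for n :: nat
  define U where "U n = {\<omega>\<in>space M. \<exists>j\<le>nat \<lfloor>C * real n\<rfloor> div d n.
     \<epsilon>' * sqrt n \<le> (\<Sum>i\<in>{j * d n..<j * d n + d n}. Z i \<omega>)}" for n :: nat
  have "\<forall>\<^sub>F n in sequentially. prob (H n) \<le> \<delta> / 2"
    unfolding H_def Y_def using truncated_window[OF \<epsilon>'(1) _ assms(3) L(1), of "\<delta> / 2"] assms(2) by simp
  then show ?thesis using eventually_ge_at_top[of 1]
  proof eventually_elim
    case (elim n)
    have d: "sqrt n \<le> d n" "d n > 0"
      using elim(2) real_sqrt_ge_1_iff[of n] unfolding d_def by linarith+
    have U: "prob (U n) \<le> \<delta> / 2"
      unfolding U_def Z_def d_def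
      by (rule tail_blocks[OF \<epsilon>'(1,2) _ assms(3) L(1) small elim(2)]) (use assms(2) in simp)
    have "{\<omega>\<in>space M. \<exists>a b. a \<le> b \<and> b \<le> nat \<lfloor>C * real n\<rfloor> \<and>
       \<epsilon> * (sqrt n + real (b - a)) < \<bar>(\<Sum>i\<in>{a..<b}. X i \<omega>) - m * real (b - a)\<bar>} \<subseteq> H n \<union> U n"
    proof
      fix \<omega> assume "\<omega> \<in> {\<omega>\<in>space M. \<exists>a b. a \<le> b \<and> b \<le> nat \<lfloor>C * real n\<rfloor> \<and>
       \<epsilon> * (sqrt n + real (b - a)) < \<bar>(\<Sum>i\<in>{a..<b}. X i \<omega>) - m * real (b - a)\<bar>}"
      then obtain a b where ab: "\<omega> \<in> space M" "a \<le> b" "b \<le> nat \<lfloor>C * real n\<rfloor>"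
        "\<epsilon> * (sqrt n + real (b - a)) < \<bar>(\<Sum>i\<in>{a..<b}. X i \<omega>) - m * real (b - a)\<bar>" by blast
      have "a < b"
      proof (rule ccontr)
        assume "\<not> a < b"
        then have "\<epsilon> * sqrt n < 0" using ab by simp
        moreover have "0 \<le> \<epsilon> * sqrt n" using assms(1) by simp
        ultimately show False by simp
      qed
      show "\<omega> \<in> H n \<union> U n"
      proof (rule ccontr)
        assume not: "\<omega> \<notin> H n \<union> U n"
        let ?l = "real (b - a)"
        have 1: "\<bar>(\<Sum>i\<in>{a..<b}. Y i \<omega>) - ?l * expectation (Y 0)\<bar> \<le> \<epsilon>' * (sqrt n + ?l)"
        proof (rule ccontr)
          assume "\<not> ?thesis"
          then have "\<epsilon>' * (sqrt n + ?l) \<le> \<bar>(\<Sum>i\<in>{a..<b}. Y i \<omega>) - ?l * expectation (Y 0)\<bar>" by simp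
          then have "\<omega> \<in> H n" unfolding H_def using ab(1,3) \<open>a < b\<close> by blast
          then show False using not by simp
        qed
        have "(\<Sum>i\<in>{a..<b}. Z i \<omega>) \<le> (?l / real (d n) + 2) * (\<epsilon>' * sqrt n)"
        proof (rule sum_blocks_le[where k = "nat \<lfloor>C * real n\<rfloor>"])
          show "(\<Sum>i\<in>{j * d n..<j * d n + d n}. Z i \<omega>) \<le> \<epsilon>' * sqrt n" if "j \<le> nat \<lfloor>C * real n\<rfloor> div d n" for j
          proof (rule ccontr)
            assume "\<not> ?thesis"
            then have "\<omega> \<in> U n" unfolding U_def using ab(1) that by auto
            then show False using not by simp
          qed
        qed (use ab \<open>a < b\<close> d \<epsilon>' L in \<open>auto simp: Z_def\<close>)
        also have "\<dots> = \<epsilon>' * (?l * (sqrt n / real (d n)) + 2 * sqrt n)" by (simp add: algebra_simps)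
        also have "\<dots> \<le> \<epsilon>' * (?l * 1 + 2 * sqrt n)"
          using \<epsilon>' d by (intro mult_left_mono add_right_mono) auto
        finally have 2: "(\<Sum>i\<in>{a..<b}. Z i \<omega>) \<le> \<epsilon>' * ?l + 2 * (\<epsilon>' * sqrt n)" by (simp add: algebra_simps)
        have 3: "0 \<le> (\<Sum>i\<in>{a..<b}. Z i \<omega>)" using L(1) by (intro sum_nonneg) (auto simp: Z_def)
        have 4: "0 \<le> ?l * expectation (Z 0)" "?l * expectation (Z 0) \<le> \<epsilon>' * ?l"
          using EZ mult_left_mono[OF EZ(2), of ?l] by (auto simp: mult.commute)
        have 5: "0 \<le> \<epsilon>' * sqrt n" using \<epsilon>' by simp
        have eq: "(\<Sum>i\<in>{a..<b}. X i \<omega>) - m * ?l = ((\<Sum>i\<in>{a..<b}. Y i \<omega>) - ?l * expectation (Y 0)) +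
          ((\<Sum>i\<in>{a..<b}. Z i \<omega>) - ?l * expectation (Z 0))"
          unfolding YZ sum.distrib m by (simp add: algebra_simps)
        have "\<bar>(\<Sum>i\<in>{a..<b}. Z i \<omega>) - ?l * expectation (Z 0)\<bar> \<le> \<epsilon>' * ?l + 2 * (\<epsilon>' * sqrt n)"
          using 2 3 4 5 by linarith
        then have "\<bar>(\<Sum>i\<in>{a..<b}. X i \<omega>) - m * ?l\<bar> \<le> \<epsilon>' * (sqrt n + ?l) + (\<epsilon>' * ?l + 2 * (\<epsilon>' * sqrt n))"
          unfolding eq using 1 by linarith
        also have "\<dots> \<le> (4 * \<epsilon>') * (sqrt n + ?l)"
          using 5 \<epsilon>' by (simp add: algebra_simps)
        also have "\<dots> \<le> \<epsilon> * (sqrt n + ?l)" using \<epsilon>' by (intro mult_right_mono) auto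
        finally show False using ab(4) by simp
      qed
    qed
    then have "prob {\<omega>\<in>space M. \<exists>a b. a \<le> b \<and> b \<le> nat \<lfloor>C * real n\<rfloor> \<and>
       \<epsilon> * (sqrt n + real (b - a)) < \<bar>(\<Sum>i\<in>{a..<b}. X i \<omega>) - m * real (b - a)\<bar>} \<le> prob (H n \<union> U n)"
      by (intro finite_measure_mono) (auto simp: H_def U_def)
    also have "\<dots> \<le> prob (H n) + prob (U n)"
      by (rule measure_Un_le) (auto simp: H_def U_def)
    finally show ?case using elim(1) U by simp
  qed
qed

end

section \<open>Noise of renewal arrivals and Poisson services\<close>

text \<open>The hypothesis \<open>t < g k\<close> makes the set of admissible counts finite, so the
  supremum in \<open>arrivals\<close> is an attained maximum and counting inverts the partial
  sums.\<close>

lemma arrivals_iff: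
  fixes ia :: "nat \<Rightarrow> real"
  assumes pos: "\<And>k. ia (Suc k) > 0" and rate: "rate > 0"
  defines "g \<equiv> \<lambda>j. \<Sum>k=1..j. ia k / rate"
  shows "strict_mono g" "g 0 = 0"
    and "0 \<le> t \<Longrightarrow> t < g k \<Longrightarrow> j \<le> arrivals ia rate t \<longleftrightarrow> g j \<le> t"
proof -
  show mono: "strict_mono g"
    unfolding strict_mono_Suc_iff g_def using pos rate by simp
  show g0: "g 0 = 0" by (simp add: g_def)
  show "j \<le> arrivals ia rate t \<longleftrightarrow> g j \<le> t" if t: "0 \<le> t" "t < g k"
  proof -
    define A where "A = {l. g l \<le> t}"
    have "l < k" if "l \<in> A" for l
      using that t strict_mono_less[OF mono, of l k] by (simp add: A_def)
    then have fin: "finite A" by (meson bounded_nat_set_is_finite)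
    have ne: "A \<noteq> {}" using t g0 by (auto simp: A_def intro!: exI[of _ 0])
    have "arrivals ia rate t = Sup A" by (simp add: arrivals_def A_def g_def)
    also have "\<dots> = Max A" using ne by (simp add: Sup_nat_def)
    finally have eq: "arrivals ia rate t = Max A" .
    show ?thesis
    proof
      assume "j \<le> arrivals ia rate t"
      then have "g j \<le> g (Max A)" unfolding eq using strict_mono_mono[OF mono] by (simp add: monoD)
      also have "\<dots> \<le> t" using Max_in[OF fin ne] by (simp add: A_def)
      finally show "g j \<le> t" .
    next
      assume "g j \<le> t"
      then show "j \<le> arrivals ia rate t" unfolding eq using fin by (intro Max_ge) (auto simp: A_def)
    qed
  qed
qed

text \<open>Counts invert partial sums: a bound for sums over a window of indices becomes one for
  the number of indices in a window of time. The count to be estimated occurs on both sides and is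
  solved for thanks to \<open>2 * \<epsilon>' \<le> 1\<close>; replacing \<open>rate\<close> by
  \<open>n * lam\<close> then costs \<open>\<beta> * sqrt n\<close> per unit time.\<close>

lemma renewal_noise:
  fixes e :: "real \<Rightarrow> nat" and x :: "nat \<Rightarrow> real" and n k :: nat and T rate lam \<beta> \<epsilon> \<epsilon>' \<kappa> s t :: real
  assumes e: "\<And>t j. 0 \<le> t \<Longrightarrow> t \<le> T \<Longrightarrow> j \<le> e t \<longleftrightarrow> (\<Sum>i<j. x i) \<le> rate * t"
    and long: "rate * T < (\<Sum>i<k. x i)" and rate: "\<bar>rate - n * lam\<bar> \<le> \<beta> * sqrt n" "rate > 0"
    and \<beta>: "\<beta> \<ge> 0" and n: "n \<ge> 1"
  shows "\<lbrakk>\<And>a b. a \<le> b \<Longrightarrow> b \<le> k \<Longrightarrow>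
        \<bar>(\<Sum>i\<in>{a..<b}. x i) - real (b - a)\<bar> \<le> \<epsilon>' * (sqrt n + real (b - a));
      0 \<le> \<epsilon>'; 2 * \<epsilon>' \<le> 1; 4 * \<epsilon>' \<le> \<epsilon>; 4 * \<epsilon>' * (lam + \<beta>) \<le> \<epsilon>; 6 \<le> \<epsilon> * sqrt n; 2 * \<beta> \<le> \<epsilon> * sqrt n;
      0 \<le> s; s \<le> t; t \<le> T\<rbrakk> \<Longrightarrow>
      \<bar>real (e t) - real (e s) - n * lam * (t - s)\<bar> \<le> \<epsilon> * (sqrt n + n * (t - s))"
    and "\<lbrakk>\<And>l. l \<le> k \<Longrightarrow> \<bar>(\<Sum>i<l. x i) - real l\<bar> \<le> \<kappa> * sqrt n; 0 \<le> t; t \<le> T\<rbrakk> \<Longrightarrow>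
      \<bar>real (e t) - n * lam * t\<bar> \<le> (\<kappa> + 1 + \<beta> * T) * sqrt n"
proof -
  have sqrt_n: "sqrt n \<ge> 1" "sqrt n * sqrt n = n" using n by auto
  have e_less: "e t < k" if "0 \<le> t" "t \<le> T" for t
  proof -
    have "rate * t \<le> rate * T" using that rate by (intro mult_left_mono) auto
    then have "\<not> k \<le> e t" using e[OF that, of k] long by simp
    then show ?thesis by simp
  qed
  have e_sum: "(\<Sum>i<e t. x i) \<le> rate * t" "rate * t < (\<Sum>i<Suc (e t). x i)" if "0 \<le> t" "t \<le> T" for t
    using e[OF that, of "e t"] e[OF that, of "Suc (e t)"] by auto
  have rate_diff: "\<bar>rate * u - n * lam * u\<bar> \<le> \<beta> * sqrt n * u" if "u \<ge> 0" for u
  proof -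
    have "\<bar>(rate - n * lam) * u\<bar> \<le> \<beta> * sqrt n * u"
      unfolding abs_mult using rate that by (intro mult_mono) auto
    then show ?thesis by (simp add: left_diff_distrib)
  qed
  have ivl: "(\<Sum>i\<in>{a..<b}. x i) = (\<Sum>i<b. x i) - (\<Sum>i<a. x i)" if "a \<le> b" for a b
    using that sum.atLeastLessThan_concat[of 0 a b x] by (simp add: atLeast0LessThan)
  show "\<bar>real (e t) - real (e s) - n * lam * (t - s)\<bar> \<le> \<epsilon> * (sqrt n + n * (t - s))"
    if W: "\<And>a b. a \<le> b \<Longrightarrow> b \<le> k \<Longrightarrow>
        \<bar>(\<Sum>i\<in>{a..<b}. x i) - real (b - a)\<bar> \<le> \<epsilon>' * (sqrt n + real (b - a))"
      and \<epsilon>': "0 \<le> \<epsilon>'" "2 * \<epsilon>' \<le> 1" "4 * \<epsilon>' \<le> \<epsilon>" "4 * \<epsilon>' * (lam + \<beta>) \<le> \<epsilon>"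
      and large: "6 \<le> \<epsilon> * sqrt n" "2 * \<beta> \<le> \<epsilon> * sqrt n" and st: "0 \<le> s" "s \<le> t" "t \<le> T"
  proof -
    have t: "0 \<le> t" "t \<le> T" and s: "0 \<le> s" "s \<le> T" using st by auto
    define c where "c = rate * (t - s)"
    have c: "c \<ge> 0" using st rate by (simp add: c_def)
    have es: "e s \<le> e t"
    proof -
      have "rate * s \<le> rate * t" using st rate by (intro mult_left_mono) auto
      then show ?thesis using e[OF t, of "e s"] e_sum(1)[OF s] by simp
    qed
    define d where "d = real (e t) - real (e s)"
    have d0: "d \<ge> 0" using es by (simp add: d_def)
    \<comment> \<open>The interarrival time straddling \<open>s\<close> begins before
      \<open>s\<close> and is left out here, whereas the lower bound includes the ones straddling
      both \<open>s\<close> and \<open>t\<close>; hence the shifts of the count by 1.\<close>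
    have up: "d \<le> c + 1 + \<epsilon>' * (sqrt n + d)"
    proof (cases "e s = e t")
      case True
      have "0 \<le> \<epsilon>' * (sqrt n + d)" using \<epsilon>' d0 by simp
      then show ?thesis using True c by (simp add: d_def)
    next
      case False
      then have le: "Suc (e s) \<le> e t" using es by simp
      have "(\<Sum>i\<in>{Suc (e s)..<e t}. x i) \<le> c"
        unfolding ivl[OF le] c_def right_diff_distrib using e_sum[OF t] e_sum[OF s] by linarith
      moreover have "real (e t - Suc (e s)) = d - 1" using le by (simp add: d_def)
      ultimately have "d - 1 \<le> c + \<epsilon>' * (sqrt n + (d - 1))"
        using W[OF le] e_less[OF t] by fastforce
      also have "\<dots> \<le> c + \<epsilon>' * (sqrt n + d)" using \<epsilon>' by (intro add_left_mono mult_left_mono) auto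
      finally show ?thesis by simp
    qed
    have low: "c \<le> d + 1 + \<epsilon>' * (sqrt n + (d + 1))"
    proof -
      have le: "e s \<le> Suc (e t)" using es by simp
      have "c \<le> (\<Sum>i\<in>{e s..<Suc (e t)}. x i)"
        unfolding ivl[OF le] c_def right_diff_distrib using e_sum[OF t] e_sum[OF s] by linarith
      moreover have "real (Suc (e t) - e s) = d + 1" using es by (simp add: d_def)
      ultimately show ?thesis using W[OF le] e_less[OF t] by fastforce
    qed
    have eps_d: "\<epsilon>' * d \<le> d / 2" using mult_right_mono[OF \<epsilon>'(2) d0] by simp
    have eps_n: "\<epsilon>' * sqrt n \<le> sqrt n / 2" using mult_right_mono[OF \<epsilon>'(2), of "sqrt n"] by simp
    have d_crude: "d \<le> 2 * c + 2 + sqrt n" using up eps_d eps_n by (simp add: distrib_left)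
    have eps_dc: "\<epsilon>' * d \<le> \<epsilon>' * (2 * c + 2 + sqrt n)" using d_crude \<epsilon>'(1) by (rule mult_left_mono)
    have dc: "\<bar>d - c\<bar> \<le> 3 + 2 * \<epsilon>' * (sqrt n + c)"
      using up low eps_dc \<epsilon>' by (simp add: abs_le_iff algebra_simps)
    have c_le: "c \<le> (lam + \<beta>) * (n * (t - s))"
    proof -
      have "\<beta> * sqrt n * (t - s) \<le> \<beta> * n * (t - s)"
      proof (intro mult_right_mono mult_left_mono)
        show "sqrt n \<le> real n" using mult_right_mono[OF sqrt_n(1), of "sqrt n"] sqrt_n(2) by simp
      qed (use st \<beta> in auto)
      then show ?thesis using rate_diff[of "t - s"] st by (simp add: c_def algebra_simps)
    qed
    have "2 * \<epsilon>' * c \<le> 2 * \<epsilon>' * ((lam + \<beta>) * (n * (t - s)))" using c_le \<epsilon>'(1) by (intro mult_left_mono) auto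
    also have "\<dots> = 4 * \<epsilon>' * (lam + \<beta>) * (n * (t - s)) / 2" by simp
    also have "\<dots> \<le> \<epsilon> * (n * (t - s)) / 2"
      using \<epsilon>'(4) st by (intro divide_right_mono mult_right_mono) auto
    finally have 1: "2 * \<epsilon>' * c \<le> \<epsilon> * (n * (t - s)) / 2" .
    have "4 * \<epsilon>' * sqrt n \<le> \<epsilon> * sqrt n" using \<epsilon>'(3) by (intro mult_right_mono) auto
    then have 2: "2 * \<epsilon>' * sqrt n \<le> \<epsilon> * sqrt n / 2" by simp
    \<comment> \<open>For large \<open>n\<close> the deviation of \<open>rate\<close> from
      \<open>n * lam\<close> disappears in the linear slack.\<close>
    have "2 * \<beta> * (sqrt n * (t - s)) \<le> \<epsilon> * sqrt n * (sqrt n * (t - s))"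
      using large(2) st by (intro mult_right_mono) auto
    also have "\<dots> = \<epsilon> * (sqrt n * sqrt n * (t - s))" by (simp only: ac_simps)
    also have "\<dots> = \<epsilon> * (n * (t - s))" unfolding sqrt_n(2) ..
    finally have 3: "\<beta> * sqrt n * (t - s) \<le> \<epsilon> * (n * (t - s)) / 2" by simp
    have "\<bar>d - n * lam * (t - s)\<bar> \<le> 3 + 2 * \<epsilon>' * sqrt n + 2 * \<epsilon>' * c + \<beta> * sqrt n * (t - s)"
      using dc rate_diff[of "t - s"] st unfolding c_def[symmetric] by (simp add: distrib_left)
    also have "\<dots> \<le> \<epsilon> * sqrt n + \<epsilon> * (n * (t - s))"
      using 1 2 3 large(1) by linarith
    finally show ?thesis by (simp add: d_def distrib_left)
  qed
  show "\<bar>real (e t) - n * lam * t\<bar> \<le> (\<kappa> + 1 + \<beta> * T) * sqrt n"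
    if \<kappa>: "\<And>l. l \<le> k \<Longrightarrow> \<bar>(\<Sum>i<l. x i) - real l\<bar> \<le> \<kappa> * sqrt n" and t: "0 \<le> t" "t \<le> T"
  proof -
    have "\<bar>real (e t) - rate * t\<bar> \<le> \<kappa> * sqrt n + 1"
      using \<kappa>[of "e t"] \<kappa>[of "Suc (e t)"] e_less[OF t] e_sum[OF t] by (simp add: abs_le_iff)
    moreover have "\<beta> * sqrt n * t \<le> \<beta> * sqrt n * T" using t \<beta> by (intro mult_left_mono) auto
    ultimately have "\<bar>real (e t) - n * lam * t\<bar> \<le> \<kappa> * sqrt n + 1 + \<beta> * sqrt n * T"
      using rate_diff[OF t(1)] by linarith
    also have "\<dots> \<le> \<kappa> * sqrt n + 1 * sqrt n + \<beta> * sqrt n * T" using sqrt_n(1) by simp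
    finally show ?thesis by (simp only: distrib_right mult.assoc mult.commute[of T])
  qed
qed

text \<open>The process is only controlled at integer times; monotonicity sandwiches a window
  between integer windows longer or shorter by at most 2, at a cost of \<open>2 * mu\<close> that is
  absorbed for large \<open>n\<close>.\<close>

lemma service_noise:
  fixes S :: "real \<Rightarrow> nat" and n k :: nat and T mu \<epsilon> \<epsilon>' \<kappa> u v :: real
  assumes S: "mono_on {0..} S" "S 0 = 0" and k: "n * T + 1 \<le> real k" and mu: "mu \<ge> 0"
    and n: "n \<ge> 1"
  defines "x \<equiv> \<lambda>j. real (S (real (Suc j)) - S (real j))"
  shows "\<lbrakk>\<And>a b. a \<le> b \<Longrightarrow> b \<le> k \<Longrightarrow>
        \<bar>(\<Sum>i\<in>{a..<b}. x i) - mu * real (b - a)\<bar> \<le> \<epsilon>' * (sqrt n + real (b - a));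
      0 \<le> \<epsilon>'; 2 * \<epsilon>' \<le> 1; 2 * \<epsilon>' \<le> \<epsilon>; 2 * (2 * mu + 1) \<le> \<epsilon> * sqrt n; 0 \<le> u; u \<le> v; v \<le> n * T\<rbrakk> \<Longrightarrow>
      \<bar>real (S v) - real (S u) - mu * (v - u)\<bar> \<le> \<epsilon> * (sqrt n + (v - u))"
    and "\<lbrakk>\<And>l. l \<le> k \<Longrightarrow> \<bar>(\<Sum>i<l. x i) - mu * real l\<bar> \<le> \<kappa> * sqrt n; 0 \<le> u; u \<le> n * T\<rbrakk> \<Longrightarrow>
      \<bar>real (S u) - mu * u\<bar> \<le> (\<kappa> + mu) * sqrt n"
proof -
  have mono: "S u \<le> S v" if "0 \<le> u" "u \<le> v" for u v
    using that by (intro mono_onD[OF S(1)]) auto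
  have sum_x: "(\<Sum>i<j. x i) = S (real j)" for j
  proof (induction j)
    case (Suc j)
    then show ?case using mono[of "real j" "real (Suc j)"] by (simp add: x_def)
  qed (use S in simp)
  have ivl: "(\<Sum>i\<in>{a..<b}. x i) = real (S (real b)) - real (S (real a))" if "a \<le> b" for a b
    using that sum.atLeastLessThan_concat[of 0 a b x] sum_x by (simp add: atLeast0LessThan)
  define lo where "lo u = nat \<lfloor>u\<rfloor>" for u :: real
  define hi where "hi u = nat \<lceil>u\<rceil>" for u :: real
  have lo: "real (lo u) \<le> u" "u - 1 < real (lo u)" and hi: "u \<le> real (hi u)" "real (hi u) < u + 1" if "0 \<le> u" for u
    using that unfolding lo_def hi_def by linarith+
  have hi_k: "hi u \<le> k" if "0 \<le> u" "u \<le> n * T" for u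
    using hi(2)[OF that(1)] that(2) k by linarith
  have lo_k: "lo u \<le> k" if "0 \<le> u" "u \<le> n * T" for u
    using lo(1)[OF that(1)] that(2) k by linarith
  show "\<bar>real (S v) - real (S u) - mu * (v - u)\<bar> \<le> \<epsilon> * (sqrt n + (v - u))"
    if W: "\<And>a b. a \<le> b \<Longrightarrow> b \<le> k \<Longrightarrow>
        \<bar>(\<Sum>i\<in>{a..<b}. x i) - mu * real (b - a)\<bar> \<le> \<epsilon>' * (sqrt n + real (b - a))"
      and \<epsilon>': "0 \<le> \<epsilon>'" "2 * \<epsilon>' \<le> 1" "2 * \<epsilon>' \<le> \<epsilon>" and large: "2 * (2 * mu + 1) \<le> \<epsilon> * sqrt n"
      and uv: "0 \<le> u" "u \<le> v" "v \<le> n * T"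
  proof -
    have v0: "0 \<le> v" and u: "u \<le> n * T" using uv by auto
    have bound: "\<epsilon>' * (sqrt n + (v - u + 2)) + 2 * mu \<le> \<epsilon> * (sqrt n + (v - u))"
    proof -
      have "2 * \<epsilon>' * (sqrt n + (v - u)) \<le> \<epsilon> * (sqrt n + (v - u))" using \<epsilon>' uv by (intro mult_right_mono) auto
      moreover have "2 * \<epsilon>' * 2 + 4 * mu \<le> \<epsilon> * (sqrt n + (v - u))"
      proof -
        have "0 \<le> \<epsilon> * (v - u)" using \<epsilon>' uv by simp
        then have "\<epsilon> * sqrt n \<le> \<epsilon> * (sqrt n + (v - u))" by (simp add: distrib_left)
        then show ?thesis using large \<epsilon>'(2) by (simp add: algebra_simps)
      qed
      ultimately show ?thesis by (simp add: distrib_left)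
    qed
    have "real (S v) - real (S u) \<le> mu * (v - u) + (\<epsilon>' * (sqrt n + (v - u + 2)) + 2 * mu)"
    proof -
      have le: "lo u \<le> hi v" using lo(1)[OF uv(1)] hi(1)[OF v0] uv(2) by linarith
      have d: "real (hi v - lo u) \<le> v - u + 2"
        using lo(2)[OF uv(1)] hi(2)[OF v0] le by (simp add: of_nat_diff)
      have "real (S v) - real (S u) \<le> (\<Sum>i\<in>{lo u..<hi v}. x i)"
        unfolding ivl[OF le] using mono[of v "hi v"] mono[of "lo u" u] hi(1)[OF v0] lo(1)[OF uv(1)] uv v0 by simp
      also have "\<dots> \<le> mu * real (hi v - lo u) + \<epsilon>' * (sqrt n + real (hi v - lo u))"
        using W[OF le hi_k[OF v0 uv(3)]] by linarith
      also have "\<dots> \<le> mu * (v - u + 2) + \<epsilon>' * (sqrt n + (v - u + 2))"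
        using d mu \<epsilon>' by (intro add_mono mult_left_mono) auto
      finally show ?thesis by (simp add: algebra_simps)
    qed
    moreover have "mu * (v - u) - (\<epsilon>' * (sqrt n + (v - u + 2)) + 2 * mu) \<le> real (S v) - real (S u)"
    proof (cases "hi u \<le> lo v")
      case True
      have d: "v - u - 2 \<le> real (lo v - hi u)" "real (lo v - hi u) \<le> v - u + 2"
        using lo[OF v0] hi[OF uv(1)] True by (auto simp: of_nat_diff)
      have "mu * (v - u - 2) - \<epsilon>' * (sqrt n + (v - u + 2)) \<le>
          mu * real (lo v - hi u) - \<epsilon>' * (sqrt n + real (lo v - hi u))"
        using d mu \<epsilon>' by (intro diff_mono mult_left_mono) auto
      also have "\<dots> \<le> (\<Sum>i\<in>{hi u..<lo v}. x i)"
        using W[OF True lo_k[OF v0 uv(3)]] by linarith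
      also have "\<dots> \<le> real (S v) - real (S u)"
        unfolding ivl[OF True] using mono[of "lo v" v] mono[of u "hi u"] lo(1)[OF v0] hi(1)[OF uv(1)] uv v0 by simp
      finally show ?thesis by (simp add: algebra_simps)
    next
      case False
      then have "v - u \<le> 2" using lo[OF v0] hi[OF uv(1)] by linarith
      then have "mu * (v - u) \<le> mu * 2" using mu by (intro mult_left_mono) auto
      moreover have "0 \<le> \<epsilon>' * (sqrt n + (v - u + 2))" using \<epsilon>' uv by simp
      moreover have "S u \<le> S v" using mono uv by simp
      ultimately show ?thesis by simp
    qed
    ultimately show ?thesis using bound by linarith
  qed
  show "\<bar>real (S u) - mu * u\<bar> \<le> (\<kappa> + mu) * sqrt n"
    if \<kappa>: "\<And>l. l \<le> k \<Longrightarrow> \<bar>(\<Sum>i<l. x i) - mu * real l\<bar> \<le> \<kappa> * sqrt n" and u: "0 \<le> u" "u \<le> n * T"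
  proof -
    have "real (S u) \<le> real (S (hi u))" "real (S (lo u)) \<le> real (S u)"
      using mono[of u "hi u"] mono[of "lo u" u] hi[OF u(1)] lo[OF u(1)] u by auto
    moreover have "\<bar>real (S (hi u)) - mu * real (hi u)\<bar> \<le> \<kappa> * sqrt n" "\<bar>real (S (lo u)) - mu * real (lo u)\<bar> \<le> \<kappa> * sqrt n"
      using \<kappa>[OF hi_k[OF u]] \<kappa>[OF lo_k[OF u]] by (auto simp: sum_x)
    moreover have "mu * real (hi u) \<le> mu * (u + 1)" "mu * (u - 1) \<le> mu * real (lo u)"
      using hi[OF u(1)] lo[OF u(1)] mu by (auto intro!: mult_left_mono)
    ultimately have "\<bar>real (S u) - mu * u\<bar> \<le> \<kappa> * sqrt n + mu * 1"
      by (simp add: distrib_left right_diff_distrib abs_le_iff)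
    also have "\<dots> \<le> \<kappa> * sqrt n + mu * sqrt n"
      using n mu by (intro add_left_mono mult_left_mono) auto
    finally show ?thesis by (simp add: distrib_right)
  qed
qed

section \<open>Input from the model: Poisson increments, interarrival times of one class, tightness
  of the initial state\<close>

lemma poisson_pmf_moments:
  assumes "\<mu> > 0"
  shows "integrable (measure_pmf (poisson_pmf \<mu>)) (\<lambda>k. (real k)\<^sup>2)"
    "(\<integral>k. real k \<partial>measure_pmf (poisson_pmf \<mu>)) = \<mu>"
proof -
  let ?a = "\<lambda>k. pmf (poisson_pmf \<mu>) k"
  have a_eq: "?a k = \<mu> ^ k / fact k * exp (- \<mu>)" for k by (rule pmf_poisson[OF assms])
  \<comment> \<open>The factor \<open>Suc j\<close> shifts the Poisson weights by one, which turns
    each moment series into a combination of lower ones.\<close>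
  have rec: "real (Suc j) * ?a (Suc j) = \<mu> * ?a j" for j
    unfolding a_eq by (simp add: field_simps del: of_nat_Suc)
  have "(\<lambda>k. \<mu> ^ k /\<^sub>R fact k * exp (- \<mu>)) sums (exp \<mu> * exp (- \<mu>))"
    by (intro sums_mult2 exp_converges)
  then have a: "?a sums 1"
    unfolding a_eq by (simp add: exp_minus_inverse divide_inverse mult.commute)
  have "(\<lambda>j. real (Suc j) * ?a (Suc j)) sums (\<mu> * 1)"
    unfolding rec by (intro sums_mult a)
  then have b: "(\<lambda>k. real k * ?a k) sums \<mu>"
    by (subst (asm) sums_Suc_iff) simp
  have "summable (\<lambda>j. \<mu> * (real j * ?a j) + \<mu> * ?a j)"
    by (intro summable_add summable_mult sums_summable[OF a] sums_summable[OF b])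
  also have "(\<lambda>j. \<mu> * (real j * ?a j) + \<mu> * ?a j) = (\<lambda>j. (real (Suc j))\<^sup>2 * ?a (Suc j))"
  proof
    fix j
    have "(real (Suc j))\<^sup>2 * ?a (Suc j) = real (Suc j) * (\<mu> * ?a j)"
      unfolding rec[symmetric] by (simp only: power2_eq_square mult.assoc)
    then show "\<mu> * (real j * ?a j) + \<mu> * ?a j = (real (Suc j))\<^sup>2 * ?a (Suc j)"
      by (simp add: algebra_simps)
  qed
  finally have c: "summable (\<lambda>k. (real k)\<^sup>2 * ?a k)"
    by (subst (asm) summable_Suc_iff)
  have int: "integrable (measure_pmf (poisson_pmf \<mu>)) f \<longleftrightarrow> summable (\<lambda>k. norm (?a k * f k))" for f :: "nat \<Rightarrow> real"
    unfolding measure_pmf_eq_density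
    by (subst integrable_density) (auto simp: integrable_count_space_nat_iff)
  show sq: "integrable (measure_pmf (poisson_pmf \<mu>)) (\<lambda>k. (real k)\<^sup>2)"
    unfolding int using c by (simp add: mult.commute abs_mult)
  have "integrable (measure_pmf (poisson_pmf \<mu>)) real"
    unfolding int using sums_summable[OF b] by (simp add: mult.commute abs_mult)
  then have "integrable (count_space UNIV) (\<lambda>k. ?a k * real k)"
    unfolding measure_pmf_eq_density by (subst (asm) integrable_density) auto
  moreover have "(\<integral>k. real k \<partial>measure_pmf (poisson_pmf \<mu>)) = (\<integral>k. ?a k * real k \<partial>count_space UNIV)"
    unfolding measure_pmf_eq_density by (subst integral_density) auto
  ultimately have "(\<integral>k. real k \<partial>measure_pmf (poisson_pmf \<mu>)) = (\<Sum>k. ?a k * real k)"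
    by (simp only: integral_count_space_nat)
  then show "(\<integral>k. real k \<partial>measure_pmf (poisson_pmf \<mu>)) = \<mu>"
    using sums_unique[OF b] by (simp add: mult.commute)
qed

context prob_space
begin

lemma poisson_increments_iid:
  assumes pois: "poisson_process \<mu> X" and \<mu>: "\<mu> > 0"
  shows "iid_nonneg M (\<lambda>j \<omega>. real (X (real (Suc j)) \<omega> - X (real j) \<omega>)) \<mu>"
proof -
  let ?I = "\<lambda>j \<omega>. X (real (Suc j)) \<omega> - X (real j) \<omega>"
  note p = pois[unfolded poisson_process_def]
  have distr: "distr M (count_space UNIV) (?I j) = measure_pmf (poisson_pmf \<mu>)" for j
    using p[THEN conjunct2, THEN conjunct2, THEN conjunct1, rule_format, of "real j" "real (Suc j)"] by simp
  have ind: "indep_vars (\<lambda>_. count_space UNIV) ?I {..<k}" for k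
    using p[THEN conjunct2, THEN conjunct2, THEN conjunct2, rule_format, of real k]
    by (simp add: strict_mono_def)
  have rv: "?I j \<in> measurable M (count_space UNIV)" for j
  proof -
    have "\<forall>i\<in>{..<Suc j}. random_variable (count_space UNIV) (?I i)"
      using ind[of "Suc j"] unfolding indep_vars_def by (rule conjunct1)
    then show ?thesis by (rule bspec) simp
  qed
  have real_m: "real \<in> measurable (count_space UNIV) borel" by simp
  have distr_real: "distr M borel (\<lambda>\<omega>. real (?I j \<omega>)) = distr (measure_pmf (poisson_pmf \<mu>)) borel real" for j
    unfolding distr[of j, symmetric] by (subst distr_distr[OF real_m rv]) (simp add: comp_def)
  have tr: "integrable M (\<lambda>\<omega>. f (?I 0 \<omega>)) \<longleftrightarrow> integrable (measure_pmf (poisson_pmf \<mu>)) f"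
    "expectation (\<lambda>\<omega>. f (?I 0 \<omega>)) = integral\<^sup>L (measure_pmf (poisson_pmf \<mu>)) f" for f :: "nat \<Rightarrow> real"
    unfolding distr[of 0, symmetric]
    by (rule integrable_distr_eq[OF rv, symmetric], simp) (rule integral_distr[OF rv, symmetric], simp)
  show ?thesis
  proof (intro iid_nonneg.intro iid_nonneg_axioms.intro prob_space_axioms)
    show "indep_vars (\<lambda>_. borel) (\<lambda>j \<omega>. real (?I j \<omega>)) {..<k}" for k
      by (rule indep_vars_compose2[OF ind]) simp
    show "distr M borel (\<lambda>\<omega>. real (?I j \<omega>)) = distr M borel (\<lambda>\<omega>. real (?I 0 \<omega>))" for j
      unfolding distr_real ..
    show "integrable M (\<lambda>\<omega>. (real (?I 0 \<omega>))\<^sup>2)"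
      using tr(1)[of "\<lambda>k. (real k)\<^sup>2"] poisson_pmf_moments(1)[OF \<mu>] by blast
    show "expectation (\<lambda>\<omega>. real (?I 0 \<omega>)) = \<mu>"
      using tr(2)[of real] poisson_pmf_moments(2)[OF \<mu>] by (rule trans)
  qed simp
qed

lemma iid_row:
  fixes IA :: "'k \<Rightarrow> nat \<Rightarrow> 'a \<Rightarrow> real"
  assumes ind: "indep_vars (\<lambda>_. borel) (\<lambda>(i, l). IA i l) (UNIV \<times> {1..})"
    and distr: "\<And>l. l \<ge> 1 \<Longrightarrow> distr M borel (IA i l) = distr M borel (IA i 1)"
    and pos: "\<And>l. l \<ge> 1 \<Longrightarrow> AE \<omega> in M. IA i l \<omega> > 0"
    and mean: "expectation (IA i 1) = m" and sq: "integrable M (\<lambda>\<omega>. (IA i 1 \<omega>)\<^sup>2)"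
  shows "iid_nonneg M (\<lambda>j. IA i (Suc j)) m"
proof (intro iid_nonneg.intro iid_nonneg_axioms.intro prob_space_axioms)
  show "indep_vars (\<lambda>_. borel) (\<lambda>j. IA i (Suc j)) {..<k}" for k
  proof -
    \<comment> \<open>Singleton blocks serve to reindex the family of pairs by
      \<open>j\<close>.\<close>
    have "indep_vars (\<lambda>j. PiM {(i, Suc j)} (\<lambda>_. borel :: real measure))
        (\<lambda>j \<omega>. restrict (\<lambda>p. (case p of (i, l) \<Rightarrow> IA i l) \<omega>) {(i, Suc j)}) {..<k}"
      by (rule indep_vars_restrict[OF ind]) (auto simp: disjoint_family_on_def)
    then have "indep_vars (\<lambda>_. borel)
        (\<lambda>j \<omega>. restrict (\<lambda>p. (case p of (i, l) \<Rightarrow> IA i l) \<omega>) {(i, Suc j)} (i, Suc j)) {..<k}"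
      by (rule indep_vars_compose2[where Y = "\<lambda>j f. f (i, Suc j)"]) (rule measurable_component_singleton, simp)
    then show ?thesis by simp
  qed
  show "distr M borel (IA i (Suc j)) = distr M borel (IA i (Suc 0))" for j
    using distr[of "Suc j"] by simp
  show "AE \<omega> in M. 0 \<le> IA i (Suc j) \<omega>" for j
    using pos[of "Suc j"] by (auto elim: eventually_mono)
qed (use mean sq in auto)

text \<open>Only test functions that depend on the norm of one component are used, together with
  Markov's inequality. For \<open>U\<close> the limit is 0, which gives smallness at every level;
  for \<open>V\<close> it is an arbitrary variable, which gives one level uniform in large
  \<open>n\<close>.\<close>

lemma converges_in_distribution_tight:
  fixes U V :: "nat \<Rightarrow> 'a \<Rightarrow> (real, 'k::finite) vec" and W :: "'b \<Rightarrow> (real, 'k) vec"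
  assumes conv: "converges_in_distribution M (\<lambda>n \<omega>. (U n \<omega>, V n \<omega>)) M' (\<lambda>\<omega>. (0, W \<omega>))"
    and M': "prob_space M'" and W: "W \<in> borel_measurable M'"
    and meas: "\<And>n. n \<ge> 1 \<Longrightarrow> (\<lambda>\<omega>. norm (U n \<omega>)) \<in> borel_measurable M"
      "\<And>n. n \<ge> 1 \<Longrightarrow> (\<lambda>\<omega>. norm (V n \<omega>)) \<in> borel_measurable M"
    and \<delta>: "\<delta> > 0"
  shows "\<epsilon> > 0 \<Longrightarrow> \<forall>\<^sub>F n in sequentially. prob {\<omega>\<in>space M. \<epsilon> \<le> norm (U n \<omega>)} \<le> \<delta>"
    and "\<exists>\<kappa>. \<forall>\<^sub>F n in sequentially. prob {\<omega>\<in>space M. \<kappa> \<le> norm (V n \<omega>)} \<le> \<delta>"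
proof -
  interpret M': prob_space M' by fact
  have markov: "\<forall>\<^sub>F n in sequentially. prob {\<omega>\<in>space M. c \<le> f (U n \<omega>, V n \<omega>)} \<le> \<delta>"
    if f: "continuous_on UNIV f" "\<And>z. 0 \<le> f z" "\<And>z. f z \<le> 1"
      and lim: "(\<integral>\<omega>. f (0, W \<omega>) \<partial>M') < c * \<delta>" and c: "c > 0"
      and meas_f: "\<And>n. n \<ge> 1 \<Longrightarrow> (\<lambda>\<omega>. f (U n \<omega>, V n \<omega>)) \<in> borel_measurable M" for f c
  proof -
    have "bounded (range f)" using f(2,3) by (intro boundedI[of _ 1]) (auto simp: abs_le_iff intro: order_trans[of _ 0])
    then have "(\<lambda>n. \<integral>\<omega>. f (U n \<omega>, V n \<omega>) \<partial>M) \<longlonglongrightarrow> (\<integral>\<omega>. f (0, W \<omega>) \<partial>M')"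
      using conv f(1) unfolding converges_in_distribution_def by blast
    then have "\<forall>\<^sub>F n in sequentially. (\<integral>\<omega>. f (U n \<omega>, V n \<omega>) \<partial>M) < c * \<delta>"
      using lim by (rule order_tendstoD(2))
    then show ?thesis using eventually_ge_at_top[of 1]
    proof eventually_elim
      case (elim n)
      note meas_f[OF elim(2), measurable]
      have "integrable M (\<lambda>\<omega>. f (U n \<omega>, V n \<omega>))"
        by (rule integrable_const_bound[of _ 1]) (use f in auto)
      then have "prob {\<omega>\<in>space M. c \<le> f (U n \<omega>, V n \<omega>)} \<le> (\<integral>\<omega>. f (U n \<omega>, V n \<omega>) \<partial>M) / c"
        using integral_Markov_inequality_measure[where A = "{}" and c = c and M = M and u = "\<lambda>\<omega>. f (U n \<omega>, V n \<omega>)"] f(2) c by auto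
      also have "\<dots> \<le> \<delta>" using elim(1) c by (simp add: pos_divide_le_eq mult.commute)
      finally show ?case .
    qed
  qed
  show "\<forall>\<^sub>F n in sequentially. prob {\<omega>\<in>space M. \<epsilon> \<le> norm (U n \<omega>)} \<le> \<delta>" if \<epsilon>: "\<epsilon> > 0"
  proof -
    have "\<forall>\<^sub>F n in sequentially. prob {\<omega>\<in>space M. min 1 \<epsilon> \<le> min 1 (norm (fst (U n \<omega>, V n \<omega>)))} \<le> \<delta>"
      by (rule markov[of "\<lambda>z. min 1 (norm (fst z))" "min 1 \<epsilon>"])
        (use \<epsilon> \<delta> meas in \<open>auto intro!: continuous_intros\<close>)
    then show ?thesis using eventually_ge_at_top[of 1]
    proof eventually_elim
      case (elim n)
      note meas(1)[OF elim(2), measurable]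
      have "prob {\<omega>\<in>space M. \<epsilon> \<le> norm (U n \<omega>)} \<le> prob {\<omega>\<in>space M. min 1 \<epsilon> \<le> min 1 (norm (U n \<omega>))}"
        by (intro finite_measure_mono) auto
      then show ?case using elim(1) by simp
    qed
  qed
  show "\<exists>\<kappa>. \<forall>\<^sub>F n in sequentially. prob {\<omega>\<in>space M. \<kappa> \<le> norm (V n \<omega>)} \<le> \<delta>"
  proof -
    \<comment> \<open>A continuous cutoff: 0 up to norm \<open>j\<close> and 1 from norm
      \<open>j + 1\<close> on.\<close>
    define F where "F j z = max 0 (min 1 (norm (snd z) - real j))"
      for j and z :: "(real, 'k) vec \<times> (real, 'k) vec"
    have nW: "(\<lambda>\<omega>. norm (W \<omega>)) \<in> borel_measurable M'" using W by measurable
    have "(\<lambda>j. \<integral>\<omega>. F j (0, W \<omega>) \<partial>M') \<longlonglongrightarrow> (\<integral>\<omega>. 0 \<partial>M')"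
    proof (rule integral_dominated_convergence[where w = "\<lambda>_. 1"])
      show "AE \<omega> in M'. (\<lambda>j. F j (0, W \<omega>)) \<longlonglongrightarrow> 0"
      proof (rule AE_I2)
        fix \<omega>
        have "\<forall>\<^sub>F j in sequentially. norm (W \<omega>) \<le> real j" by real_asymp
        then have "\<forall>\<^sub>F j in sequentially. F j (0, W \<omega>) = 0"
          by eventually_elim (simp add: F_def)
        then show "(\<lambda>j. F j (0, W \<omega>)) \<longlonglongrightarrow> 0" by (rule tendsto_eventually)
      qed
    qed (use nW in \<open>auto simp: F_def\<close>)
    then have "\<forall>\<^sub>F j in sequentially. (\<integral>\<omega>. F j (0, W \<omega>) \<partial>M') < 1 * \<delta>"
      using \<delta> by (simp add: order_tendstoD(2))
    then obtain j where j: "(\<integral>\<omega>. F j (0, W \<omega>) \<partial>M') < 1 * \<delta>"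
      using eventually_happens by force
    have "\<forall>\<^sub>F n in sequentially. prob {\<omega>\<in>space M. 1 \<le> F j (U n \<omega>, V n \<omega>)} \<le> \<delta>"
    proof (rule markov[OF _ _ _ j])
      show "continuous_on UNIV (F j)" unfolding F_def by (intro continuous_intros)
      show "(\<lambda>\<omega>. F j (U n \<omega>, V n \<omega>)) \<in> borel_measurable M" if "n \<ge> 1" for n
        using meas(2)[OF that] unfolding F_def by simp
    qed (auto simp: F_def)
    moreover have "1 \<le> F j (u, v) \<longleftrightarrow> real j + 1 \<le> norm v" for u v by (auto simp: F_def)
    ultimately show ?thesis by auto
  qed
qed

end

section \<open>Paths of a loss system\<close>

text \<open>Before \<open>t\<close> the values are natural numbers bounded by \<open>f t\<close>, so
  their maximum is attained, and \<open>f\<close> is constant from that point up to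
  \<open>t\<close>.\<close>

lemma mono_nat_eventually_const_at_left:
  fixes f :: "real \<Rightarrow> nat"
  assumes f: "mono_on {0..T} f" and t: "0 < t" "t \<le> T"
  shows "\<exists>c. \<forall>\<^sub>F v in at_left t. f v = c"
proof -
  have "f ` {0..<t} \<subseteq> {..f t}"
    using t by (auto intro: mono_onD[OF f])
  then have fin: "finite (f ` {0..<t})"
    by (rule finite_subset) simp
  then have "Max (f ` {0..<t}) \<in> f ` {0..<t}"
    using t by (intro Max_in) auto
  then obtain s where s: "s \<in> {0..<t}" "Max (f ` {0..<t}) = f s"
    by blast
  have "f v = f s" if "s < v" "v < t" for v
  proof (rule antisym)
    show "f v \<le> f s"
      unfolding s(2)[symmetric] using s(1) that by (intro Max_ge fin imageI) auto
    show "f s \<le> f v"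
      using s t that by (intro mono_onD[OF f]) auto
  qed
  then have "\<forall>\<^sub>F v in at_left t. f v = f s"
    using s by (auto simp: eventually_at_left_field)
  then show ?thesis by blast
qed

lemma left_lim_eq:
  assumes "\<forall>\<^sub>F v in at_left t. f v = c"
  shows "left_lim f t = c"
  unfolding left_lim_def using assms
  by (intro tendsto_Lim tendsto_eventually) (simp_all add: trivial_limit_at_left_real)

lemma eventually_left_lim:
  assumes "\<forall>\<^sub>F v in at_left t. f v = c"
  shows "\<forall>\<^sub>F v in at_left t. f v = left_lim f t"
  unfolding left_lim_eq[OF assms] by (rule assms)

lemma eventually_at_left_obtain:
  fixes s t :: real
  assumes "\<forall>\<^sub>F v in at_left t. P v" "s < t"
  obtains v where "s < v" "v < t" "P v"
proof -
  have "\<forall>\<^sub>F v in at_left t. s < v \<and> v < t \<and> P v"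
    using assms(1) eventually_at_left_real[OF assms(2)] by eventually_elim auto
  then have "\<exists>v. s < v \<and> v < t \<and> P v"
    by (rule eventually_happens'[OF trivial_limit_at_left_real])
  then show ?thesis using that by blast
qed

lemma continuous_nat_at_rightD:
  fixes f :: "real \<Rightarrow> nat"
  assumes "continuous (at_right t) f"
  shows "\<forall>\<^sub>F v in at_right t. f v = f t"
  using assms unfolding continuous_within tendsto_discrete .

text \<open>\<open>f\<close> may jump, but upwards by at most \<open>\<alpha>\<close> beyond the
  drift: the supremum \<open>u\<close> of the times at level \<open>c\<close> or below may fail to
  be such a time, hence the loss of \<open>\<alpha>\<close> in the bound for \<open>f u\<close>. The
  lemma isolates a final stretch on which a quantity stays too large.\<close>

lemma last_exit:
  fixes f :: "real \<Rightarrow> real"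
  assumes st: "s \<le> t" and fs: "f s \<le> c"
    and inc: "\<And>u v. s \<le> u \<Longrightarrow> u \<le> v \<Longrightarrow> v \<le> t \<Longrightarrow> f v \<le> f u + \<alpha> + \<beta> * (v - u)" and \<beta>: "\<beta> \<ge> 0"
  obtains u where "s \<le> u" "u \<le> t" "f u \<le> c + \<alpha>" "\<And>v. u < v \<Longrightarrow> v \<le> t \<Longrightarrow> c < f v"
proof -
  define A where "A = {v\<in>{s..t}. f v \<le> c}"
  have A: "s \<in> A" "bdd_above A"
    using st fs by (auto simp: A_def intro: bdd_aboveI[of _ t])
  define u where "u = Sup A"
  have u: "s \<le> u" "u \<le> t"
    using A st by (auto simp: u_def A_def intro: cSup_upper cSup_least)
  have "f u \<le> c + \<alpha> + e" if "e > 0" for e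
  proof -
    \<comment> \<open>Dividing by \<open>\<beta> + 1\<close> covers the case
      \<open>\<beta> = 0\<close>.\<close>
    have "u - e / (\<beta> + 1) < Sup A"
      using \<beta> that by (simp add: u_def)
    then obtain v where v: "v \<in> A" "u - e / (\<beta> + 1) < v"
      using A by (metis empty_iff less_cSup_iff)
    have "v \<le> u" using v A by (auto simp: u_def intro: cSup_upper)
    then have "f u \<le> f v + \<alpha> + \<beta> * (u - v)"
      using v u by (intro inc) (auto simp: A_def)
    moreover have "\<beta> * (u - v) \<le> (\<beta> + 1) * (e / (\<beta> + 1))"
      using v \<beta> \<open>v \<le> u\<close> by (intro mult_mono) auto
    ultimately show ?thesis using v \<beta> by (auto simp: A_def)
  qed
  then have "f u \<le> c + \<alpha>" by (rule field_le_epsilon)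
  moreover have "c < f v" if "u < v" "v \<le> t" for v
  proof (rule ccontr)
    assume "\<not> c < f v"
    then have "v \<in> A" using that u by (auto simp: A_def)
    then have "v \<le> u" using A by (auto simp: u_def intro: cSup_upper)
    then show False using that by simp
  qed
  ultimately show ?thesis using that u by blast
qed

section \<open>Stieltjes measures of counting functions\<close>

lemma stieltjes_emeasure:
  assumes "mono_on {0..} b" "\<And>t. t \<ge> 0 \<Longrightarrow> continuous (at_right t) b" "0 \<le> s" "s \<le> t"
  shows "emeasure (stieltjes b) {s<..t} = ennreal (real (b t) - real (b s))"
proof -
  let ?F = "\<lambda>t. if t < 0 then 0 else real (b t)"
  have 1: "?F x \<le> ?F y" if "x \<le> y" for x y
    using that mono_onD[OF assms(1), of x y] by auto
  have 2: "continuous (at_right a) ?F" for a :: real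
  proof (cases "a < 0")
    case True
    have "\<forall>\<^sub>F v in at_right a. ?F v = ?F a"
      using eventually_at_right_real[OF True] by eventually_elim (use True in auto)
    then show ?thesis unfolding continuous_within by (rule tendsto_eventually)
  next
    case False
    have "\<forall>\<^sub>F v in at_right a. b v = b a"
      by (rule continuous_nat_at_rightD[OF assms(2)]) (use False in simp)
    then have "\<forall>\<^sub>F v in at_right a. ?F v = ?F a"
      using eventually_at_right_less[of a] by eventually_elim (use False in simp)
    then show ?thesis unfolding continuous_within by (rule tendsto_eventually)
  qed
  have "emeasure (interval_measure ?F) {s<..t} = ennreal (?F t - ?F s)"
    by (rule emeasure_interval_measure_Ioc[OF assms(4) 1 2])
  then show ?thesis using assms(3,4) by (simp add: stieltjes_def)
qed

text \<open>An integrand that is at least 1 on the half-open interval forces that interval to have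
  measure 0, and its measure is the increment of \<open>b\<close>. The possible atom at 0 lies
  outside every such interval.\<close>

lemma stieltjes_integral_0_const:
  assumes b: "mono_on {0..} b" "\<And>t. t \<ge> 0 \<Longrightarrow> continuous (at_right t) b" and st: "0 \<le> s" "s \<le> t"
    and "(\<integral>\<^sup>+u\<in>{0..}. f u \<partial>stieltjes b) = 0" and f: "\<And>u. s < u \<Longrightarrow> u \<le> t \<Longrightarrow> 1 \<le> f u"
  shows "b t = b s"
proof -
  have "ennreal (real (b t) - real (b s)) = (\<integral>\<^sup>+u. indicator {s<..t} u \<partial>stieltjes b)"
    using stieltjes_emeasure[OF b st] by (simp add: stieltjes_def)
  also have "\<dots> \<le> (\<integral>\<^sup>+u\<in>{0..}. f u \<partial>stieltjes b)"
    using f st by (intro nn_integral_mono) (auto simp: indicator_def)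
  finally have "b t \<le> b s" using assms(5) by (simp add: ennreal_eq_0_iff)
  moreover have "b s \<le> b t" using st by (intro mono_onD[OF b(1)]) auto
  ultimately show ?thesis by simp
qed

text \<open>Renewal counting: \<open>g j\<close> is the time of the \<open>j\<close>-th arrival.\<close>

locale loss_system =
  fixes pol :: scheduling and n :: nat and E S :: "'k::{finite,linorder} process"
    and q0 psi0 :: "'k \<Rightarrow> nat" and acc :: "'k \<Rightarrow> nat \<Rightarrow> bool" and sc :: "'k scenario"
    and Q Psi B D :: "'k process" and g :: "'k \<Rightarrow> nat \<Rightarrow> real" and T :: real
  assumes path: "system_path pol n E S q0 psi0
       (scenario_profile (\<lambda>i j q. if acc i q then 1 else 0) sc) Q Psi B D"
    and g: "\<And>i. strict_mono (g i)" "\<And>i. g i 0 = 0"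
    and E_iff: "\<And>i t j. 0 \<le> t \<Longrightarrow> t \<le> T \<Longrightarrow> j \<le> E i t \<longleftrightarrow> g i j \<le> t"
    and S: "\<And>i. mono_on {0..} (S i)" "\<And>i. S i 0 = 0"
    and n: "n \<ge> 1" and T: "T > 0"
begin

abbreviation dec :: "'k \<Rightarrow> nat \<Rightarrow> nat" where
  "dec \<equiv> decisions E (scenario_profile (\<lambda>i j q. if acc i q then 1 else 0) sc) Q"

definition R :: "'k process" where "R = rejections E dec"
definition J :: "'k process" where "J = joins E dec"

definition A :: "'k \<Rightarrow> real \<Rightarrow> real" where "A i t = integral {0..t} (\<lambda>u. real (Psi i u))"

lemma dec_01: "dec i j \<le> 1"
  by (auto simp: decisions_def scenario_profile_def)

lemmas path_conjs = path[unfolded system_path_def]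
lemmas path_right = path_conjs[THEN conjunct1, rule_format]
lemmas path_B = path_conjs[THEN conjunct2, THEN conjunct1, rule_format]
lemmas path_Q = path_conjs[THEN conjunct2, THEN conjunct2, THEN conjunct1, rule_format]
lemmas path_Psi = path_conjs[THEN conjunct2, THEN conjunct2, THEN conjunct2, THEN conjunct1, rule_format]
lemmas path_D = path_conjs[THEN conjunct2, THEN conjunct2, THEN conjunct2, THEN conjunct2,
    THEN conjunct1, rule_format]
lemmas Psi_le = path_conjs[THEN conjunct2, THEN conjunct2, THEN conjunct2, THEN conjunct2,
    THEN conjunct2, THEN conjunct1, rule_format]
lemmas path_busy = path_conjs[THEN conjunct2, THEN conjunct2, THEN conjunct2, THEN conjunct2,
    THEN conjunct2, THEN conjunct2, THEN conjunct1, rule_format]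
lemmas path_schedules = path_conjs[THEN conjunct2, THEN conjunct2, THEN conjunct2, THEN conjunct2,
    THEN conjunct2, THEN conjunct2, THEN conjunct2]

lemma right_const:
  assumes "t \<ge> 0"
  shows "\<forall>\<^sub>F v in at_right t. Q i v = Q i t" "\<forall>\<^sub>F v in at_right t. Psi i v = Psi i t"
    "\<forall>\<^sub>F v in at_right t. B i v = B i t" "\<forall>\<^sub>F v in at_right t. D i v = D i t"
  using path_right[OF assms, of i] by (blast intro: continuous_nat_at_rightD)+

lemma B_0 [simp]: "B i 0 = 0" and B_mono: "mono_on {0..} (B i)"
  using path_B[of i] by blast+

lemma B_le: "0 \<le> s \<Longrightarrow> s \<le> t \<Longrightarrow> B i s \<le> B i t"
  by (rule mono_onD[OF B_mono]) simp_all

lemma Q_eq: "t \<ge> 0 \<Longrightarrow> int (Q i t) = int (q0 i) + int (E i t) - int (B i t) - int (R i t)"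
  unfolding R_def by (rule path_Q)

lemma Q_eq_real:
  "t \<ge> 0 \<Longrightarrow> real (Q i t) = real (q0 i) + real (E i t) - real (B i t) - real (R i t)"
  using Q_eq[of t i] by linarith

lemma Psi_eq_real: "t \<ge> 0 \<Longrightarrow> real (Psi i t) = real (psi0 i) + real (B i t) - real (D i t)"
  using path_Psi[of t i] by linarith

lemma D_eq: "t \<ge> 0 \<Longrightarrow> D i t = S i (A i t)"
  unfolding A_def by (rule path_D)

lemma busy:
  assumes "t \<ge> 0" "Q i t > 0"
  shows "(\<Sum>i\<in>UNIV. Psi i t) = n"
proof (rule path_busy[OF assms(1)])
  show "0 < (\<Sum>i\<in>UNIV. Q i t)"
    by (rule sum_pos2[of UNIV i]) (use assms in simp_all)
qed

lemma E_0 [simp]: "E i 0 = 0"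
proof -
  have "\<not> 1 \<le> E i 0"
    using T E_iff[of 0 1 i] strict_monoD[OF g(1), of 0 1 i] by (auto simp: g(2))
  then show ?thesis by simp
qed

lemma E_le: "0 \<le> s \<Longrightarrow> s \<le> t \<Longrightarrow> t \<le> T \<Longrightarrow> E i s \<le> E i t"
  using E_iff[of s "E i s" i] E_iff[of t "E i s" i] by linarith

lemma E_mono: "mono_on {0..T} (E i)"
  by (auto simp: mono_on_def intro: E_le)

lemma count_le:
  fixes c :: "nat \<Rightarrow> nat"
  shows "0 \<le> s \<Longrightarrow> s \<le> t \<Longrightarrow> t \<le> T \<Longrightarrow> (\<Sum>j=1..E i s. c j) \<le> (\<Sum>j=1..E i t. c j)"
  using E_le[of s t i] by (intro sum_mono2) auto

lemma count_diff:
  fixes c :: "nat \<Rightarrow> nat"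
  assumes "0 \<le> s" "s \<le> t" "t \<le> T"
  shows "(\<Sum>j=1..E i t. c j) = (\<Sum>j=1..E i s. c j) + (\<Sum>j\<in>{E i s<..E i t}. c j)"
proof -
  have "{1..E i t} = {1..E i s} \<union> {E i s<..E i t}" using E_le[OF assms, of i] by auto
  then show ?thesis by (simp add: sum.union_disjoint ivl_disj_int)
qed

lemma R_le: "0 \<le> s \<Longrightarrow> s \<le> t \<Longrightarrow> t \<le> T \<Longrightarrow> R i s \<le> R i t"
  unfolding R_def rejections_def by (rule count_le)

lemma J_le: "0 \<le> s \<Longrightarrow> s \<le> t \<Longrightarrow> t \<le> T \<Longrightarrow> J i s \<le> J i t"
  unfolding J_def joins_def by (rule count_le)

lemma JR: "J i t + R i t = E i t"
proof -
  have "J i t + R i t = (\<Sum>j=1..E i t. 1)"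
    unfolding J_def R_def joins_def rejections_def sum.distrib[symmetric]
    using dec_01 by (intro sum.cong) auto
  then show ?thesis by simp
qed

lemma R_0 [simp]: "R i 0 = 0" and J_0 [simp]: "J i 0 = 0"
  using JR[of i 0] by auto

lemma Q_0 [simp]: "Q i 0 = q0 i"
  using Q_eq[of 0 i] by simp

lemma D_0 [simp]: "D i 0 = 0"
  using D_eq[of 0 i] S by (simp add: A_def)

lemma Psi_0 [simp]: "Psi i 0 = psi0 i"
  using Psi_eq_real[of 0 i] by simp

text \<open>\<open>Q\<close> is not monotone, but it is an integer combination of the monotone
  counts \<open>E\<close>, \<open>B\<close> and \<open>R\<close>.\<close>

lemma left_const:
  assumes "0 < t" "t \<le> T"
  shows "\<forall>\<^sub>F v in at_left t. E i v = left_lim (E i) t"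
    "\<forall>\<^sub>F v in at_left t. B i v = left_lim (B i) t"
    "\<forall>\<^sub>F v in at_left t. R i v = left_lim (R i) t"
    "\<forall>\<^sub>F v in at_left t. J i v = left_lim (J i) t"
    "\<forall>\<^sub>F v in at_left t. Q i v = left_lim (Q i) t"
proof -
  have *: "\<forall>\<^sub>F v in at_left t. f v = left_lim f t" if "mono_on {0..T} f" for f :: "real \<Rightarrow> nat"
    using mono_nat_eventually_const_at_left[OF that assms] by (blast intro: eventually_left_lim)
  show E: "\<forall>\<^sub>F v in at_left t. E i v = left_lim (E i) t"
    by (rule *[OF E_mono])
  show B: "\<forall>\<^sub>F v in at_left t. B i v = left_lim (B i) t"
    by (intro *) (auto simp: mono_on_def intro: B_le)
  show R: "\<forall>\<^sub>F v in at_left t. R i v = left_lim (R i) t"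
    by (intro *) (auto simp: mono_on_def intro: R_le)
  show J: "\<forall>\<^sub>F v in at_left t. J i v = left_lim (J i) t"
    by (intro *) (auto simp: mono_on_def intro: J_le)
  have pos: "\<forall>\<^sub>F v in at_left t. 0 < v"
    using eventually_at_left_real[OF assms(1)] by eventually_elim auto
  have "\<forall>\<^sub>F v in at_left t. Q i v = nat (int (q0 i) + int (left_lim (E i) t) - int (left_lim (B i) t) - int (left_lim (R i) t))"
    using E B R pos
  proof eventually_elim
    case (elim v)
    have "int (Q i v) = int (q0 i) + int (E i v) - int (B i v) - int (R i v)"
      using elim(4) by (intro Q_eq) simp
    then show ?case using elim(1-3) by simp
  qed
  then show "\<forall>\<^sub>F v in at_left t. Q i v = left_lim (Q i) t"
    by (rule eventually_left_lim)
qed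

lemma arrival_time_eq:
  assumes "1 \<le> j" "j \<le> E i t" "0 \<le> t" "t \<le> T"
  shows "arrival_time (E i) j = g i j" "0 < g i j" "g i j \<le> t"
proof -
  show gt: "g i j \<le> t" using assms E_iff by auto
  show g0: "0 < g i j" using assms strict_monoD[OF g(1), of 0 j i] by (simp add: g(2))
  show "arrival_time (E i) j = g i j"
    unfolding arrival_time_def
  proof (rule cInf_eq_minimum)
    show "g i j \<in> {t. 0 \<le> t \<and> j \<le> E i t}" using gt g0 assms by (auto simp: E_iff)
    fix x assume x: "x \<in> {t. 0 \<le> t \<and> j \<le> E i t}"
    show "g i j \<le> x"
    proof (cases "x \<le> T")
      case True
      then show ?thesis using x by (auto simp: E_iff)
    qed (use gt assms in auto)
  qed
qed

text \<open>The slack 2 accounts for the arrival itself and for the deviating customer.\<close>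

lemma last_counted:
  fixes c :: "nat \<Rightarrow> nat"
  assumes st: "0 \<le> s" "s \<le> t" "t \<le> T" and c: "\<And>j. c j \<le> 1"
    and two: "(\<Sum>j=1..E i s. c j) + 2 \<le> (\<Sum>j=1..E i t. c j)"
  obtains v j where "s < v" "v < t" "c j = 1" "sc \<noteq> Some (i, j)"
    "dec i j = (if acc i (Q i v) then 1 else 0)" "(\<Sum>j=1..E i t. c j) \<le> (\<Sum>j=1..E i v. c j) + 2"
proof -
  \<comment> \<open>Counted arrivals in the window other than the deviating customer. Their
    decisions are dictated by \<open>acc\<close>, and the last of them is the one sought.\<close>
  let ?J = "{j\<in>{E i s<..E i t}. c j = 1 \<and> sc \<noteq> Some (i, j)}"
  have excl: "(\<Sum>j\<in>I. c j) \<le> 1"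
    if "\<And>j. j \<in> I \<Longrightarrow> c j = 1 \<Longrightarrow> sc = Some (i, j)" "finite I" for I
  proof (cases "\<exists>j\<in>I. c j = 1")
    case True
    then obtain j where j: "j \<in> I" "c j = 1" by auto
    have "c k = 0" if "k \<in> I - {j}" for k
      using \<open>\<And>j. j \<in> I \<Longrightarrow> c j = 1 \<Longrightarrow> sc = Some (i, j)\<close> j that c[of k]
      by (cases "c k = 1") (auto simp: le_Suc_eq)
    then have "(\<Sum>j\<in>I - {j}. c j) = 0" by simp
    then show ?thesis using j that(2) by (simp add: sum.remove)
  next
    case False
    then have "c j = 0" if "j \<in> I" for j
      using that c[of j] by (cases "c j = 1") auto
    then have "(\<Sum>j\<in>I. c j) = 0" by simp
    then show ?thesis by simp
  qed
  have "?J \<noteq> {}"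
  proof
    assume "?J = {}"
    then have "(\<Sum>j\<in>{E i s<..E i t}. c j) \<le> 1" by (intro excl) auto
    then show False using two count_diff[OF st, of c] by simp
  qed
  define m where "m = Max ?J"
  have m: "m \<in> ?J" unfolding m_def using \<open>?J \<noteq> {}\<close> by (intro Max_in) auto
  have m_max: "j \<le> m" if "j \<in> ?J" for j
    unfolding m_def using that by (intro Max_ge) auto
  have am: "arrival_time (E i) m = g i m" "0 < g i m" "g i m \<le> t"
    using arrival_time_eq[of m i t] m st by auto
  have "s < g i m" using m st E_iff[of s m i] by (auto simp: not_le[symmetric])
  have "\<forall>\<^sub>F v in at_left (g i m). Q i v = left_lim (Q i) (g i m)"
    using left_const[of "g i m"] am st by auto
  moreover have "max s (g i (m - 1)) < g i m"
    using \<open>s < g i m\<close> m strict_monoD[OF g(1), of "m - 1" m i] by auto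
  \<comment> \<open>A time after the previous arrival and so close to the arrival of
    \<open>m\<close> that the queue already has the length that \<open>m\<close> sees.\<close>
  ultimately obtain v where v: "max s (g i (m - 1)) < v" "v < g i m" "Q i v = left_lim (Q i) (g i m)"
    by (rule eventually_at_left_obtain) auto
  have Ev: "E i v = m - 1"
  proof (rule antisym)
    show "m - 1 \<le> E i v" using v st am by (subst E_iff) auto
    have "\<not> m \<le> E i v" using v st am by (subst E_iff) auto
    then show "E i v \<le> m - 1" by simp
  qed
  have mm: "{E i v<..E i t} = insert m {m<..E i t}" using m Ev by auto
  have "(\<Sum>j=1..E i t. c j) = (\<Sum>j=1..E i v. c j) + (\<Sum>j\<in>{E i v<..E i t}. c j)"
    using v st am by (intro count_diff) auto
  also have "(\<Sum>j\<in>{E i v<..E i t}. c j) \<le> 1 + 1"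
  proof -
    have "(\<Sum>j\<in>{m<..E i t}. c j) \<le> 1"
    proof (rule excl)
      fix j assume j: "j \<in> {m<..E i t}" "c j = 1"
      then show "sc = Some (i, j)" using m m_max[of j] by force
    qed simp
    then show ?thesis unfolding mm using c[of m] by simp
  qed
  finally have "(\<Sum>j=1..E i t. c j) \<le> (\<Sum>j=1..E i v. c j) + 2" by simp
  moreover have "dec i m = (if acc i (Q i v) then 1 else 0)"
    using m by (auto simp: decisions_def scenario_profile_def am v)
  ultimately show ?thesis using that[of v m] v am m by auto
qed

lemma last_rejection:
  assumes "0 \<le> s" "s \<le> t" "t \<le> T" "R i s + 2 \<le> R i t"
  obtains v where "s < v" "v < t" "\<not> acc i (Q i v)" "R i t \<le> R i v + 2"
proof (rule last_counted[of s t "\<lambda>j. 1 - dec i j" i])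
  fix v j assume "s < v" "v < t" "1 - dec i j = 1" "dec i j = (if acc i (Q i v) then 1 else 0)"
    "(\<Sum>j=1..E i t. 1 - dec i j) \<le> (\<Sum>j=1..E i v. 1 - dec i j) + 2"
  then show thesis
    using that[of v] by (auto simp: R_def rejections_def split: if_splits)
qed (use assms in \<open>simp_all add: R_def rejections_def\<close>)

lemma last_join:
  assumes "0 \<le> s" "s \<le> t" "t \<le> T" "J i s + 2 \<le> J i t"
  obtains v where "s < v" "v < t" "acc i (Q i v)" "J i t \<le> J i v + 2"
proof (rule last_counted[OF assms(1-3), of "dec i" i])
  show "dec i j \<le> 1" for j by (rule dec_01)
  show "(\<Sum>j=1..E i s. dec i j) + 2 \<le> (\<Sum>j=1..E i t. dec i j)"
    using assms(4) by (simp only: J_def joins_def)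
  fix v j assume v: "s < v" "v < t" "dec i j = 1" "dec i j = (if acc i (Q i v) then 1 else 0)"
    "(\<Sum>j=1..E i t. dec i j) \<le> (\<Sum>j=1..E i v. dec i j) + 2"
  have "acc i (Q i v)" using v(3,4) by (metis zero_neq_one)
  moreover have "J i t \<le> J i v + 2" using v(5) by (simp only: J_def joins_def)
  ultimately show thesis using that[OF v(1,2)] by blast
qed

end

text \<open>\<open>f\<close> is only integrable, so no differential inequality is available. Instead
  let \<open>m\<close> be the supremum of \<open>f\<close> weighted by
  \<open>exp (- 2 * c * t)\<close>, finite by boundedness: under this weight the integral term
  contributes at most half of \<open>m\<close>, so \<open>m > 2 * a\<close> is impossible.\<close>

lemma gronwall_integral:
  fixes f :: "real \<Rightarrow> real"
  assumes f: "f integrable_on {0..T}" "\<And>t. t \<in> {0..T} \<Longrightarrow> \<bar>f t\<bar> \<le> b"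
    and le: "\<And>t. t \<in> {0..T} \<Longrightarrow> f t \<le> a + c * integral {0..t} f" and c: "c > 0" and a: "a \<ge> 0" and t: "t \<in> {0..T}"
  shows "f t \<le> 2 * a * exp (2 * c * t)"
proof -
  define m where "m = (SUP t\<in>{0..T}. exp (- 2 * c * t) * f t)"
  have bdd: "bdd_above ((\<lambda>t. exp (- 2 * c * t) * f t) ` {0..T})"
  proof (rule bdd_aboveI2)
    fix t assume t: "t \<in> {0..T}"
    have "exp (- 2 * c * t) * f t \<le> exp (- 2 * c * t) * \<bar>f t\<bar>" by simp
    also have "\<dots> \<le> 1 * b" using f(2)[OF t] t c by (intro mult_mono) auto
    finally show "exp (- 2 * c * t) * f t \<le> b" by simp
  qed
  have le_m: "exp (- 2 * c * t) * f t \<le> m" if "t \<in> {0..T}" for t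
    unfolding m_def using bdd that by (intro cSUP_upper)
  have f_le: "f t \<le> m * exp (2 * c * t)" if "t \<in> {0..T}" for t
  proof -
    have "exp (2 * c * t) * (exp (- 2 * c * t) * f t) \<le> exp (2 * c * t) * m"
      by (intro mult_left_mono le_m that) simp
    moreover have "exp (2 * c * t) * (exp (- 2 * c * t) * f t) = f t"
      by (simp only: mult.assoc[symmetric] exp_add[symmetric]) simp
    ultimately show ?thesis by (simp only: mult.commute)
  qed
  have "m \<le> 2 * a"
  proof (rule ccontr)
    assume m: "\<not> m \<le> 2 * a"
    have "exp (- 2 * c * t) * f t \<le> m / 2" if t: "t \<in> {0..T}" for t
    proof -
      have "((\<lambda>u. m * exp (2 * c * u)) has_integral
          (m / (2 * c) * exp (2 * c * t) - m / (2 * c) * exp (2 * c * 0))) {0..t}"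
        using t c by (intro fundamental_theorem_of_calculus)
          (auto intro!: derivative_eq_intros simp: has_real_derivative_iff_has_vector_derivative[symmetric])
      then have int: "(\<lambda>u. m * exp (2 * c * u)) integrable_on {0..t}"
        "integral {0..t} (\<lambda>u. m * exp (2 * c * u)) = m / (2 * c) * exp (2 * c * t) - m / (2 * c)"
        by (auto simp: has_integral_iff)
      have "f integrable_on {0..t}"
        using f(1) by (rule integrable_on_subinterval) (use t in auto)
      then have "integral {0..t} f \<le> m / (2 * c) * exp (2 * c * t) - m / (2 * c)"
        unfolding int(2)[symmetric] using int(1) t f_le by (intro integral_le) auto
      then have "c * integral {0..t} f \<le> c * (m / (2 * c) * exp (2 * c * t) - m / (2 * c))"
        using c by (intro mult_left_mono) auto
      also have "\<dots> = m / 2 * exp (2 * c * t) - m / 2"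
        using c by (simp add: field_simps)
      finally have "f t \<le> m / 2 * exp (2 * c * t)"
        using le[OF t] m by simp
      then have "exp (- 2 * c * t) * f t \<le> exp (- 2 * c * t) * (m / 2 * exp (2 * c * t))"
        by (intro mult_left_mono) auto
      also have "\<dots> = m / 2 * (exp (- 2 * c * t) * exp (2 * c * t))"
        by simp
      also have "exp (- 2 * c * t) * exp (2 * c * t) = 1"
        by (simp add: exp_add[symmetric])
      finally show ?thesis by simp
    qed
    then have "m \<le> m / 2" using t unfolding m_def by (intro cSUP_least) auto
    then show False using m a by simp
  qed
  then have "m * exp (2 * c * t) \<le> 2 * a * exp (2 * c * t)"
    by (intro mult_right_mono) auto
  then show ?thesis using f_le[OF t] by linarith
qed

text \<open>\<open>f\<close> is the pointwise limit of its values at the grid points of mesh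
  \<open>1 / Suc k\<close> next to the right of \<open>t\<close>. These lie strictly above
  \<open>t\<close>, where eventual constancy applies, and each approximant is a function of an
  integer.\<close>

lemma right_continuous_measurable:
  fixes f :: "real \<Rightarrow> real"
  assumes f: "\<And>t. \<forall>\<^sub>F v in at_right t. f v = f t"
  shows "f \<in> borel_measurable borel"
proof (rule borel_measurable_LIMSEQ_real)
  fix t :: real
  define x where "x k = (real_of_int \<lfloor>t * real (Suc k)\<rfloor> + 1) / real (Suc k)" for k
  have x_gt: "t < x k" for k
    unfolding x_def by (subst pos_less_divide_eq) (simp, linarith)
  have x_le: "x k \<le> t + 1 / real (Suc k)" for k
  proof -
    have "real_of_int \<lfloor>t * real (Suc k)\<rfloor> + 1 \<le> t * real (Suc k) + 1" by simp
    also have "\<dots> = (t + 1 / real (Suc k)) * real (Suc k)" by (simp add: field_simps)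
    finally show ?thesis unfolding x_def by (simp only: pos_divide_le_eq of_nat_0_less_iff zero_less_Suc)
  qed
  have "(\<lambda>k. t + 1 / real (Suc k)) \<longlonglongrightarrow> t + 0"
    by (intro tendsto_add tendsto_const LIMSEQ_Suc[OF lim_1_over_n])
  then have "x \<longlonglongrightarrow> t"
    by (intro real_tendsto_sandwich[where f = "\<lambda>_. t" and g = x and h = "\<lambda>k. t + 1 / real (Suc k)"]
        always_eventually allI less_imp_le x_gt x_le tendsto_const) simp
  then have "filterlim x (at_right t) sequentially"
    by (rule tendsto_imp_filterlim_at_right) (intro always_eventually allI x_gt)
  then have "\<forall>\<^sub>F k in sequentially. f (x k) = f t"
    by (rule eventually_compose_filterlim[OF f])
  then show "(\<lambda>k. f ((real_of_int \<lfloor>t * real (Suc k)\<rfloor> + 1) / real (Suc k))) \<longlonglongrightarrow> f t"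
    unfolding x_def by (rule tendsto_eventually)
next
  fix k :: nat
  have "(\<lambda>t. \<lfloor>t * real (Suc k)\<rfloor>) \<in> borel \<rightarrow>\<^sub>M count_space UNIV" by measurable
  from measurable_compose[OF this, of "\<lambda>z. f ((real_of_int z + 1) / real (Suc k))" borel]
  show "(\<lambda>t. f ((real_of_int \<lfloor>t * real (Suc k)\<rfloor> + 1) / real (Suc k))) \<in> borel_measurable borel"
    by simp
qed

lemma right_continuous_bounded_integrable:
  fixes f :: "real \<Rightarrow> real"
  assumes f: "\<And>t. t \<ge> 0 \<Longrightarrow> \<forall>\<^sub>F v in at_right t. f v = f t" and b: "\<And>t. t \<ge> 0 \<Longrightarrow> \<bar>f t\<bar> \<le> b"
    and "0 \<le> s"
  shows "f integrable_on {s..t}"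
proof -
  let ?F = "\<lambda>t. if t < 0 then 0 else f t"
  have "\<forall>\<^sub>F v in at_right t. ?F v = ?F t" for t
  proof (cases "t < 0")
    case True
    show ?thesis
      using eventually_at_right_real[OF True] by eventually_elim (use True in auto)
  next
    case False
    then have "\<forall>\<^sub>F v in at_right t. f v = f t" by (intro f) simp
    then show ?thesis
      using eventually_at_right_less[of t] by eventually_elim (use False in simp)
  qed
  then have "?F \<in> borel_measurable borel" by (rule right_continuous_measurable)
  then have "?F \<in> borel_measurable lborel"
    by (simp only: measurable_lborel2)
  then have "?F \<in> borel_measurable (completion lborel)"
    by (rule measurable_completion)
  then have F: "?F \<in> borel_measurable (lebesgue_on {s..t})"
    by (rule measurable_restrict_space1)
  have "?F integrable_on {s..t}"
  proof (rule measurable_bounded_by_integrable_imp_integrable[OF F])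
    show "(\<lambda>_. b) integrable_on {s..t}" by (rule integrable_const_ivl)
    show "norm (?F x) \<le> b" if "x \<in> {s..t}" for x
      using b[of x] that \<open>0 \<le> s\<close> by simp
  qed simp
  then show ?thesis
    by (rule integrable_eq) (use \<open>0 \<le> s\<close> in simp)
qed

section \<open>Bounds on the diffusion scale\<close>

text \<open>\<open>N\<close> is the number of classes, \<open>m\<close> the total service rate,
  \<open>T\<close> the horizon. In units of \<open>sqrt n\<close>,
  \<open>8 * N * kap + 2 * N\<close> is the initial term for the total of \<open>X\<close>; the
  exponential and the factor 4 come from the Gronwall estimate for \<open>Y\<close>, and
  \<open>1 + 2 * m * T\<close> covers the queues, which take one more integration. The noise level
  \<open>eps\<close> is absent on purpose.\<close>

definition path_bound :: "real \<Rightarrow> real \<Rightarrow> real \<Rightarrow> real \<Rightarrow> real" where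
  "path_bound N kap m T = 4 * (8 * N * kap + 2 * N) * (1 + 2 * m * T) * exp (8 * m * T)"

context loss_system
begin

lemma Psi_le_n: "t \<ge> 0 \<Longrightarrow> real (Psi i t) \<le> real n"
proof -
  assume t: "t \<ge> 0"
  have "Psi i t \<le> (\<Sum>i\<in>UNIV. Psi i t)" by (rule member_le_sum) auto
  then show ?thesis using Psi_le[OF t] by linarith
qed

lemma Psi_integrable:
  fixes c :: real
  assumes "0 \<le> s"
  shows "(\<lambda>u. real (Psi i u)) integrable_on {s..t}" "(\<lambda>u. real (Psi i u) - c) integrable_on {s..t}"
    "(\<lambda>u. \<bar>real (Psi i u) - c\<bar>) integrable_on {s..t}"
proof -
  have *: "(\<lambda>u. F (real (Psi i u))) integrable_on {s..t}" if "\<And>x. 0 \<le> x \<Longrightarrow> x \<le> n \<Longrightarrow> \<bar>F x\<bar> \<le> real n + \<bar>c\<bar>" for F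
  proof (rule right_continuous_bounded_integrable[OF _ _ assms])
    fix t :: real assume t: "t \<ge> 0"
    show "\<forall>\<^sub>F v in at_right t. F (real (Psi i v)) = F (real (Psi i t))"
      using right_const(2)[OF t, of i] by eventually_elim simp
    show "\<bar>F (real (Psi i t))\<bar> \<le> real n + \<bar>c\<bar>"
      using that Psi_le_n[OF t] by simp
  qed
  show "(\<lambda>u. real (Psi i u)) integrable_on {s..t}" by (rule *[of "\<lambda>x. x"]) simp
  show "(\<lambda>u. real (Psi i u) - c) integrable_on {s..t}" by (rule *[of "\<lambda>x. x - c"]) simp
  show "(\<lambda>u. \<bar>real (Psi i u) - c\<bar>) integrable_on {s..t}" by (rule *[of "\<lambda>x. \<bar>x - c\<bar>"]) simp
qed

lemma A_diff:
  assumes "0 \<le> s" "s \<le> t"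
  shows "A i t - A i s = integral {s..t} (\<lambda>u. real (Psi i u))"
  unfolding A_def using Henstock_Kurzweil_Integration.integral_combine[OF assms Psi_integrable(1)[OF order.refl]]
  by (simp add: algebra_simps)

lemma A_bounds:
  assumes "0 \<le> s" "s \<le> t"
  shows "A i s \<le> A i t" "A i t - A i s \<le> real n * (t - s)"
proof -
  have "0 \<le> integral {s..t} (\<lambda>u. real (Psi i u))"
    by (intro integral_nonneg Psi_integrable assms) simp
  then show "A i s \<le> A i t" using A_diff[OF assms, of i] by simp
  have "integral {s..t} (\<lambda>u. real (Psi i u)) \<le> integral {s..t} (\<lambda>u. real n)"
    by (intro integral_le Psi_integrable assms) (use assms Psi_le_n in auto)
  then show "A i t - A i s \<le> real n * (t - s)"
    unfolding A_diff[OF assms] using assms by (simp add: mult.commute)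
qed

lemma A_range: "0 \<le> t \<Longrightarrow> t \<le> T \<Longrightarrow> 0 \<le> A i t \<and> A i t \<le> real n * T"
proof -
  assume t: "0 \<le> t" "t \<le> T"
  have "A i 0 = 0" by (simp add: A_def)
  moreover have "real n * t \<le> real n * T" using t by (intro mult_left_mono) auto
  ultimately show ?thesis using A_bounds[of 0 t i] t by simp
qed

lemma A_centered:
  assumes "0 \<le> s" "s \<le> t"
  shows "A i t - A i s - c * (t - s) = integral {s..t} (\<lambda>u. real (Psi i u) - c)"
    "\<bar>A i t - A i s - c * (t - s)\<bar> \<le> integral {s..t} (\<lambda>u. \<bar>real (Psi i u) - c\<bar>)"
proof -
  show *: "A i t - A i s - c * (t - s) = integral {s..t} (\<lambda>u. real (Psi i u) - c)"
    unfolding A_diff[OF assms]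
    by (subst Henstock_Kurzweil_Integration.integral_diff) (use assms in \<open>auto intro: Psi_integrable\<close>)
  show "\<bar>A i t - A i s - c * (t - s)\<bar> \<le> integral {s..t} (\<lambda>u. \<bar>real (Psi i u) - c\<bar>)"
    unfolding * real_norm_def[symmetric] by (rule integral_norm_bound_integral)
      (use assms in \<open>auto intro: Psi_integrable\<close>)
qed

text \<open>Every class with at least two rejections has a last one in the sense of
  \<open>last_rejection\<close>; the latest of these serves all classes at once. A single rejection
  may be due to the deviating customer and says nothing about the queue, whence the first
  alternative.\<close>

lemma total_last_rejection:
  assumes st: "0 \<le> s" "s \<le> t" "t \<le> T"
  obtains "\<And>k. R k t \<le> R k s + 1"
    | v i where "s < v" "v < t" "\<not> acc i (Q i v)" "\<And>k. R k t \<le> R k v + 2"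
proof (cases "\<exists>k. R k s + 2 \<le> R k t")
  case False
  then show ?thesis using that(1) by (metis Suc_eq_plus1 add_2_eq_Suc' not_less_eq_eq)
next
  case True
  define P where "P k v \<longleftrightarrow> s < v \<and> v < t \<and> \<not> acc k (Q k v) \<and> R k t \<le> R k v + 2" for k v
  define K where "K = {k. R k s + 2 \<le> R k t}"
  have "\<exists>v. P k v" if "k \<in> K" for k
    using last_rejection[OF st, of k] that unfolding K_def P_def by blast
  then obtain f where f: "\<And>k. k \<in> K \<Longrightarrow> P k (f k)" by metis
  have fin: "finite (f ` K)" "f ` K \<noteq> {}" using True by (auto simp: K_def)
  obtain i where i: "i \<in> K" "Max (f ` K) = f i" using Max_in[OF fin] by blast
  have fi: "s < f i" "f i < t" "\<not> acc i (Q i (f i))" using f[OF i(1)] by (auto simp: P_def)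
  have "R k t \<le> R k (f i) + 2" for k
  proof (cases "k \<in> K")
    case True
    have "f k \<le> f i" unfolding i(2)[symmetric] using True fin by (intro Max_ge) auto
    then have "R k (f k) \<le> R k (f i)"
      using f[OF True] fi st by (intro R_le) (auto simp: P_def)
    then show ?thesis using f[OF True] by (auto simp: P_def)
  next
    case False
    have "R k s \<le> R k (f i)" using fi st by (intro R_le) auto
    then show ?thesis using False by (auto simp: K_def)
  qed
  then show ?thesis using that(2) fi by blast
qed

end

text \<open>Randomness enters through inequalities for \<open>E\<close>, \<open>S\<close> and the
  initial state, which are the same in every scenario. \<open>NE\<close> and \<open>NS\<close> are
  fine bounds for windows, \<open>TE\<close> and \<open>TS\<close> coarse global ones; the last
  condition makes the effect on departures of a service imbalance of order \<open>sqrt n\<close>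
  smaller than the window noise.\<close>

locale noisy_loss_system = loss_system pol n E S q0 psi0 acc sc Q Psi B D g T
  for pol :: scheduling and n :: nat and E S :: "'k::{finite,linorder} process"
    and q0 psi0 :: "'k \<Rightarrow> nat" and acc :: "'k \<Rightarrow> nat \<Rightarrow> bool" and sc :: "'k scenario"
    and Q Psi B D :: "'k process" and g :: "'k \<Rightarrow> nat \<Rightarrow> real" and T :: real +
  fixes lam mu rho :: "'k \<Rightarrow> real" and eps kap :: real
  assumes lam: "\<And>i. lam i > 0" and mu: "\<And>i. mu i > 0" and rho: "\<And>i. rho i = lam i / mu i"
    and rho_sum: "(\<Sum>i\<in>UNIV. rho i) = 1"
    and eps: "0 < eps" "eps \<le> 1" "1 \<le> kap"
    and NE: "\<And>i (s::real) t. 0 \<le> s \<Longrightarrow> s \<le> t \<Longrightarrow> t \<le> T \<Longrightarrow>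
        \<bar>real (E i t) - real (E i s) - n * lam i * (t - s)\<bar> \<le> eps * (sqrt n + n * (t - s))"
    and NS: "\<And>i (x::real) y. 0 \<le> x \<Longrightarrow> x \<le> y \<Longrightarrow> y \<le> n * T \<Longrightarrow>
        \<bar>real (S i y) - real (S i x) - mu i * (y - x)\<bar> \<le> eps * (sqrt n + (y - x))"
    and TE: "\<And>i (t::real). 0 \<le> t \<Longrightarrow> t \<le> T \<Longrightarrow> \<bar>real (E i t) - n * lam i * t\<bar> \<le> kap * sqrt n"
    and TS: "\<And>i (x::real). 0 \<le> x \<Longrightarrow> x \<le> n * T \<Longrightarrow> \<bar>real (S i x) - mu i * x\<bar> \<le> kap * sqrt n"
    and I0: "\<And>i. real (q0 i) \<le> eps * sqrt n" "\<And>i. \<bar>real (psi0 i) - n * rho i\<bar> \<le> kap * sqrt n"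
    and acc_0: "\<And>i. acc i 0"
    and n_large: "2 \<le> eps * sqrt n"
      "(\<Sum>i\<in>UNIV. mu i) * path_bound (CARD('k)) kap (\<Sum>i\<in>UNIV. mu i) T \<le> eps * sqrt n"
begin

abbreviation r :: real where "r \<equiv> sqrt (real n)"
abbreviation m :: real where "m \<equiv> (\<Sum>i\<in>UNIV. mu i)"
abbreviation K :: real where "K \<equiv> path_bound CARD('k) kap m T"

definition dPsi :: "'k \<Rightarrow> real \<Rightarrow> real" where "dPsi i t = real (Psi i t) - n * rho i"
definition Y :: "real \<Rightarrow> real" where "Y t = (\<Sum>i\<in>UNIV. \<bar>dPsi i t\<bar>)"
text \<open>Adding the queue and the centred number in service cancels the routing count
  \<open>B\<close>, so the balance equation of \<open>X\<close> does not involve the scheduling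
  policy directly.\<close>

definition X :: "'k \<Rightarrow> real \<Rightarrow> real" where "X i t = real (Q i t) + dPsi i t"

lemma card_ge_1: "real CARD('k) \<ge> 1"
  by (simp add: Suc_le_eq)

lemma r: "r \<ge> 1" "r * r = n"
  using n by auto

lemma mu_le: "mu i \<le> m"
  by (rule member_le_sum) (auto simp: less_imp_le mu)

lemma m_pos: "m > 0"
  using mu by (intro sum_pos) auto

lemma mu_rho: "mu i * rho i = lam i"
  using mu[of i] by (simp add: rho)

lemma Y_integrable: "0 \<le> s \<Longrightarrow> Y integrable_on {s..t}"
  unfolding Y_def dPsi_def by (intro integrable_sum Psi_integrable) auto

lemma dPsi_integrable: "0 \<le> s \<Longrightarrow> (\<lambda>u. \<bar>dPsi i u\<bar>) integrable_on {s..t}"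
  unfolding dPsi_def by (intro Psi_integrable) auto

lemma Y_ge: "\<bar>dPsi i t\<bar> \<le> Y t"
  unfolding Y_def by (rule member_le_sum) auto

lemma sum_dPsi_integral_le:
  assumes "0 \<le> s"
  shows "(\<Sum>i\<in>UNIV. mu i * integral {s..t} (\<lambda>u. \<bar>dPsi i u\<bar>)) \<le> m * integral {s..t} Y"
proof -
  have "(\<Sum>i\<in>UNIV. mu i * integral {s..t} (\<lambda>u. \<bar>dPsi i u\<bar>)) \<le>
      (\<Sum>i\<in>UNIV. m * integral {s..t} (\<lambda>u. \<bar>dPsi i u\<bar>))"
    by (intro sum_mono mult_right_mono mu_le integral_nonneg dPsi_integrable assms) auto
  also have "\<dots> = m * integral {s..t} Y"
    unfolding Y_def
    by (subst integral_sum) (use assms in \<open>auto intro: dPsi_integrable simp: sum_distrib_left\<close>)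
  finally show ?thesis .
qed

lemma integral_Y_mono: "0 \<le> s \<Longrightarrow> s \<le> t \<Longrightarrow> integral {0..s} Y \<le> integral {0..t} Y"
  by (rule integral_subset_le) (auto intro: Y_integrable simp: Y_def sum_nonneg)

text \<open>Since \<open>mu i * rho i = lam i\<close>, the fluid terms cancel and only the initial
  state, two noise terms and the imbalance of service are left. \<open>4 * kap\<close> collects four
  bounds, of which the one for the initial queue is \<open>eps \<le> kap\<close>.\<close>

lemma X_eq:
  assumes "0 \<le> t" "t \<le> T"
  shows "\<bar>X i t + real (R i t)\<bar> \<le> 4 * kap * r + mu i * integral {0..t} (\<lambda>u. \<bar>dPsi i u\<bar>)"
proof -
  have "X i t + real (R i t) = real (q0 i) + (real (psi0 i) - n * rho i) + (real (E i t) - n * lam i * t)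
      - (real (S i (A i t)) - mu i * A i t) - mu i * (A i t - A i 0 - n * rho i * (t - 0))"
    using Q_eq_real[OF assms(1), of i] Psi_eq_real[OF assms(1), of i] D_eq[OF assms(1), of i]
    by (simp add: X_def dPsi_def A_def algebra_simps mu_rho[of i, symmetric])
  also have "\<bar>\<dots>\<bar> \<le> eps * r + kap * r + kap * r + kap * r + mu i * integral {0..t} (\<lambda>u. \<bar>dPsi i u\<bar>)"
  proof -
    have "\<bar>mu i * (A i t - A i 0 - n * rho i * (t - 0))\<bar> \<le> mu i * integral {0..t} (\<lambda>u. \<bar>dPsi i u\<bar>)"
      unfolding abs_mult dPsi_def using A_centered(2)[of 0 t i "n * rho i"] assms mu[of i]
      by (simp add: less_imp_le)
    then show ?thesis
      using I0(1)[of i] I0(2)[of i] TE[OF assms, of i] TS[of "A i t" i] A_range[OF assms, of i] by linarith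
  qed
  also have "\<dots> \<le> 4 * kap * r + mu i * integral {0..t} (\<lambda>u. \<bar>dPsi i u\<bar>)"
    using mult_right_mono[of eps kap r] eps by simp
  finally show ?thesis .
qed

text \<open>Nonidling: if some queue is nonempty all servers are busy and, the \<open>rho i\<close>
  summing to 1, the centred numbers in service add up to 0; otherwise they add up to at most
  0.\<close>

lemma sum_Q_le:
  assumes "t \<ge> 0"
  shows "(\<Sum>i\<in>UNIV. real (Q i t)) = max 0 (\<Sum>i\<in>UNIV. X i t)"
proof -
  have sumX: "(\<Sum>i\<in>UNIV. X i t) = (\<Sum>i\<in>UNIV. real (Q i t)) + real (\<Sum>i\<in>UNIV. Psi i t) - n"
    by (simp add: X_def dPsi_def sum.distrib sum_subtractf sum_distrib_left[symmetric] rho_sum)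
  show ?thesis
  proof (cases "\<exists>i. Q i t > 0")
    case True
    then have "(\<Sum>i\<in>UNIV. Psi i t) = n" using busy[OF assms] by blast
    then show ?thesis unfolding sumX by (simp add: sum_nonneg)
  next
    case False
    moreover have "real (\<Sum>i\<in>UNIV. Psi i t) \<le> n" using Psi_le[OF assms] by (simp only: of_nat_le_iff)
    ultimately show ?thesis unfolding sumX by simp
  qed
qed

text \<open>\<open>X\<close> is bounded by noise, an integral and the rejections; the rejections by
  the total of \<open>X + R\<close> at the last rejection; and \<open>dPsi\<close> by
  \<open>X\<close>, because the total queue is the positive part of the total of \<open>X\<close>.
  The loop closes in an integral inequality for \<open>Y\<close>.\<close>

lemma path_bounds:
  assumes t: "0 \<le> t" "t \<le> T"
  shows "Y t \<le> K * r" "(\<Sum>i\<in>UNIV. real (Q i t)) \<le> K * r"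
proof -
  define a where "a = (8 * real CARD('k) * kap + 2 * real CARD('k)) * r"
  have a0: "a \<ge> 0" using eps by (simp add: a_def)
  define V where "V t = (\<Sum>i\<in>UNIV. \<bar>X i t\<bar>)" for t
  have sumXR: "(\<Sum>i\<in>UNIV. \<bar>X i t + real (R i t)\<bar>) \<le> 4 * real CARD('k) * kap * r + m * integral {0..t} Y"
    if t: "0 \<le> t" "t \<le> T" for t
  proof -
    have "(\<Sum>i\<in>UNIV. \<bar>X i t + real (R i t)\<bar>) \<le>
        (\<Sum>i\<in>UNIV. 4 * kap * r + mu i * integral {0..t} (\<lambda>u. \<bar>dPsi i u\<bar>))"
      by (intro sum_mono X_eq t)
    then show ?thesis using sum_dPsi_integral_le[of 0 t] by (simp add: sum.distrib)
  qed
  have R_le': "(\<Sum>i\<in>UNIV. real (R i t)) \<le> 4 * real CARD('k) * kap * r + 2 * real CARD('k) * r + m * integral {0..t} Y"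
    if t: "0 \<le> t" "t \<le> T" for t
  proof -
    have Y0: "integral {0..t} Y \<ge> 0"
      by (intro integral_nonneg Y_integrable) (auto simp: Y_def sum_nonneg)
    have Nr: "real CARD('k) \<le> real CARD('k) * r" "0 \<le> real CARD('k) * kap * r" using r card_ge_1 eps by auto
    consider "\<And>k. R k t \<le> R k 0 + 1"
      | v i where "0 < v" "v < t" "\<not> acc i (Q i v)" "\<And>k. R k t \<le> R k v + 2"
      using total_last_rejection[of 0 t] t by auto
    then show ?thesis
    proof cases
      case 1
      then have "(\<Sum>i\<in>UNIV. real (R i t)) \<le> (\<Sum>i\<in>(UNIV::'k set). 1)"
        by (intro sum_mono) (metis R_0 add_0 of_nat_1 of_nat_le_iff)
      then have "(\<Sum>i\<in>UNIV. real (R i t)) \<le> real CARD('k)" by simp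
      moreover have "0 \<le> m * integral {0..t} Y" using Y0 m_pos by simp
      ultimately show ?thesis using Nr by linarith
    next
      case 2
      have "Q i v > 0" using 2(3) acc_0[of i] by (cases "Q i v = 0") auto
      then have "(\<Sum>i\<in>UNIV. real (Q i v)) > 0" by (intro sum_pos2[of UNIV i]) auto
      \<comment> \<open>A strictly positive positive part equals the sum itself; the sign of this
        sum allows adding it to the rejections.\<close>
      then have "(\<Sum>i\<in>UNIV. X i v) \<ge> 0" using sum_Q_le[of v] 2(1) by simp
      then have "(\<Sum>i\<in>UNIV. real (R i v)) \<le> (\<Sum>i\<in>UNIV. X i v + real (R i v))"
        by (simp add: sum.distrib)
      also have "\<dots> \<le> (\<Sum>i\<in>UNIV. \<bar>X i v + real (R i v)\<bar>)" by (intro sum_mono) simp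
      also have "\<dots> \<le> 4 * real CARD('k) * kap * r + m * integral {0..v} Y"
        using 2 t by (intro sumXR) auto
      also have "\<dots> \<le> 4 * real CARD('k) * kap * r + m * integral {0..t} Y"
        using 2 m_pos by (intro add_left_mono mult_left_mono integral_Y_mono) auto
      finally have RQ: "(\<Sum>i\<in>UNIV. real (R i v)) \<le> 4 * real CARD('k) * kap * r + m * integral {0..t} Y" .
      have "(\<Sum>i\<in>UNIV. real (R i t)) \<le> (\<Sum>i\<in>UNIV. real (R i v) + 2)"
        using 2(4) by (intro sum_mono) (metis of_nat_add of_nat_le_iff of_nat_numeral)
      then have "(\<Sum>i\<in>UNIV. real (R i t)) \<le> (\<Sum>i\<in>UNIV. real (R i v)) + 2 * real CARD('k)"
        by (simp add: sum.distrib)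
      with RQ show ?thesis using Nr by linarith
    qed
  qed
  have V_le: "V t \<le> a + 2 * m * integral {0..t} Y" if t: "0 \<le> t" "t \<le> T" for t
  proof -
    have "V t \<le> (\<Sum>i\<in>UNIV. \<bar>X i t + real (R i t)\<bar> + real (R i t))"
      unfolding V_def by (intro sum_mono) linarith
    then show ?thesis using sumXR[OF t] R_le'[OF t] by (simp add: sum.distrib a_def algebra_simps)
  qed
  have Q_V: "(\<Sum>i\<in>UNIV. real (Q i t)) \<le> V t" if t: "0 \<le> t" for t
    unfolding sum_Q_le[OF t] V_def by (auto intro: sum_mono sum_nonneg)
  have Y_V: "Y t \<le> 2 * V t" if t: "0 \<le> t" for t
  proof -
    have "Y t \<le> (\<Sum>i\<in>UNIV. \<bar>X i t\<bar> + real (Q i t))"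
      unfolding Y_def by (intro sum_mono) (simp add: X_def)
    then show ?thesis using Q_V[OF t] by (simp add: sum.distrib V_def)
  qed
  have Y_exp: "Y t \<le> 4 * a * exp (8 * m * t)" if t: "0 \<le> t" "t \<le> T" for t
  proof -
    have "Y t \<le> 2 * (2 * a) * exp (2 * (4 * m) * t)"
    proof (rule gronwall_integral)
      show "Y integrable_on {0..T}" by (rule Y_integrable) simp
      show "Y t \<le> 2 * a + 4 * m * integral {0..t} Y" if "t \<in> {0..T}" for t
        using Y_V[of t] V_le[of t] that by simp
      show "\<bar>Y t\<bar> \<le> (\<Sum>i\<in>UNIV. n + \<bar>n * rho i\<bar>)" if "t \<in> {0..T}" for t
      proof -
        have "Y t \<le> (\<Sum>i\<in>UNIV. n + \<bar>n * rho i\<bar>)"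
          unfolding Y_def dPsi_def using that Psi_le_n[of t]
          by (intro sum_mono) (smt (verit) atLeastAtMost_iff of_nat_0_le_iff)
        then show ?thesis by (simp add: Y_def sum_nonneg)
      qed
    qed (use t m_pos a0 in auto)
    then show ?thesis by simp
  qed
  have exp_le: "4 * a * exp (8 * m * t) \<le> 4 * a * exp (8 * m * T)" if "t \<le> T" for t
    using that m_pos a0 by (intro mult_left_mono) auto
  have Kr: "K * r = 4 * a * exp (8 * m * T) + 2 * m * T * (4 * a * exp (8 * m * T))"
    by (simp add: path_bound_def a_def algebra_simps)
  have nn: "0 \<le> 2 * m * T * (4 * a * exp (8 * m * T))" using m_pos T a0 by simp
  show "Y t \<le> K * r" using Y_exp[OF t] exp_le[OF t(2)] nn unfolding Kr by linarith
  have "integral {0..t} Y \<le> integral {0..t} (\<lambda>_. 4 * a * exp (8 * m * T))"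
    using t by (intro integral_le Y_integrable) (auto intro: order_trans[OF Y_exp exp_le])
  also have "\<dots> = t * (4 * a * exp (8 * m * T))" using t by simp
  also have "\<dots> \<le> T * (4 * a * exp (8 * m * T))"
    using t a0 by (intro mult_right_mono) auto
  finally have "2 * m * integral {0..t} Y \<le> 2 * m * (T * (4 * a * exp (8 * m * T)))"
    using m_pos by (intro mult_left_mono) auto
  moreover have "a \<le> 4 * a * exp (8 * m * T)"
    using a0 m_pos T mult_mono[of a "4 * a" 1 "exp (8 * m * T)"] by simp
  ultimately show "(\<Sum>i\<in>UNIV. real (Q i t)) \<le> K * r"
    using Q_V[OF t(1)] V_le[OF t] unfolding Kr by (simp add: algebra_simps)
qed

lemma Q_le: "0 \<le> t \<Longrightarrow> t \<le> T \<Longrightarrow> real (Q i t) \<le> K * r"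
  using path_bounds(2)[of t] member_le_sum[of i UNIV "\<lambda>i. real (Q i t)"] by simp

text \<open>One \<open>eps\<close> is the noise of the service process. The other pays for replacing
  the busy time by \<open>n * rho i * (t - s)\<close>: by \<open>path_bounds\<close> and the size of
  \<open>n\<close>, an imbalance of order \<open>sqrt n\<close> is a small multiple of
  \<open>n\<close> per unit time.\<close>

lemma ND:
  fixes s t :: real
  assumes st: "0 \<le> s" "s \<le> t" "t \<le> T"
  shows "\<bar>real (D i t) - real (D i s) - n * lam i * (t - s)\<bar> \<le> 2 * eps * (r + n * (t - s))"
proof -
  have t0: "0 \<le> t" using st by simp
  have "\<bar>A i t - A i s - n * rho i * (t - s)\<bar> \<le> integral {s..t} (\<lambda>u. \<bar>real (Psi i u) - n * rho i\<bar>)"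
    using st by (intro A_centered) auto
  also have "\<dots> \<le> integral {s..t} (\<lambda>_. K * r)"
  proof (intro integral_le Psi_integrable)
    fix u assume u: "u \<in> {s..t}"
    show "\<bar>real (Psi i u) - n * rho i\<bar> \<le> K * r"
      using path_bounds(1)[of u] Y_ge[of i u] u st unfolding dPsi_def by simp
  qed (use st in auto)
  also have "\<dots> = K * r * (t - s)" using st by simp
  finally have "mu i * \<bar>A i t - A i s - n * rho i * (t - s)\<bar> \<le> m * (K * r * (t - s))"
    using mu_le[of i] mu[of i] by (intro mult_mono) auto
  also have "\<dots> = (m * K) * (r * (t - s))" by simp
  also have "\<dots> \<le> (eps * r) * (r * (t - s))"
    using st by (intro mult_right_mono n_large) auto
  also have "\<dots> = eps * (n * (t - s))" using r(2) by (metis mult.assoc)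
  finally have *: "mu i * \<bar>A i t - A i s - n * rho i * (t - s)\<bar> \<le> eps * (n * (t - s))" .
  have 1: "\<bar>mu i * (A i t - A i s) - n * lam i * (t - s)\<bar> \<le> eps * (n * (t - s))"
  proof -
    have "mu i * (A i t - A i s) - n * lam i * (t - s) = mu i * (A i t - A i s - n * rho i * (t - s))"
      by (simp add: mu_rho[of i, symmetric] algebra_simps)
    then show ?thesis using * mu[of i] by (simp add: abs_mult)
  qed
  have "\<bar>real (D i t) - real (D i s) - mu i * (A i t - A i s)\<bar> \<le> eps * (r + (A i t - A i s))"
    unfolding D_eq[OF t0] D_eq[OF st(1)] using st A_bounds[of s t i] A_range[of s i] A_range[of t i]
    by (intro NS) auto
  also have "\<dots> \<le> eps * (r + n * (t - s))"
    using A_bounds[of s t i] st eps by (intro mult_left_mono add_left_mono) auto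
  finally have "\<bar>real (D i t) - real (D i s) - mu i * (A i t - A i s)\<bar> \<le> eps * (r + n * (t - s))" .
  with 1 have "\<bar>real (D i t) - real (D i s) - n * lam i * (t - s)\<bar> \<le> eps * (r + n * (t - s)) + eps * (n * (t - s))"
    by linarith
  also have "\<dots> \<le> 2 * eps * (r + n * (t - s))"
    using eps by (simp add: algebra_simps)
  finally show ?thesis .
qed

end

section \<open>State space collapse\<close>

context loss_system
begin

definition M :: "real \<Rightarrow> nat" where "M t = (MAX k. Q k t)"

lemma M_ge: "Q k t \<le> M t"
  unfolding M_def by (intro Max_ge) auto

lemma M_attained: "\<exists>k. M t = Q k t"
proof -
  have "(MAX k. Q k t) \<in> range (\<lambda>k. Q k t)" by (rule Max_in) auto
  then show ?thesis unfolding M_def by blast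
qed

lemma Q_diff:
  assumes "0 \<le> s" "s \<le> t"
  shows "real (Q i t) - real (Q i s) =
    (real (E i t) - real (E i s)) - (real (B i t) - real (B i s)) - (real (R i t) - real (R i s))"
  using Q_eq_real[of s i] Q_eq_real[of t i] assms by simp

text \<open>Between none and all of the arrivals in the window are rejected.\<close>

lemma Q_diff_le:
  assumes "0 \<le> s" "s \<le> t" "t \<le> T"
  shows "real (Q i t) - real (Q i s) \<le> (real (E i t) - real (E i s)) - (real (B i t) - real (B i s))"
    "real (Q i t) - real (Q i s) \<ge> - (real (B i t) - real (B i s))"
proof -
  have "R i s \<le> R i t" "J i s \<le> J i t" using assms by (auto intro: R_le J_le)
  then have "R i s \<le> R i t" "real (R i t) - real (R i s) \<le> real (E i t) - real (E i s)"
    using JR[of i s] JR[of i t] by linarith+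
  then show "real (Q i t) - real (Q i s) \<le> (real (E i t) - real (E i s)) - (real (B i t) - real (B i s))"
    "real (Q i t) - real (Q i s) \<ge> - (real (B i t) - real (B i s))"
    using Q_diff[OF assms(1,2), of i] by linarith+
qed

lemma B_total:
  assumes "0 \<le> s" "s \<le> t"
  shows "(\<Sum>i\<in>UNIV. real (B i t) - real (B i s)) = (\<Sum>i\<in>UNIV. real (D i t) - real (D i s))
    + real (\<Sum>i\<in>UNIV. Psi i t) - real (\<Sum>i\<in>UNIV. Psi i s)"
proof -
  have "real (B i t) - real (B i s) = real (D i t) - real (D i s) + real (Psi i t) - real (Psi i s)" for i
    using Psi_eq_real[of s i] Psi_eq_real[of t i] assms by simp
  then show ?thesis by (simp add: sum.distrib sum_subtractf)
qed

text \<open>If a queue is nonempty at the end, all servers are busy then, so the total in service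
  cannot have dropped and routings make up for departures. A nonempty queue at the beginning gives
  the reverse inequality in the same way.\<close>

lemma B_total_ge:
  assumes "0 \<le> s" "s \<le> t" "Q j t > 0"
  shows "(\<Sum>i\<in>UNIV. real (D i t) - real (D i s)) \<le> (\<Sum>i\<in>UNIV. real (B i t) - real (B i s))"
proof -
  have "(\<Sum>i\<in>UNIV. Psi i s) \<le> (\<Sum>i\<in>UNIV. Psi i t)"
    using Psi_le[of s] busy[of t j] assms by simp
  then show ?thesis unfolding B_total[OF assms(1,2)] by linarith
qed

lemma B_total_le:
  assumes "0 \<le> s" "s \<le> t" "Q j s > 0"
  shows "(\<Sum>i\<in>UNIV. real (B i t) - real (B i s)) \<le> (\<Sum>i\<in>UNIV. real (D i t) - real (D i s))"
proof -
  have "(\<Sum>i\<in>UNIV. Psi i t) \<le> (\<Sum>i\<in>UNIV. Psi i s)"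
    using Psi_le[of t] busy[of s j] assms by simp
  then show ?thesis unfolding B_total[OF assms(1,2)] by linarith
qed

lemma B_le_total:
  assumes "0 \<le> s" "s \<le> t"
  shows "real (B k t) - real (B k s) \<le> (\<Sum>i\<in>UNIV. real (B i t) - real (B i s))"
  by (rule member_le_sum[where f = "\<lambda>i. real (B i t) - real (B i s)"]) (use assms B_le in auto)

text \<open>The integrand of the FP condition uses queue lengths after the transition, so the
  hypothesis includes the right endpoint \<open>t\<close>; being integer valued, the integrand is at
  least 1 where it is positive.\<close>

lemma FP_no_service:
  assumes "pol = FP" "0 \<le> s" "s \<le> t" and higher: "\<And>u. s < u \<Longrightarrow> u \<le> t \<Longrightarrow> \<exists>k<i. Q k u > 0"
  shows "B i t = B i s"
proof (rule stieltjes_integral_0_const[OF B_mono _ assms(2,3)])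
  show "continuous (at_right t) (B i)" if "t \<ge> 0" for t
    using path_right[OF that, of i] by blast
  show "(\<integral>\<^sup>+t\<in>{0..}. (\<Sum>k\<in>{..<i}. of_nat (Q k t)) \<partial>stieltjes (B i)) = 0"
    using path_schedules assms(1) by simp
  fix u assume "s < u" "u \<le> t"
  then obtain k where k: "k < i" "Q k u > 0" using higher by blast
  have "(1::ennreal) \<le> of_nat (Q k u)" using k by (metis Suc_leI of_nat_1 of_nat_mono One_nat_def)
  also have "\<dots> \<le> (\<Sum>k\<in>{..<i}. of_nat (Q k u))" using k by (intro member_le_sum) auto
  finally show "1 \<le> (\<Sum>k\<in>{..<i}. of_nat (Q k u) :: ennreal)" .
qed

text \<open>The policy tests left limits, which are queue lengths at times strictly before; hence a
  hypothesis on the open interval excludes a routing at \<open>t\<close> as well.\<close>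

lemma SLQ_no_service:
  assumes "pol = SLQ" and st: "0 \<le> s" "s \<le> t" "t \<le> T" and shorter: "\<And>v. s < v \<Longrightarrow> v < t \<Longrightarrow> Q i v < M v"
  shows "B i t = B i s"
proof (rule stieltjes_integral_0_const[OF B_mono _ st(1,2)])
  show "continuous (at_right t) (B i)" if "t \<ge> 0" for t
    using path_right[OF that, of i] by blast
  show "(\<integral>\<^sup>+t\<in>{0..}. indicator {t. left_lim (Q i) t < (MAX k. left_lim (Q k) t)} t
              \<partial>stieltjes (B i)) = 0"
    using path_schedules assms(1) by simp
  fix u assume u: "s < u" "u \<le> t"
  have "\<forall>\<^sub>F v in at_left u. \<forall>k\<in>UNIV. Q k v = left_lim (Q k) u"
    by (intro eventually_ball_finite ballI left_const) (use u st in auto)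
  then obtain v where v: "s < v" "v < u" "\<forall>k\<in>UNIV. Q k v = left_lim (Q k) u"
    by (rule eventually_at_left_obtain[OF _ u(1)])
  have "left_lim (Q i) u < (MAX k. left_lim (Q k) u)"
    using shorter[of v] v u unfolding M_def by simp
  then show "1 \<le> (indicator {t. left_lim (Q i) t < (MAX k. left_lim (Q k) t)} u :: ennreal)"
    by simp
qed

text \<open>\<open>u\<close> is the time of the last routing of class \<open>k\<close>, an infimum
  attained by right-continuity. Under SLQ the class is a longest queue at times \<open>v\<close>
  arbitrarily close before it; \<open>h\<close> prescribes how close.\<close>

lemma SLQ_last_service:
  assumes "pol = SLQ" and st: "0 \<le> s" "s \<le> t" "t \<le> T" and "B k s < B k t" "h > 0"
  obtains v u where "s < v" "v < u" "u \<le> t" "u - v < h" "Q k v = M v" "B k t = B k u"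
proof -
  define C where "C = {u\<in>{s..t}. B k u = B k t}"
  have C: "t \<in> C" "bdd_below C" using st by (auto simp: C_def intro: bdd_belowI[of _ s])
  define u where "u = Inf C"
  have u: "s \<le> u" "u \<le> t" unfolding u_def
    using C by (auto intro!: cInf_lower cInf_greatest) (auto simp: C_def)
  have Bu: "B k u = B k t"
  proof -
    have "\<forall>\<^sub>F v in at_right u. B k v = B k u" using u st by (intro right_const) auto
    then obtain b where b: "u < b" "\<And>v. u < v \<Longrightarrow> v < b \<Longrightarrow> B k v = B k u"
      by (auto simp: eventually_at_right_field)
    obtain v where v: "v \<in> C" "v < b" using b(1) C unfolding u_def by (metis cInf_lessD empty_iff)
    have "u \<le> v" using v C by (auto simp: u_def intro: cInf_lower)
    then show ?thesis using b(2)[of v] v by (cases "u = v") (auto simp: C_def)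
  qed
  have "s < u" using u Bu assms(5) by (cases "s = u") auto
  define v0 where "v0 = max s (u - h / 2)"
  have v0: "s \<le> v0" "v0 < u" "u - v0 < h" using \<open>s < u\<close> \<open>h > 0\<close> by (auto simp: v0_def)
  have "\<not> (\<forall>v. v0 < v \<longrightarrow> v < u \<longrightarrow> Q k v < M v)"
  proof
    assume "\<forall>v. v0 < v \<longrightarrow> v < u \<longrightarrow> Q k v < M v"
    then have "B k u = B k v0" by (intro SLQ_no_service) (use assms(1) v0 u st in auto)
    then have "v0 \<in> C" using Bu v0 u by (auto simp: C_def)
    then have "u \<le> v0" using C by (auto simp: u_def intro: cInf_lower)
    then show False using v0 by simp
  qed
  then obtain v where v: "v0 < v" "v < u" "\<not> Q k v < M v" by blast
  then have "Q k v = M v" using M_ge[of k v] by simp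
  then show ?thesis using that[of v u] v v0 u Bu by simp
qed

end

section \<open>Draining of queues; collapse under FP\<close>

context noisy_loss_system
begin

lemma er: "eps * r \<ge> 2"
  using n_large by simp

lemma E_inc:
  assumes "0 \<le> s" "s \<le> t" "t \<le> T"
  shows "real (E i t) - real (E i s) \<le> eps * r + n * (lam i + eps) * (t - s)"
  using NE[OF assms, of i] by (simp add: algebra_simps)

lemma D_inc:
  assumes "0 \<le> s" "s \<le> t" "t \<le> T"
  shows "(\<Sum>i\<in>UNIV. real (D i t) - real (D i s)) \<le> 2 * real CARD('k) * eps * r + (\<Sum>i\<in>UNIV. n * (lam i + 2 * eps)) * (t - s)"
proof -
  have "(\<Sum>i\<in>UNIV. real (D i t) - real (D i s)) \<le> (\<Sum>i\<in>UNIV. 2 * eps * r + n * (lam i + 2 * eps) * (t - s))"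
  proof (rule sum_mono)
    fix i
    have "real (D i t) - real (D i s) \<le> n * lam i * (t - s) + 2 * eps * (r + n * (t - s))"
      using ND[OF assms, of i] by linarith
    then show "real (D i t) - real (D i s) \<le> 2 * eps * r + n * (lam i + 2 * eps) * (t - s)"
      by (simp add: algebra_simps)
  qed
  also have "\<dots> = 2 * real CARD('k) * eps * r + (\<Sum>i\<in>UNIV. n * (lam i + 2 * eps)) * (t - s)"
    by (simp add: sum.distrib sum_distrib_right)
  finally show ?thesis .
qed

text \<open>All servers work on the other classes, whose total load falls short of the service capacity
  by the arrival rate \<open>n * lam i\<close> of class \<open>i\<close>.\<close>

lemma drain:
  assumes st: "0 \<le> s" "s \<le> t" "t \<le> T" and "Q j t > 0" "B i t = B i s" and small: "4 * real CARD('k) * eps \<le> lam i"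
  shows "(\<Sum>k\<in>UNIV - {i}. (real (E k t) - real (E k s)) - (real (B k t) - real (B k s))) \<le> 4 * real CARD('k) * eps * r"
proof -
  let ?e = "eps * (r + n * (t - s))"
  have nts: "0 \<le> n * (t - s)" using st by simp
  have "(\<Sum>k\<in>UNIV. (real (E k t) - real (E k s)) - (real (D k t) - real (D k s))) \<le> (\<Sum>k\<in>(UNIV::'k set). 3 * ?e)"
  proof (rule sum_mono)
    fix k
    show "(real (E k t) - real (E k s)) - (real (D k t) - real (D k s)) \<le> 3 * ?e"
      using NE[OF st, of k] ND[OF st, of k] by linarith
  qed
  then have 1: "(\<Sum>k\<in>UNIV. real (E k t) - real (E k s)) - (\<Sum>k\<in>UNIV. real (D k t) - real (D k s)) \<le> 3 * real CARD('k) * ?e"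
    by (simp add: sum_subtractf)
  have "(\<Sum>k\<in>UNIV - {i}. (real (E k t) - real (E k s)) - (real (B k t) - real (B k s))) =
      (\<Sum>k\<in>UNIV. real (E k t) - real (E k s)) - (\<Sum>k\<in>UNIV. real (B k t) - real (B k s)) - (real (E i t) - real (E i s))"
    using assms(5) by (simp add: sum_diff1 sum_subtractf)
  also have "\<dots> \<le> 3 * real CARD('k) * ?e - (n * lam i * (t - s) - ?e)"
    using 1 B_total_ge[OF st(1,2) assms(4)] NE[OF st, of i] by linarith
  \<comment> \<open>Rounding the last error up to one unit per class gives the common factor 4,
    matched by the hypothesis \<open>small\<close>.\<close>
  also have "\<dots> \<le> 3 * real CARD('k) * ?e - (n * lam i * (t - s) - real CARD('k) * ?e)"
  proof -
    have "0 \<le> ?e" using eps nts st by (intro mult_nonneg_nonneg add_nonneg_nonneg) auto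
    then have "1 * ?e \<le> real CARD('k) * ?e" using card_ge_1 by (rule mult_right_mono[rotated])
    then show ?thesis by linarith
  qed
  also have "\<dots> = 4 * real CARD('k) * eps * r + (4 * real CARD('k) * eps - lam i) * (n * (t - s))"
    by (simp add: algebra_simps)
  also have "\<dots> \<le> 4 * real CARD('k) * eps * r"
    using small nts mult_nonpos_nonneg[of "4 * real CARD('k) * eps - lam i" "n * (t - s)"] by simp
  finally show ?thesis .
qed

text \<open>After the last time at which the queues other than the last were below their initial
  bound, the last class receives no service and \<open>drain\<close> applies. Level, overshoot and
  draining contribute 1, 1 and 4 to the factor 6.\<close>

lemma FP_collapse:
  assumes "pol = FP" and t: "0 \<le> t" "t \<le> T" and small: "\<And>i. 4 * real CARD('k) * eps \<le> lam i"
  shows "(\<Sum>k\<in>UNIV - {Max UNIV}. real (Q k t)) \<le> 6 * real CARD('k) * eps * r"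
proof -
  let ?i = "Max UNIV :: 'k"
  define U where "U t = (\<Sum>k\<in>UNIV - {?i}. real (Q k t))" for t
  have "U 0 \<le> (\<Sum>k\<in>UNIV. real (Q k 0))"
    unfolding U_def by (rule sum_mono2) auto
  also have "\<dots> \<le> (\<Sum>k\<in>(UNIV::'k set). eps * r)"
    using I0(1) by (intro sum_mono) simp
  finally have "U 0 \<le> (\<Sum>k\<in>(UNIV::'k set). eps * r)" .
  then have U0: "U 0 \<le> real CARD('k) * eps * r" by simp
  have inc: "U v \<le> U u + real CARD('k) * eps * r + (\<Sum>k\<in>UNIV. n * (lam k + eps)) * (v - u)"
    if "0 \<le> u" "u \<le> v" "v \<le> t" for u v
  proof -
    have "U v - U u \<le> (\<Sum>k\<in>UNIV - {?i}. eps * r + n * (lam k + eps) * (v - u))"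
      unfolding U_def sum_subtractf[symmetric]
    proof (rule sum_mono)
      fix k
      show "real (Q k v) - real (Q k u) \<le> eps * r + n * (lam k + eps) * (v - u)"
        using Q_diff_le(1)[of u v k] E_inc[of u v k] B_le[of u v k] that t by linarith
    qed
    also have "\<dots> \<le> (\<Sum>k\<in>UNIV. eps * r + n * (lam k + eps) * (v - u))"
      using eps lam that by (intro sum_mono2) (auto intro!: add_nonneg_nonneg mult_nonneg_nonneg simp: less_imp_le)
    also have "\<dots> = real CARD('k) * eps * r + (\<Sum>k\<in>UNIV. n * (lam k + eps)) * (v - u)"
      by (simp add: sum.distrib sum_distrib_right)
    finally show ?thesis by simp
  qed
  obtain u where u: "0 \<le> u" "u \<le> t" "U u \<le> real CARD('k) * eps * r + real CARD('k) * eps * r"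
    "\<And>v. u < v \<Longrightarrow> v \<le> t \<Longrightarrow> real CARD('k) * eps * r < U v"
    by (rule last_exit[OF t(1) U0 inc]) (use eps lam in \<open>auto intro!: sum_nonneg mult_nonneg_nonneg simp: less_imp_le\<close>)
  show ?thesis
  proof (cases "u = t")
    case True
    have "0 \<le> real CARD('k) * eps * r" using eps by simp
    moreover have "U t \<le> real CARD('k) * eps * r + real CARD('k) * eps * r" using u(3) True by simp
    ultimately show ?thesis unfolding U_def by linarith
  next
    case False
    have pos: "\<exists>k<?i. Q k v > 0" if v: "u < v" "v \<le> t" for v
    proof (rule ccontr)
      assume *: "\<not> (\<exists>k<?i. Q k v > 0)"
      have "U v = 0" unfolding U_def
      proof (rule sum.neutral, rule ballI)
        fix k assume "k \<in> UNIV - {?i}"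
        then have "k < ?i" using Max_ge[OF finite UNIV_I, of k] by (simp add: order_less_le)
        then show "real (Q k v) = 0" using * by auto
      qed
      moreover have "0 \<le> real CARD('k) * eps * r" using eps by simp
      ultimately show False using u(4)[OF v] by simp
    qed
    obtain k where k: "Q k t > 0" using pos[of t] False u by auto
    have "U t - U u \<le> (\<Sum>k\<in>UNIV - {?i}. (real (E k t) - real (E k u)) - (real (B k t) - real (B k u)))"
      unfolding U_def sum_subtractf[symmetric] using u t by (intro sum_mono Q_diff_le) auto
    also have "\<dots> \<le> 4 * real CARD('k) * eps * r"
      by (rule drain[OF _ _ _ k FP_no_service]) (use u t pos assms in auto)
    finally show ?thesis using u(3) unfolding U_def by linarith
  qed
qed

end

section \<open>Collapse under SLQ\<close>

context noisy_loss_system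
begin

text \<open>The value that \<open>SLQ_collapse\<close> produces. With \<open>N\<close> classes and
  \<open>e = eps * r\<close>, each queue starts a draining period at most
  \<open>3 * N * e + e\<close> above a level and draining adds \<open>4 * N * e\<close>, in total
  \<open>(3 * N^2 + 5 * N) * e\<close>; one more \<open>e\<close> makes the contradiction strict,
  and \<open>N * e\<close> separates the short queue from the level.\<close>

definition G :: real where "G = 3 * real CARD('k) * real CARD('k) + 6 * real CARD('k) + 1"

lemma M_inc:
  assumes "0 \<le> s" "s \<le> t" "t \<le> T"
  shows "real (M t) \<le> real (M s) + eps * r + (\<Sum>i\<in>UNIV. n * (lam i + eps)) * (t - s)"
proof -
  obtain k where k: "M t = Q k t" using M_attained by blast
  have "n * (lam k + eps) \<le> (\<Sum>i\<in>UNIV. n * (lam i + eps))"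
    using lam eps by (intro member_le_sum) (auto simp: less_imp_le)
  then have "n * (lam k + eps) * (t - s) \<le> (\<Sum>i\<in>UNIV. n * (lam i + eps)) * (t - s)"
    using assms by (intro mult_right_mono) auto
  then show ?thesis
    using k M_ge[of k s] Q_diff_le(1)[OF assms, of k] E_inc[OF assms, of k] B_le[of s t k] assms
    by linarith
qed

text \<open>A crude growth bound feeding \<open>last_exit\<close>: the maximum grows through
  arrivals only, and a nonempty queue shrinks at most by all departures, as the servers are busy at
  time \<open>s\<close>.\<close>

lemma SLQ_gap_inc:
  assumes "0 \<le> s" "s \<le> t" "t \<le> T"
  shows "real (M t) - real (Q i t) \<le> real (M s) - real (Q i s) + 3 * real CARD('k) * eps * r
    + (\<Sum>i\<in>UNIV. n * (2 * lam i + 3 * eps)) * (t - s)"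
proof -
  have "real (Q i s) - real (Q i t) \<le>
      2 * real CARD('k) * eps * r + (\<Sum>i\<in>UNIV. n * (lam i + 2 * eps)) * (t - s)" (is "_ \<le> ?b")
  proof (cases "Q i s = 0")
    case True
    have "0 \<le> ?b" using eps lam assms
      by (auto intro!: add_nonneg_nonneg mult_nonneg_nonneg sum_nonneg simp: less_imp_le)
    then show ?thesis using True by simp
  next
    case False
    then show ?thesis
      using Q_diff_le(2)[OF assms, of i] B_le_total[OF assms(1,2), of i] B_total_le[OF assms(1,2), of i]
        D_inc[OF assms] by linarith
  qed
  moreover have "eps * r \<le> real CARD('k) * eps * r"
    using card_ge_1 eps mult_right_mono[of 1 "real CARD('k)" "eps * r"] by simp
  moreover have "(\<Sum>i\<in>UNIV. n * (2 * lam i + 3 * eps)) =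
      (\<Sum>i\<in>UNIV. n * (lam i + eps)) + (\<Sum>i\<in>UNIV. n * (lam i + 2 * eps))"
    unfolding sum.distrib[symmetric] by (intro sum.cong) (auto simp: algebra_simps)
  ultimately show ?thesis
    using M_inc[OF assms] by (simp add: distrib_right)
qed

text \<open>The margin of 3 in the lower bound for \<open>M\<close> absorbs the possible jump of \<open>B\<close> at the last
  service, so that a queue above level \<open>L\<close> is not served below \<open>L\<close>.\<close>

lemma SLQ_excess:
  assumes "pol = SLQ" and st: "0 \<le> s" "s \<le> t" "t \<le> T" and L: "L \<ge> 0"
    and above: "\<And>v. s < v \<Longrightarrow> v \<le> t \<Longrightarrow> L + 3 * real CARD('k) * eps * r < real (M v)"
  shows "max 0 (real (Q k t) - L) \<le> max 0 (real (Q k s) - L) +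
    ((real (E k t) - real (E k s)) - (real (B k t) - real (B k s)))"
proof (cases "B k s = B k t")
  case True
  have "E k s \<le> E k t" using st by (intro E_le)
  then show ?thesis using True Q_diff_le(1)[OF st, of k] by simp
next
  case False
  define b where "b = (\<Sum>i\<in>UNIV. n * (lam i + 2 * eps))"
  have b: "b \<ge> 0" using eps lam by (auto intro!: sum_nonneg mult_nonneg_nonneg simp: b_def less_imp_le)
  have "B k s < B k t" using False B_le[of s t k] st by simp
  \<comment> \<open>The distance \<open>1 / (b + 1)\<close> keeps the drift of the routings between
    \<open>v\<close> and \<open>u\<close> below 1, so that together with the noise they stay within
    the margin of \<open>above\<close>.\<close>
  then obtain v u where v: "s < v" "v < u" "u \<le> t" "u - v < 1 / (b + 1)" "Q k v = M v" "B k t = B k u"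
    by (rule SLQ_last_service[OF assms(1) st, where h = "1 / (b + 1)"]) (use b in auto)
  have vt: "0 \<le> v" "v \<le> u" "u \<le> T" "v \<le> t" using v st by auto
  have er1: "eps * r \<le> real CARD('k) * eps * r"
    using card_ge_1 eps mult_right_mono[of 1 "real CARD('k)" "eps * r"] by simp
  have Qv: "L + 3 * real CARD('k) * eps * r < real (Q k v)" using above[of v] v by simp
  then have "0 < Q k v" using L er1 er by linarith
  then have "real (B k u) - real (B k v) \<le> 2 * real CARD('k) * eps * r + b * (u - v)"
    using B_le_total[OF vt(1,2), of k] B_total_le[OF vt(1,2), of k] D_inc[OF vt(1,2,3)]
    unfolding b_def by linarith
  also have "b * (u - v) \<le> (b + 1) * (1 / (b + 1))"
    using b v by (intro mult_mono) auto
  also have "\<dots> = 1" using b by simp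
  finally have jump: "real (B k t) - real (B k v) \<le> 3 * real CARD('k) * eps * r"
    using er er1 v(6) by linarith
  \<comment> \<open>At \<open>v\<close> the queue is still above \<open>L\<close> by the margin,
    which limits the routings before \<open>v\<close>; the margin pays for those after
    \<open>v\<close>.\<close>
  have "real (B k v) - real (B k s) \<le> (real (E k v) - real (E k s)) + real (Q k s) - real (Q k v)"
    using Q_diff_le(1)[of s v k] v st by linarith
  moreover have "E k v \<le> E k t" using vt st by (intro E_le) auto
  ultimately have "real (B k t) - real (B k s) \<le> (real (E k t) - real (E k s)) + (real (Q k s) - L)"
    using jump Qv by linarith
  then show ?thesis using Q_diff_le(1)[OF st, of k] by linarith
qed

text \<open>Suppose class \<open>i\<close> is far below the maximum at \<open>t\<close>. Since the
  last time \<open>s\<close> of a small gap it has not been served, so it was never longer than at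
  \<open>t\<close>. A level \<open>L\<close> between it and the maximum is thus exceeded by other
  classes only; their excess over \<open>L\<close> was small at a last time \<open>u\<close>, and
  draining since then contradicts its size at \<open>t\<close>.\<close>

lemma SLQ_collapse:
  assumes pol: "pol = SLQ" and t: "0 \<le> t" "t \<le> T" and small: "\<And>i. 4 * real CARD('k) * eps \<le> lam i"
  shows "real (M t) - real (Q i t) \<le> G * eps * r"
proof (rule ccontr)
  let ?c = "real CARD('k)"
  define e where "e = eps * r"
  define H where "H = 3 * ?c * ?c + 5 * ?c + 1"
  assume "\<not> ?thesis"
  then have gap: "G * e < real (M t) - real (Q i t)" by (simp add: e_def mult.assoc)
  have e: "e \<ge> 2" using er by (simp add: e_def)
  have ce: "e \<le> ?c * e" "0 \<le> ?c * (?c * e)"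
    using card_ge_1 e mult_right_mono[of 1 ?c e] by auto
  have He: "H * e = 3 * (?c * (?c * e)) + 5 * (?c * e) + e" "G * e = 3 * (?c * (?c * e)) + 6 * (?c * e) + e"
    by (auto simp: H_def G_def algebra_simps)
  define b where "b = (\<Sum>i\<in>UNIV. n * (2 * lam i + 3 * eps))"
  have b: "b \<ge> 0" using eps lam by (auto intro!: sum_nonneg mult_nonneg_nonneg simp: b_def less_imp_le)
  obtain k0 where "M 0 = Q k0 0" using M_attained by blast
  then have f0: "real (M 0) - real (Q i 0) \<le> e" using I0(1)[of k0] by (simp add: e_def)
  obtain s where s: "0 \<le> s" "s \<le> t" "real (M s) - real (Q i s) \<le> e + 3 * (?c * e)"
    "\<And>v. s < v \<Longrightarrow> v \<le> t \<Longrightarrow> e < real (M v) - real (Q i v)"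
  proof (rule last_exit[where f = "\<lambda>v. real (M v) - real (Q i v)" and \<alpha> = "3 * (?c * e)" and \<beta> = b, OF t(1) f0])
    show "real (M v) - real (Q i v) \<le> real (M u) - real (Q i u) + 3 * (?c * e) + b * (v - u)"
      if "0 \<le> u" "u \<le> v" "v \<le> t" for u v
      using SLQ_gap_inc[of u v i] that t by (simp add: e_def b_def mult.assoc)
  qed (use b in blast)+
  have B_s: "B i v = B i s" if "s \<le> v" "v \<le> t" for v
  proof (rule SLQ_no_service[OF pol])
    show "Q i w < M w" if "s < w" "w < v" for w
      using s(4)[of w] that \<open>v \<le> t\<close> e by linarith
  qed (use s t that in auto)
  have Q_s: "real (Q i v) \<le> real (Q i t)" if "s \<le> v" "v \<le> t" for v
    using Q_diff_le(2)[of v t i] B_s[OF that] B_s[of t] s t that by simp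
  \<comment> \<open>High enough to stay above queue \<open>i\<close>, low enough that the longest
    queue exceeds it at \<open>t\<close> by more than the initial excess and the draining error
    allow.\<close>
  define L where "L = real (M t) - H * e"
  have L1: "real (Q i t) < L" using gap ce e unfolding L_def He by linarith
  then have L: "real (Q i t) < L" "L \<ge> 0" by auto
  have fs: "real (M s) \<le> L + 3 * (?c * e)"
    using s(3) Q_s[of s] s(2) gap ce unfolding L_def He by linarith
  obtain u where u: "s \<le> u" "u \<le> t" "real (M u) \<le> L + 3 * (?c * e) + e"
    "\<And>v. u < v \<Longrightarrow> v \<le> t \<Longrightarrow> L + 3 * (?c * e) < real (M v)"
  proof (rule last_exit[where f = "\<lambda>v. real (M v)" and \<alpha> = e and \<beta> = "\<Sum>i\<in>UNIV. n * (lam i + eps)", OF s(2) fs])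
    show "real (M v) \<le> real (M u) + e + (\<Sum>i\<in>UNIV. n * (lam i + eps)) * (v - u)"
      if "s \<le> u" "u \<le> v" "v \<le> t" for u v
      using M_inc[of u v] that s t by (simp add: e_def)
    show "0 \<le> (\<Sum>i\<in>UNIV. n * (lam i + eps))"
      using eps lam by (auto intro!: sum_nonneg mult_nonneg_nonneg simp: less_imp_le)
  qed blast
  have u0: "0 \<le> u" using u s by simp
  obtain j where j: "M t = Q j t" using M_attained by blast
  have H_e: "0 < H * e" using ce e unfolding He by linarith
  have "Q j t > 0" using j L H_e unfolding L_def by linarith
  have "j \<noteq> i" using j L H_e unfolding L_def by auto
  have "H * e \<le> max 0 (real (Q j t) - L)" using j by (simp add: L_def)
  also have "\<dots> \<le> (\<Sum>k\<in>UNIV - {i}. max 0 (real (Q k t) - L))"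
    using \<open>j \<noteq> i\<close> by (intro member_le_sum) auto
  also have "\<dots> \<le> (\<Sum>k\<in>UNIV - {i}. max 0 (real (Q k u) - L) +
      ((real (E k t) - real (E k u)) - (real (B k t) - real (B k u))))"
  proof (rule sum_mono)
    fix k
    show "max 0 (real (Q k t) - L) \<le> max 0 (real (Q k u) - L) +
      ((real (E k t) - real (E k u)) - (real (B k t) - real (B k u)))"
      by (rule SLQ_excess[OF pol u0 u(2) t(2) L(2)]) (use u(4) in \<open>simp add: e_def mult.assoc\<close>)
  qed
  also have "\<dots> \<le> (\<Sum>k\<in>UNIV - {i}. 3 * (?c * e) + e) + 4 * ?c * eps * r"
    unfolding sum.distrib
  proof (rule add_mono)
    show "(\<Sum>k\<in>UNIV - {i}. max 0 (real (Q k u) - L)) \<le> (\<Sum>k\<in>UNIV - {i}. 3 * (?c * e)) + (\<Sum>k\<in>UNIV - {i}. e)"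
      unfolding sum.distrib[symmetric]
    proof (rule sum_mono)
      fix k
      show "max 0 (real (Q k u) - L) \<le> 3 * (?c * e) + e"
        using u(3) M_ge[of k u] ce e by linarith
    qed
    have "B i t = B i u" using B_s[of t] B_s[of u] u s by simp
    then show "(\<Sum>k\<in>UNIV - {i}. (real (E k t) - real (E k u)) - (real (B k t) - real (B k u))) \<le> 4 * ?c * eps * r"
      using drain[OF u0 u(2) t(2) \<open>Q j t > 0\<close>] small by blast
  qed
  also have "\<dots> \<le> (\<Sum>k\<in>(UNIV :: 'k set). 3 * (?c * e) + e) + 4 * ?c * eps * r"
    using ce e by (intro add_right_mono sum_mono2) auto
  also have "\<dots> = 3 * (?c * (?c * e)) + 5 * (?c * e)" by (simp add: e_def algebra_simps)
  finally show False using e unfolding He by linarith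
qed

end

section \<open>Waiting times under state space collapse\<close>

text \<open>\<open>c\<close> stands for the number of classes, and the inner polynomial is
  \<open>G\<close>. This constant and the next are defined outside the locales because
  \<open>eps\<close> is chosen in terms of them before any path is at hand.\<close>

definition reject_const :: "real \<Rightarrow> real" where
  "reject_const c = c * (2 + 2 * (3 * c * c + 6 * c + 1))"

text \<open>In units of window noise: 1 for the arrivals,
  \<open>8 * c + reject_const c + 2 * G\<close> for the increment of a queue, and
  \<open>5 * c + reject_const c\<close> for the rejections of a class.\<close>

definition window_const :: "real \<Rightarrow> real" where
  "window_const c = 1 + 13 * c + 2 * reject_const c + 2 * (3 * c * c + 6 * c + 1)"

lemma Inf_ereal_between:
  fixes P :: "real \<Rightarrow> bool"
  assumes "\<And>s. P s \<Longrightarrow> a \<le> s" "P b"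
  obtains x where "Inf {ereal s |s. P s} = ereal x" "a \<le> x" "x \<le> b"
proof -
  have "ereal a \<le> Inf {ereal s |s. P s}" using assms(1) by (intro Inf_greatest) auto
  moreover have "Inf {ereal s |s. P s} \<le> ereal b" using assms(2) by (intro Inf_lower) auto
  ultimately show ?thesis using that by (cases "Inf {ereal s |s. P s}") auto
qed

text \<open>\<open>acc\<close> is a threshold rule only up to the a priori bound
  \<open>K * r\<close>, as a bounded cost function may accept every queue length.
  \<open>a_large\<close> excludes rejections by the classes whose queues collapse under FP,
  \<open>lam_large\<close> is the drift condition of \<open>drain\<close>.\<close>

locale threshold_loss_system = noisy_loss_system +
  fixes a :: "'a \<Rightarrow> real"
  assumes acc_iff: "\<And>i q. real q \<le> K * r \<Longrightarrow> acc i q \<longleftrightarrow> real q \<le> a i * r"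
    and a_large: "\<And>i. 6 * real CARD('a) * eps < a i"
    and lam_large: "\<And>i. 4 * real CARD('a) * eps \<le> lam i"
begin

lemma a_pos: "a i > 0"
proof -
  have "0 \<le> 6 * real CARD('a) * eps" using eps by simp
  then show ?thesis using a_large[of i] by linarith
qed

lemma not_accD:
  assumes "0 \<le> v" "v \<le> T" "\<not> acc i (Q i v)"
  shows "a i * r < real (Q i v)"
  using acc_iff[OF Q_le[OF assms(1,2)]] assms(3) by simp

text \<open>At the last accepted arrival the queue was at most \<open>a i * r\<close>, and at most
  two joins are counted from just before it. With fewer than two joins in all, the initial bound
  does.\<close>

lemma Q_upper:
  assumes "0 \<le> t" "t \<le> T"
  shows "real (Q i t) \<le> a i * r + 2 * (eps * r)"
proof (cases "J i 0 + 2 \<le> J i t")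
  case True
  obtain v where v: "0 < v" "v < t" "acc i (Q i v)" "J i t \<le> J i v + 2"
    using last_join[OF order.refl assms True] by blast
  have "real (Q i v) \<le> a i * r" using acc_iff[OF Q_le[of v]] v assms by simp
  moreover have "real (Q i t) - real (Q i v) \<le> 2"
    using Q_diff[of v t i] JR[of i v] JR[of i t] B_le[of v t i] v by simp
  ultimately show ?thesis using er by linarith
next
  case False
  have "0 \<le> a i * r" using a_pos[of i] by simp
  then show ?thesis using False I0(1)[of i] Q_eq_real[OF assms(1), of i] JR[of i t] er by simp
qed

text \<open>The fraction of the total queue that a class holds once the state has collapsed.\<close>

definition share :: "'a \<Rightarrow> real" where
  "share i = (case pol of FP \<Rightarrow> if i = Max UNIV then 1 else 0 | SLQ \<Rightarrow> 1 / CARD('a))"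

lemma share: "0 \<le> share i" "share i \<le> 1"
  using card_ge_1 by (auto simp: share_def split: scheduling.split)

definition Qs :: "real \<Rightarrow> real" where "Qs t = (\<Sum>k\<in>UNIV. real (Q k t))"

lemma FP_Qs: "Qs t = real (Q (Max UNIV) t) + (\<Sum>k\<in>UNIV - {Max UNIV}. real (Q k t))"
  unfolding Qs_def by (rule sum.remove) auto

lemma SLQ_Qs:
  assumes "pol = SLQ" "0 \<le> t" "t \<le> T"
  shows "\<bar>real CARD('a) * real (Q i t) - Qs t\<bar> \<le> real CARD('a) * (G * eps * r)"
proof -
  have "Qs t \<le> (\<Sum>k\<in>(UNIV :: 'a set). real (Q i t) + G * eps * r)"
    unfolding Qs_def
  proof (rule sum_mono)
    fix k
    show "real (Q k t) \<le> real (Q i t) + G * eps * r"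
      using SLQ_collapse[OF assms lam_large, of i] M_ge[of k t] by linarith
  qed
  moreover have "(\<Sum>k\<in>(UNIV :: 'a set). real (Q i t) - G * eps * r) \<le> Qs t"
    unfolding Qs_def
  proof (rule sum_mono)
    fix k
    show "real (Q i t) - G * eps * r \<le> real (Q k t)"
      using SLQ_collapse[OF assms lam_large, of k] M_ge[of i t] by linarith
  qed
  ultimately show ?thesis by (simp add: algebra_simps abs_le_iff)
qed

lemma G_ge: "6 * real CARD('a) \<le> G" "1 \<le> G"
  using card_ge_1 by (auto simp: G_def)

lemma FP_rest:
  assumes "pol = FP" "0 \<le> t" "t \<le> T"
  shows "(\<Sum>k\<in>UNIV - {Max UNIV}. real (Q k t)) \<le> G * (eps * r)"
proof -
  have "6 * real CARD('a) * (eps * r) \<le> G * (eps * r)"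
    using G_ge er by (intro mult_right_mono) auto
  then show ?thesis using FP_collapse[OF assms lam_large] by (simp add: mult.assoc)
qed

lemma collapse:
  assumes "0 \<le> t" "t \<le> T"
  shows "\<bar>real (Q i t) - share i * Qs t\<bar> \<le> G * (eps * r)"
proof (cases pol)
  case FP
  show ?thesis
  proof (cases "i = Max UNIV")
    case True
    then have "share i = 1" by (subst share_def) (simp add: FP)
    then show ?thesis using FP_rest[OF FP assms] FP_Qs[of t] True by (simp add: sum_nonneg)
  next
    case False
    have "real (Q i t) \<le> (\<Sum>k\<in>UNIV - {Max UNIV}. real (Q k t))"
      using False by (intro member_le_sum) auto
    moreover have "share i = 0" by (subst share_def) (simp add: FP False)
    ultimately show ?thesis using FP_rest[OF FP assms] by simp
  qed
next
  case SLQ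
  have "\<bar>real CARD('a) * (real (Q i t) - share i * Qs t)\<bar> \<le> real CARD('a) * (G * (eps * r))"
  proof -
    have "share i = 1 / real CARD('a)" by (subst share_def) (simp add: SLQ)
    then show ?thesis using SLQ_Qs[OF SLQ assms, of i] by (simp add: right_diff_distrib mult.assoc)
  qed
  then show ?thesis using card_ge_1 by (simp add: abs_mult)
qed

text \<open>A rejecting class exceeds its threshold, which by \<open>Q_upper\<close> is nearly the
  largest length it ever has, and collapse carries this over to the total. Under FP the rejecting
  class must be the last one, since the other queues lie below their thresholds by
  \<open>a_large\<close>.\<close>

lemma reject_high:
  assumes v: "0 \<le> v" "v \<le> T" "\<not> acc i (Q i v)" and s: "0 \<le> s" "s \<le> T"
  shows "Qs s \<le> Qs v + reject_const CARD('a) * (eps * r)"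
proof (cases pol)
  case FP
  have "i = Max UNIV"
  proof (rule ccontr)
    assume "i \<noteq> Max UNIV"
    then have "real (Q i v) \<le> (\<Sum>k\<in>UNIV - {Max UNIV}. real (Q k v))"
      by (intro member_le_sum) auto
    then have "real (Q i v) \<le> (6 * real CARD('a) * eps) * r"
      using FP_collapse[OF FP v(1,2) lam_large] by simp
    also have "\<dots> \<le> a i * r" using a_large[of i] by (intro mult_right_mono) auto
    finally show False using not_accD[OF v] by simp
  qed
  then have "Qs s \<le> real (Q i v) + 2 * (eps * r) + 6 * real CARD('a) * eps * r"
    using not_accD[OF v] Q_upper[OF s, of i] FP_collapse[OF FP s lam_large] FP_Qs[of s] by simp
  also have "\<dots> \<le> Qs v + (2 + 6 * real CARD('a)) * (eps * r)"
    using member_le_sum[of i UNIV "\<lambda>i. real (Q i v)"] by (simp add: Qs_def algebra_simps)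
  also have "\<dots> \<le> Qs v + reject_const CARD('a) * (eps * r)"
  proof -
    have "2 + 6 * real CARD('a) \<le> 2 * real CARD('a) + 6 * real CARD('a)" using card_ge_1 by simp
    also have "\<dots> \<le> reject_const CARD('a)"
    proof -
      have "1 * real CARD('a) \<le> real CARD('a) * real CARD('a)"
        using card_ge_1 by (intro mult_right_mono) auto
      moreover have "0 \<le> real CARD('a) * real CARD('a) * real CARD('a)" by simp
      moreover have "reject_const CARD('a) = 6 * (real CARD('a) * real CARD('a) * real CARD('a)) +
          12 * (real CARD('a) * real CARD('a)) + 4 * real CARD('a)"
        by (simp add: reject_const_def algebra_simps)
      ultimately show ?thesis by linarith
    qed
    finally show ?thesis using er by (intro add_left_mono mult_right_mono) auto
  qed
  finally show ?thesis .
next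
  case SLQ
  let ?c = "real CARD('a)"
  have "Qs s \<le> ?c * real (Q i s) + ?c * (G * eps * r)"
    using SLQ_Qs[OF SLQ s, of i] by linarith
  also have "?c * real (Q i s) \<le> ?c * (real (Q i v) + 2 * (eps * r))"
    using not_accD[OF v] Q_upper[OF s, of i] by (intro mult_left_mono) auto
  also have "\<dots> = ?c * real (Q i v) + 2 * ?c * (eps * r)" by (simp add: distrib_left)
  also have "?c * real (Q i v) \<le> Qs v + ?c * (G * eps * r)"
    using SLQ_Qs[OF SLQ v(1,2), of i] by linarith
  finally show ?thesis by (simp add: reject_const_def G_def algebra_simps)
qed

section \<open>Fluctuations over short windows\<close>

definition \<eta> :: "real \<Rightarrow> real" where "\<eta> h = eps * (r + real n * h)"

lemma \<eta>: "h \<ge> 0 \<Longrightarrow> eps * r \<le> \<eta> h" "h \<ge> 0 \<Longrightarrow> 2 \<le> \<eta> h" "h \<le> h' \<Longrightarrow> \<eta> h \<le> \<eta> h'"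
proof -
  show 1: "h \<ge> 0 \<Longrightarrow> eps * r \<le> \<eta> h" unfolding \<eta>_def using eps by (intro mult_left_mono) auto
  show "h \<ge> 0 \<Longrightarrow> 2 \<le> \<eta> h" using 1 er by simp
  show "h \<le> h' \<Longrightarrow> \<eta> h \<le> \<eta> h'" unfolding \<eta>_def using eps
    by (intro mult_left_mono add_left_mono) auto
qed

lemma X_diff:
  assumes st: "0 \<le> s" "s \<le> t" "t \<le> T"
  shows "\<bar>(\<Sum>k\<in>UNIV. X k t) - (\<Sum>k\<in>UNIV. X k s) + (\<Sum>k\<in>UNIV. real (R k t) - real (R k s))\<bar>
    \<le> 3 * real CARD('a) * \<eta> (t - s)"
proof -
  have "(\<Sum>k\<in>UNIV. X k t) - (\<Sum>k\<in>UNIV. X k s) + (\<Sum>k\<in>UNIV. real (R k t) - real (R k s)) =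
     (\<Sum>k\<in>UNIV. (real (E k t) - real (E k s)) - (real (D k t) - real (D k s)))"
    unfolding sum_subtractf[symmetric] sum.distrib[symmetric]
  proof (rule sum.cong)
    fix k
    show "X k t - X k s + (real (R k t) - real (R k s)) =
      (real (E k t) - real (E k s)) - (real (D k t) - real (D k s))"
      using Q_diff[OF st(1,2), of k] Psi_eq_real[of s k] Psi_eq_real[of t k] st
      by (simp add: X_def dPsi_def)
  qed simp
  also have "\<bar>\<dots>\<bar> \<le> (\<Sum>k\<in>(UNIV :: 'a set). 3 * \<eta> (t - s))"
  proof (rule order_trans[OF sum_abs sum_mono])
    fix k
    show "\<bar>(real (E k t) - real (E k s)) - (real (D k t) - real (D k s))\<bar> \<le> 3 * \<eta> (t - s)"
      using NE[OF st, of k] ND[OF st, of k] unfolding \<eta>_def by linarith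
  qed
  finally show ?thesis by simp
qed

text \<open>Up to the last rejection \<open>v\<close> the total of \<open>X + R\<close> changes by
  noise only, and by \<open>reject_high\<close> the total queue at \<open>v\<close> is, up to noise,
  no lower than at \<open>s\<close>; so nearly nothing was rejected before \<open>v\<close>.
  Afterwards only the slack of \<open>total_last_rejection\<close> remains.\<close>

lemma R_window:
  assumes st: "0 \<le> s" "s \<le> t" "t \<le> T"
  shows "(\<Sum>k\<in>UNIV. real (R k t) - real (R k s)) \<le> (5 * real CARD('a) + reject_const CARD('a)) * \<eta> (t - s)"
proof -
  let ?c = "real CARD('a)"
  have rc: "0 \<le> reject_const ?c" by (simp add: reject_const_def)
  have c\<eta>: "?c * 2 \<le> ?c * \<eta> (t - s)" using \<eta>(2)[of "t - s"] st by (intro mult_left_mono) auto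
  from total_last_rejection[OF st] show ?thesis
  proof cases
    case 1
    have "(\<Sum>k\<in>UNIV. real (R k t) - real (R k s)) \<le> (\<Sum>k\<in>(UNIV :: 'a set). 1)"
    proof (rule sum_mono)
      fix k
      show "real (R k t) - real (R k s) \<le> 1" using 1[of k] by linarith
    qed
    also have "\<dots> \<le> 5 * (?c * \<eta> (t - s))" using c\<eta> card_ge_1 by simp
    also have "\<dots> \<le> (5 * ?c + reject_const ?c) * \<eta> (t - s)"
      using rc \<eta>(2)[of "t - s"] st by (simp add: distrib_right)
    finally show ?thesis .
  next
    case (2 v i)
    have v: "0 \<le> v" "v \<le> T" "s \<le> v" using 2 st by auto
    have "(\<Sum>k\<in>UNIV. real (R k t) - real (R k s)) \<le> (\<Sum>k\<in>UNIV. (real (R k v) - real (R k s)) + 2)"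
    proof (rule sum_mono)
      fix k
      show "real (R k t) - real (R k s) \<le> (real (R k v) - real (R k s)) + 2" using 2(4)[of k] by linarith
    qed
    also have "\<dots> = (\<Sum>k\<in>UNIV. real (R k v) - real (R k s)) + ?c * 2" by (simp add: sum.distrib)
    also have "(\<Sum>k\<in>UNIV. real (R k v) - real (R k s)) \<le>
        3 * ?c * \<eta> (v - s) - ((\<Sum>k\<in>UNIV. X k v) - (\<Sum>k\<in>UNIV. X k s))"
      using X_diff[OF st(1) v(3,2)] by linarith
    also have "\<dots> \<le> 3 * ?c * \<eta> (t - s) + reject_const ?c * \<eta> (t - s)"
    proof -
      have "0 < a i * r" using a_pos[of i] r by simp
      then have "0 < real (Q i v)" using not_accD[OF v(1,2) 2(3)] by linarith
      then have "0 < Qs v" unfolding Qs_def by (intro sum_pos2[of UNIV i]) auto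
      then have "(\<Sum>k\<in>UNIV. X k v) = Qs v" using sum_Q_le[OF v(1)] by (simp add: Qs_def)
      moreover have "(\<Sum>k\<in>UNIV. X k s) \<le> Qs s" using sum_Q_le[OF st(1)] by (simp add: Qs_def)
      moreover have "Qs s \<le> Qs v + reject_const ?c * (eps * r)"
        using reject_high[OF v(1,2) 2(3) st(1)] st by simp
      moreover have "reject_const ?c * (eps * r) \<le> reject_const ?c * \<eta> (t - s)"
        using rc \<eta>(1)[of "t - s"] st by (intro mult_left_mono) auto
      moreover have "3 * ?c * \<eta> (v - s) \<le> 3 * ?c * \<eta> (t - s)"
        using 2 by (intro mult_left_mono \<eta>) auto
      ultimately show ?thesis by linarith
    qed
    finally have "(\<Sum>k\<in>UNIV. real (R k t) - real (R k s)) \<le>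
        3 * ?c * \<eta> (t - s) + reject_const ?c * \<eta> (t - s) + ?c * 2" by simp
    then show ?thesis using c\<eta> unfolding distrib_right by linarith
  qed
qed

lemma R_window_single:
  assumes st: "0 \<le> s" "s \<le> t" "t \<le> T"
  shows "real (R i t) - real (R i s) \<le> (5 * real CARD('a) + reject_const CARD('a)) * \<eta> (t - s)"
proof -
  have "real (R i t) - real (R i s) \<le> (\<Sum>k\<in>UNIV. real (R k t) - real (R k s))"
    by (rule member_le_sum[where f = "\<lambda>k. real (R k t) - real (R k s)"]) (use R_le[OF st] in auto)
  then show ?thesis using R_window[OF st] by linarith
qed

text \<open>Taking positive parts does not increase distances, so the total queue moves as little as
  the total of \<open>X\<close>; a single queue follows its share, with the collapse error at both
  ends.\<close>

lemma Q_window: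
  assumes st: "0 \<le> s" "s \<le> t" "t \<le> T"
  shows "\<bar>real (Q i t) - real (Q i s)\<bar> \<le> (8 * real CARD('a) + reject_const CARD('a) + 2 * G) * \<eta> (t - s)"
proof -
  let ?c = "real CARD('a)"
  have t: "0 \<le> t" "t \<le> T" and s: "0 \<le> s" "s \<le> T" using st by auto
  have "0 \<le> (\<Sum>k\<in>UNIV. real (R k t) - real (R k s))"
    using R_le[OF st] by (intro sum_nonneg) simp
  then have X: "\<bar>(\<Sum>k\<in>UNIV. X k t) - (\<Sum>k\<in>UNIV. X k s)\<bar> \<le>
      3 * ?c * \<eta> (t - s) + (5 * ?c + reject_const ?c) * \<eta> (t - s)"
    using X_diff[OF st] R_window[OF st] by linarith
  then have Qs: "\<bar>Qs t - Qs s\<bar> \<le> 3 * ?c * \<eta> (t - s) + (5 * ?c + reject_const ?c) * \<eta> (t - s)"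
    unfolding Qs_def sum_Q_le[OF t(1)] sum_Q_le[OF s(1)] by linarith
  have "\<bar>share i * Qs t - share i * Qs s\<bar> \<le> 1 * \<bar>Qs t - Qs s\<bar>"
    unfolding right_diff_distrib[symmetric] abs_mult using share[of i] by (intro mult_right_mono) auto
  with Qs have 1: "\<bar>share i * Qs t - share i * Qs s\<bar> \<le>
      3 * ?c * \<eta> (t - s) + (5 * ?c + reject_const ?c) * \<eta> (t - s)"
    by simp
  have "G * (eps * r) \<le> G * \<eta> (t - s)"
    using G_ge \<eta>(1)[of "t - s"] st by (intro mult_left_mono) auto
  with collapse[OF t, of i] collapse[OF s, of i]
  have "\<bar>real (Q i t) - share i * Qs t\<bar> \<le> G * \<eta> (t - s)"
    "\<bar>real (Q i s) - share i * Qs s\<bar> \<le> G * \<eta> (t - s)"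
    by (auto intro: order_trans)
  with 1 have "\<bar>real (Q i t) - real (Q i s)\<bar> \<le>
      3 * ?c * \<eta> (t - s) + (5 * ?c + reject_const ?c) * \<eta> (t - s) + 2 * (G * \<eta> (t - s))"
    by linarith
  then show ?thesis by (simp add: algebra_simps)
qed

lemma window_const_eq:
  "window_const CARD('a) * x = x + (8 * real CARD('a) + reject_const CARD('a) + 2 * G) * x
    + (5 * real CARD('a) + reject_const CARD('a)) * x"
  by (simp add: window_const_def G_def algebra_simps)

lemma B_window:
  assumes st: "0 \<le> s" "s \<le> t" "t \<le> T"
  shows "\<bar>real (B i t) - real (B i s) - n * lam i * (t - s)\<bar> \<le> window_const CARD('a) * \<eta> (t - s)"
  using Q_window[OF st, of i] R_window_single[OF st, of i] R_le[OF st, of i] NE[OF st, of i]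
    Q_diff[OF st(1,2), of i]
  unfolding window_const_eq \<eta>_def[symmetric] by linarith

lemma J_window:
  assumes st: "0 \<le> s" "s \<le> t" "t \<le> T"
  shows "real (J i t) - real (J i s) \<ge> n * lam i * (t - s) - window_const CARD('a) * \<eta> (t - s)"
proof -
  have "0 \<le> (8 * real CARD('a) + reject_const CARD('a) + 2 * G) * \<eta> (t - s)"
    using Q_window[OF st, of i] by linarith
  then show ?thesis
    using R_window_single[OF st, of i] NE[OF st, of i] JR[of i s] JR[of i t]
    unfolding window_const_eq \<eta>_def[symmetric] by linarith
qed

text \<open>With \<open>h = C / r\<close>, somebody joins within \<open>h\<close> after
  \<open>t\<close> by \<open>J_window\<close>, and from the joining time \<open>u\<close> on
  \<open>B_window\<close> pins down when \<open>B\<close> has grown by the queue at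
  \<open>u\<close>. \<open>C\<close> is large enough for the wait, about \<open>K / lam i\<close> at
  most on this scale, to fit into a second window; the 2 in the hypothesis on \<open>C\<close>
  leaves room for \<open>\<zeta>\<close>.\<close>

lemma deviation_le:
  assumes t: "0 \<le> t" "t + 2 * (C / r) \<le> T" and C: "K + 2 \<le> lam i * C"
    and \<zeta>: "window_const CARD('a) * (1 + C) * eps \<le> \<zeta>" "0 < \<zeta>" "\<zeta> \<le> 1"
  shows "deviation n (lam i) (J i) (B i) (Q i) t \<le> ereal \<zeta>"
proof -
  define h where "h = C / r"
  have K: "K \<ge> 0" using path_bounds(2)[of 0] T r by (smt (verit) mult_neg_pos of_nat_0_le_iff sum_nonneg)
  have C0: "C > 0" using C K lam[of i] by (smt (verit) mult_nonneg_nonpos)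
  have h: "h > 0" "n * h = C * r" using C0 r unfolding h_def by (auto simp: real_div_sqrt field_simps)
  have wc: "window_const CARD('a) \<ge> 0" by (simp add: window_const_def reject_const_def)
  have win: "window_const CARD('a) * \<eta> d \<le> \<zeta> * r" if "d \<le> h" for d
  proof -
    have "window_const CARD('a) * \<eta> d \<le> window_const CARD('a) * \<eta> h"
      using that wc by (intro mult_left_mono \<eta>)
    also have "\<dots> = (window_const CARD('a) * (1 + C) * eps) * r"
      using h by (simp add: \<eta>_def algebra_simps)
    also have "\<dots> \<le> \<zeta> * r" using \<zeta> by (intro mult_right_mono) auto
    finally show ?thesis .
  qed
  have lam_h: "n * lam i * h = lam i * C * r" using h by (simp add: mult.assoc mult.left_commute)
  have T2: "t + 2 * h \<le> T" using t by (simp add: h_def)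
  have "J i t < J i (t + h)"
  proof -
    have "real (J i (t + h)) - real (J i t) \<ge> n * lam i * h - \<zeta> * r"
      using J_window[of t "t + h" i] win[of h] t T2 h by simp
    also have "n * lam i * h - \<zeta> * r = (lam i * C - \<zeta>) * r" unfolding lam_h by (simp add: algebra_simps)
    finally have *: "real (J i (t + h)) - real (J i t) \<ge> (lam i * C - \<zeta>) * r" .
    have "0 < (lam i * C - \<zeta>) * r" using C K \<zeta> r by (intro mult_pos_pos) auto
    then show ?thesis using * by linarith
  qed
  \<comment> \<open>The joining time compares with the count just before \<open>t\<close>, read as 0
    at time 0; either way this is at most \<open>J i t\<close>.\<close>
  moreover have "(if t = 0 then 0 else left_lim (J i) t) \<le> J i t"
  proof (cases "t = 0")
    case False
    then have "0 < t" using t by simp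
    then obtain v where "0 < v" "v < t" "J i v = left_lim (J i) t"
      using eventually_at_left_obtain[OF left_const(4)[of t i], of 0] T2 h by auto
    then show ?thesis using J_le[of v t i] T2 h False by simp
  qed simp
  ultimately have th: "t \<le> t + h \<and> (if t = 0 then 0 else left_lim (J i) t) < J i (t + h)"
    using h by auto
  obtain u where u: "join_time (J i) t = ereal u" "t \<le> u" "u \<le> t + h"
    unfolding join_time_def by (rule Inf_ereal_between[where P = "\<lambda>s. t \<le> s \<and> (if t = 0 then 0 else left_lim (J i) t) < J i s", OF _ th]) auto
  have u0: "0 \<le> u" "u \<le> T" "u + h \<le> T" using u t T2 h by auto
  define q where "q = real (Q i u) / r"
  have q: "real (Q i u) = q * r" "0 \<le> q" "q \<le> K"
    using r Q_le[OF u0(1,2), of i] by (auto simp: q_def field_simps)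
  \<comment> \<open>The time at which \<open>B\<close>, growing at its nominal rate from
    \<open>u\<close> on, has gained \<open>x * r\<close>.\<close>
  define w where "w x = u + x / (lam i * r)" for x
  have lr: "0 < lam i * r" using lam[of i] r by simp
  have wu: "n * lam i * (w x - u) = x * r" for x
    using lam[of i] r unfolding w_def by (simp add: real_div_sqrt field_simps)
  have w_le: "x \<le> lam i * C \<longleftrightarrow> w x \<le> u + h" for x
    using lam[of i] r unfolding w_def h_def by (simp add: field_simps)
  have lower: "w (q - \<zeta>) \<le> s" if s: "t < s \<and> B i u + Q i u \<le> B i s" for s
  proof (rule ccontr)
    assume "\<not> w (q - \<zeta>) \<le> s"
    then have less: "s < w (q - \<zeta>)" by simp
    then have "n * lam i * (s - u) < n * lam i * (w (q - \<zeta>) - u)"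
      using n lam[of i] by (intro mult_strict_left_mono) auto
    then have less': "n * lam i * (s - u) < (q - \<zeta>) * r" by (simp add: wu)
    have "s < u + h" using less w_le[of "q - \<zeta>"] q \<zeta> C by linarith
    have "real (Q i u) \<le> real (B i s) - real (B i u)" using s by linarith
    also have "\<dots> \<le> n * lam i * (s - u) + \<zeta> * r"
    \<comment> \<open>\<open>service_time\<close> takes the infimum over times after
      \<open>t\<close>, not after \<open>u\<close>, so \<open>s\<close> may precede
      \<open>u\<close>.\<close>
    proof (cases "u \<le> s")
      case True
      then show ?thesis using B_window[of u s i] win[of "s - u"] u0 \<open>s < u + h\<close> by auto
    next
      case False
      then show ?thesis using B_window[of s u i] win[of "u - s"] u0 u s t by (auto simp: algebra_simps)
    qed
    finally show False using less' q by (simp add: algebra_simps)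
  qed
  have upper: "t < w (q + \<zeta>) \<and> B i u + Q i u \<le> B i (w (q + \<zeta>))"
  proof -
    have "0 < (q + \<zeta>) / (lam i * r)" using q \<zeta> lr by (intro divide_pos_pos) auto
    then have 1: "u < w (q + \<zeta>)" by (simp add: w_def)
    have 2: "w (q + \<zeta>) \<le> u + h" using w_le[of "q + \<zeta>"] q \<zeta> C by linarith
    have "real (B i (w (q + \<zeta>))) - real (B i u) \<ge> (q + \<zeta>) * r - \<zeta> * r"
      using B_window[of u "w (q + \<zeta>)" i] win[of "w (q + \<zeta>) - u"] 1 2 u0 by (simp add: wu)
    then have "real (B i (w (q + \<zeta>))) - real (B i u) \<ge> real (Q i u)"
      using q by (simp add: algebra_simps)
    then show ?thesis using 1 u by linarith
  qed
  obtain x where x: "Inf {ereal s |s. t < s \<and> B i u + Q i u \<le> B i s} = ereal x"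
    "w (q - \<zeta>) \<le> x" "x \<le> w (q + \<zeta>)"
    by (rule Inf_ereal_between[where P = "\<lambda>s. t < s \<and> B i u + Q i u \<le> B i s", OF lower upper])
  have st: "service_time (J i) (B i) (Q i) t = ereal x"
    unfolding service_time_def using u x(1) by (simp add: Let_def)
  have "\<bar>q - lam i * (r * (x - u))\<bar> \<le> \<zeta>"
  proof -
    have "lam i * r * (w y - u) = y" for y
    proof -
      have "w y - u = y / (lam i * r)" by (simp add: w_def)
      then show ?thesis using lr by (metis less_irrefl nonzero_mult_div_cancel_left times_divide_eq_right)
    qed
    moreover have "lam i * r * (w (q - \<zeta>) - u) \<le> lam i * r * (x - u)"
      "lam i * r * (x - u) \<le> lam i * r * (w (q + \<zeta>) - u)"
      using lr x by (auto intro!: mult_left_mono)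
    ultimately show ?thesis by (simp add: abs_le_iff mult.assoc)
  qed
  then show ?thesis
    unfolding deviation_def waiting_time_def st u(1) by (simp add: q_def)
qed

end

section \<open>Convergence in probability\<close>

text \<open>If the cost does not exceed \<open>r\<close> up to \<open>K\<close>, the value
  \<open>a = K\<close> describes the rule on the relevant range even when there is no finite
  threshold; otherwise the intermediate value theorem gives one, positive because
  \<open>h 0 = 0 < r\<close>.\<close>

lemma threshold_level:
  fixes h :: "real \<Rightarrow> real"
  assumes h: "continuous_on {0..} h" "strict_mono_on {0..} h" "h 0 = 0" and r: "r > 0"
    and lam: "lam > 0" and K: "K > 0"
  obtains a where "a > 0" "\<And>x. 0 \<le> x \<Longrightarrow> x \<le> K \<Longrightarrow> h (x / lam) \<le> r \<longleftrightarrow> x \<le> a"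
proof (cases "h (K / lam) \<le> r")
  case True
  have "h (x / lam) \<le> r" if "0 \<le> x" "x \<le> K" for x
  proof -
    have "h (x / lam) \<le> h (K / lam)"
      using that lam by (intro monotone_onD[OF strict_mono_on_imp_mono_on[OF h(2)]]) (auto intro: divide_right_mono)
    then show ?thesis using True by simp
  qed
  then show ?thesis using that[OF K] by simp
next
  case False
  have "\<exists>y. 0 \<le> y \<and> y \<le> K / lam \<and> h y = r"
    using False h(3) r K lam by (intro IVT') (auto intro: continuous_on_subset[OF h(1)])
  then obtain y where y: "0 \<le> y" "h y = r" by blast
  have "y \<noteq> 0" using y h(3) r by auto
  then have a: "y * lam > 0" using y lam by simp
  have "h (x / lam) \<le> r \<longleftrightarrow> x \<le> y * lam" if "0 \<le> x" for x
    using strict_mono_on_less_eq[OF h(2), of "x / lam" y] that y lam by (simp add: pos_divide_le_eq)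
  then show ?thesis using that[OF a] by simp
qed

text \<open>The deterministic core at one sample point, for all scenarios at once: none of the noise
  hypotheses mentions the scenario. The horizon is \<open>T + 2\<close> since from a time up to
  \<open>T\<close> two windows of length \<open>C / sqrt n \<le> 1\<close> are followed.\<close>

lemma sample_bound:
  fixes E S :: "'k::{finite,linorder} process" and Q Psi B D :: "'k scenario \<Rightarrow> 'k process"
    and lam mu rho r a :: "'k \<Rightarrow> real" and T C eps kap \<zeta> :: real and n :: nat
    and h :: "'k \<Rightarrow> real \<Rightarrow> real"
  defines "\<sigma> \<equiv> threshold_profile lam r h n"
    and "m \<equiv> (\<Sum>i\<in>UNIV. mu i)" and "N \<equiv> real CARD('k)"
  assumes path: "\<And>s. s \<in> scenarios \<Longrightarrow>
      system_path pol n E S q0 psi0 (scenario_profile \<sigma> s) (Q s) (Psi s) (B s) (D s)"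
    and g: "\<And>i. strict_mono (g i :: nat \<Rightarrow> real)" "\<And>i. g i 0 = 0"
    and E_iff: "\<And>i (t::real) j. 0 \<le> t \<Longrightarrow> t \<le> T + 2 \<Longrightarrow> j \<le> E i t \<longleftrightarrow> g i j \<le> t"
    and S: "\<And>i. mono_on {0..} (S i)" "\<And>i. S i 0 = 0"
    and n: "n \<ge> 1" and T: "T > 0"
    and lam: "\<And>i. lam i > 0" and mu: "\<And>i. mu i > 0" and rho: "\<And>i. rho i = lam i / mu i"
    and rho_sum: "(\<Sum>i\<in>UNIV. rho i) = 1"
    and eps: "0 < eps" "eps \<le> 1" "1 \<le> kap"
    and NE: "\<And>i (s::real) t. 0 \<le> s \<Longrightarrow> s \<le> t \<Longrightarrow> t \<le> T + 2 \<Longrightarrow>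
        \<bar>real (E i t) - real (E i s) - n * lam i * (t - s)\<bar> \<le> eps * (sqrt n + n * (t - s))"
    and NS: "\<And>i (x::real) y. 0 \<le> x \<Longrightarrow> x \<le> y \<Longrightarrow> y \<le> n * (T + 2) \<Longrightarrow>
        \<bar>real (S i y) - real (S i x) - mu i * (y - x)\<bar> \<le> eps * (sqrt n + (y - x))"
    and TE: "\<And>i (t::real). 0 \<le> t \<Longrightarrow> t \<le> T + 2 \<Longrightarrow> \<bar>real (E i t) - n * lam i * t\<bar> \<le> kap * sqrt n"
    and TS: "\<And>i (x::real). 0 \<le> x \<Longrightarrow> x \<le> n * (T + 2) \<Longrightarrow> \<bar>real (S i x) - mu i * x\<bar> \<le> kap * sqrt n"
    and I0: "\<And>i. real (q0 i) \<le> eps * sqrt n" "\<And>i. \<bar>real (psi0 i) - n * rho i\<bar> \<le> kap * sqrt n"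
    and h: "\<And>i. h i 0 = 0" and r: "\<And>i. r i > 0"
    and a: "\<And>i (x::real). 0 \<le> x \<Longrightarrow> x \<le> path_bound N kap m (T + 2) \<Longrightarrow> h i (x / lam i) \<le> r i \<longleftrightarrow> x \<le> a i"
    and small: "\<And>i. 6 * N * eps < a i" "\<And>i. 4 * N * eps \<le> lam i" "window_const N * (1 + C) * eps \<le> \<zeta>"
    and n_large: "2 \<le> eps * sqrt n" "m * path_bound N kap m (T + 2) \<le> eps * sqrt n" and C_n: "C \<le> sqrt n"
    and C: "path_bound N kap m (T + 2) + 2 \<le> lam i * C" and \<zeta>: "0 < \<zeta>" "\<zeta> \<le> 1"
  shows "(SUP s\<in>scenarios. SUP t\<in>{0..T}. deviation n (lam i)
      (joins E (decisions E (scenario_profile \<sigma> s) (Q s)) i) (B s i) (Q s i) t) \<le> ereal \<zeta>"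
proof (intro SUP_least)
  fix s :: "'k scenario" and t assume s: "s \<in> scenarios" and t: "t \<in> {0..T}"
  define acc where "acc k q \<longleftrightarrow> h k (real q / (sqrt n * lam k)) \<le> r k" for k and q :: nat
  have \<sigma>: "\<sigma> = (\<lambda>k j q. if acc k q then 1 else 0)"
    by (intro ext) (simp add: \<sigma>_def threshold_profile_def acc_def)
  have sqrt_n: "sqrt n > 0" using n by simp
  interpret threshold_loss_system pol n E S q0 psi0 acc s "Q s" "Psi s" "B s" "D s" g "T + 2" lam mu rho eps kap a
  proof unfold_locales
    show "system_path pol n E S q0 psi0
       (scenario_profile (\<lambda>i j q. if acc i q then 1 else 0) s) (Q s) (Psi s) (B s) (D s)"
      using path[OF s] unfolding \<sigma> .
    show "acc k q \<longleftrightarrow> real q \<le> a k * sqrt n"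
      if "real q \<le> path_bound CARD('k) kap (\<Sum>i\<in>UNIV. mu i) (T + 2) * sqrt n" for k q
    proof -
      have "h k (real q / sqrt n / lam k) \<le> r k \<longleftrightarrow> real q / sqrt n \<le> a k"
        using that sqrt_n by (intro a) (auto simp: pos_divide_le_eq m_def N_def)
      then show ?thesis using sqrt_n by (simp add: acc_def pos_divide_le_eq)
    qed
    show "acc k 0" for k using h[of k] r[of k] by (simp add: acc_def)
  qed (use g E_iff S n T lam mu rho rho_sum eps NE NS TE TS I0 small n_large in \<open>simp_all add: m_def N_def\<close>)
  have "C / sqrt n \<le> 1" using C_n sqrt_n by (simp add: pos_divide_le_eq)
  then have "deviation n (lam i) (J i) (B s i) (Q s i) t \<le> ereal \<zeta>"
    using t C small(3) \<zeta> by (intro deviation_le[where C = C]) (auto simp: m_def N_def)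
  then show "deviation n (lam i) (joins E (decisions E (scenario_profile \<sigma> s) (Q s)) i) (B s i) (Q s i) t \<le> ereal \<zeta>"
    unfolding J_def \<sigma> .
qed

text \<open>All that the path argument asks of the arrivals of one class. That epochs
  \<open>g\<close> invert the counts is part of it, since the partial sums are known to pass the
  horizon only on the good event.\<close>

definition renewal_close :: "(real \<Rightarrow> nat) \<Rightarrow> real \<Rightarrow> real \<Rightarrow> nat \<Rightarrow> real \<Rightarrow> real \<Rightarrow> bool" where
  "renewal_close e lam T n \<kappa> \<epsilon> \<longleftrightarrow>
     (\<exists>g :: nat \<Rightarrow> real. strict_mono g \<and> g 0 = 0 \<and>
       (\<forall>t j. 0 \<le> t \<longrightarrow> t \<le> T \<longrightarrow> (j \<le> e t \<longleftrightarrow> g j \<le> t))) \<and>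
     (\<forall>s t. 0 \<le> s \<longrightarrow> s \<le> t \<longrightarrow> t \<le> T \<longrightarrow>
       \<bar>real (e t) - real (e s) - n * lam * (t - s)\<bar> \<le> \<epsilon> * (sqrt n + n * (t - s))) \<and>
     (\<forall>t. 0 \<le> t \<longrightarrow> t \<le> T \<longrightarrow> \<bar>real (e t) - n * lam * t\<bar> \<le> \<kappa> * sqrt n)"

definition service_close :: "(real \<Rightarrow> nat) \<Rightarrow> real \<Rightarrow> real \<Rightarrow> nat \<Rightarrow> real \<Rightarrow> real \<Rightarrow> bool" where
  "service_close S mu T n \<kappa> \<epsilon> \<longleftrightarrow>
     (\<forall>x y. 0 \<le> x \<longrightarrow> x \<le> y \<longrightarrow> y \<le> n * T \<longrightarrow>
       \<bar>real (S y) - real (S x) - mu * (y - x)\<bar> \<le> \<epsilon> * (sqrt n + (y - x))) \<and>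
     (\<forall>x. 0 \<le> x \<longrightarrow> x \<le> n * T \<longrightarrow> \<bar>real (S x) - mu * x\<bar> \<le> \<kappa> * sqrt n)"

section \<open>Noise events of high probability\<close>

context prob_space
begin

text \<open>The order of quantifiers matters: \<open>\<kappa>\<^sub>0\<close> is found from
  \<open>\<delta>\<close> before \<open>\<epsilon>\<close> is known, and only the exceptional event
  and the range of \<open>n\<close> depend on \<open>\<epsilon>\<close>.\<close>

lemma arrival_noise_whp:
  fixes IA :: "nat \<Rightarrow> 'a \<Rightarrow> real" and rate :: "nat \<Rightarrow> real" and T lam \<beta> \<delta> :: real
  assumes iid: "iid_nonneg M (\<lambda>j. IA (Suc j)) 1" and T: "T > 0" and lam: "lam > 0"
    and rate: "\<forall>\<^sub>F n in sequentially. \<bar>rate n - n * lam\<bar> \<le> \<beta> * sqrt n" "\<And>n. n \<ge> 1 \<Longrightarrow> rate n > 0"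
    and \<beta>: "\<beta> \<ge> 0" and \<delta>: "\<delta> > 0"
  obtains \<kappa>\<^sub>0 where "\<kappa>\<^sub>0 \<ge> 1" "\<And>\<kappa> \<epsilon>. \<kappa>\<^sub>0 \<le> \<kappa> \<Longrightarrow> \<epsilon> > 0 \<Longrightarrow> \<forall>\<^sub>F n in sequentially. \<exists>A\<in>events. prob A \<le> \<delta> \<and>
    (\<forall>\<omega>\<in>space M - A. (\<forall>k. IA (Suc k) \<omega> > 0) \<longrightarrow> renewal_close (arrivals (\<lambda>k. IA k \<omega>) (rate n)) lam T n \<kappa> \<epsilon>)"
proof -
  interpret X: iid_nonneg M "\<lambda>j. IA (Suc j)" 1 by fact
  \<comment> \<open>Enough interarrival times to pass the horizon: with noise factor at most 1/2,
    the sum of about \<open>C * n\<close> of them is at least half their number up to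
    \<open>sqrt n / 2\<close>, hence the factor 2 in front of
    \<open>(lam + \<beta>) * T\<close>.\<close>
  define C where "C = 2 * (lam + \<beta>) * T + 4"
  have C: "C \<ge> 0" using lam \<beta> T by (simp add: C_def)
  obtain \<kappa>\<^sub>1 where \<kappa>\<^sub>1: "\<kappa>\<^sub>1 \<ge> 1" "\<And>\<kappa>' (n::nat). \<kappa>\<^sub>1 \<le> \<kappa>' \<Longrightarrow> n \<ge> 1 \<Longrightarrow>
      prob {\<omega>\<in>space M. \<exists>l. real l \<le> C * n \<and> \<kappa>' * sqrt n \<le> \<bar>(\<Sum>i<l. IA (Suc i) \<omega>) - 1 * l\<bar>} \<le> \<delta> / 2"
    by (rule X.partial_sums_tight[of "\<delta> / 2" C]) (use \<delta> C in auto)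
  define \<kappa>\<^sub>0 where "\<kappa>\<^sub>0 = \<kappa>\<^sub>1 + 1 + \<beta> * T"
  have \<kappa>\<^sub>0: "\<kappa>\<^sub>0 \<ge> 1" using \<kappa>\<^sub>1(1) \<beta> T by (simp add: \<kappa>\<^sub>0_def)
  show ?thesis
  proof (rule that[OF \<kappa>\<^sub>0])
    fix \<kappa> \<epsilon> :: real assume \<kappa>: "\<kappa>\<^sub>0 \<le> \<kappa>" and \<epsilon>: "\<epsilon> > 0"
    define \<epsilon>' where "\<epsilon>' = min (1 / 2) (min (\<epsilon> / 4) (\<epsilon> / (4 * (lam + \<beta>))))"
    have lb: "lam + \<beta> > 0" using lam \<beta> by simp
    have \<epsilon>': "0 < \<epsilon>'" "2 * \<epsilon>' \<le> 1" "4 * \<epsilon>' \<le> \<epsilon>" "4 * \<epsilon>' * (lam + \<beta>) \<le> \<epsilon>"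
    proof -
      show "0 < \<epsilon>'" "2 * \<epsilon>' \<le> 1" "4 * \<epsilon>' \<le> \<epsilon>" using \<epsilon> lb by (auto simp: \<epsilon>'_def)
      have "\<epsilon>' \<le> \<epsilon> / (4 * (lam + \<beta>))" by (simp add: \<epsilon>'_def)
      then show "4 * \<epsilon>' * (lam + \<beta>) \<le> \<epsilon>" using lb by (simp add: pos_le_divide_eq mult.commute mult.left_commute)
    qed
    have "\<forall>\<^sub>F n in sequentially. prob {\<omega>\<in>space M. \<exists>a b. a \<le> b \<and> b \<le> nat \<lfloor>C * real n\<rfloor> \<and>
      \<epsilon>' * (sqrt n + real (b - a)) < \<bar>(\<Sum>i\<in>{a..<b}. IA (Suc i) \<omega>) - 1 * real (b - a)\<bar>} \<le> \<delta> / 2"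
      by (rule X.partial_sums_window) (use \<epsilon>' \<delta> C in auto)
    moreover have "\<forall>\<^sub>F n in sequentially. 6 \<le> \<epsilon> * sqrt (real n)" "\<forall>\<^sub>F n in sequentially. 2 * \<beta> \<le> \<epsilon> * sqrt (real n)"
      using \<epsilon> by real_asymp+
    moreover note rate(1) eventually_ge_at_top[of 1]
    ultimately show "\<forall>\<^sub>F n in sequentially. \<exists>A\<in>events. prob A \<le> \<delta> \<and>
    (\<forall>\<omega>\<in>space M - A. (\<forall>k. IA (Suc k) \<omega> > 0) \<longrightarrow> renewal_close (arrivals (\<lambda>k. IA k \<omega>) (rate n)) lam T n \<kappa> \<epsilon>)"
    proof eventually_elim
      case (elim n)
      define k where "k = nat \<lfloor>C * real n\<rfloor>"
      have k: "real l \<le> C * n \<longleftrightarrow> l \<le> k" for l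
        using C by (simp add: k_def le_nat_iff le_floor_iff)
      define A1 where "A1 = {\<omega>\<in>space M. \<exists>a b. a \<le> b \<and> b \<le> k \<and>
        \<epsilon>' * (sqrt n + real (b - a)) < \<bar>(\<Sum>i\<in>{a..<b}. IA (Suc i) \<omega>) - 1 * real (b - a)\<bar>}"
      define A2 where "A2 = {\<omega>\<in>space M. \<exists>l. real l \<le> C * n \<and> \<kappa>\<^sub>1 * sqrt n \<le> \<bar>(\<Sum>i<l. IA (Suc i) \<omega>) - 1 * l\<bar>}"
      have A: "A1 \<in> events" "A2 \<in> events" unfolding A1_def A2_def by measurable
      have "prob (A1 \<union> A2) \<le> prob A1 + prob A2" by (rule measure_Un_le[OF A])
      also have "prob A1 \<le> \<delta> / 2" using elim(1) by (simp only: A1_def k_def)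
      also have "prob A2 \<le> \<delta> / 2" unfolding A2_def by (rule \<kappa>\<^sub>1(2)) (use elim in auto)
      finally have prob: "prob (A1 \<union> A2) \<le> \<delta>" by simp
      have sqrt_n: "sqrt n \<ge> 1" "sqrt n \<le> n"
        using elim(5) by (auto simp: real_le_lsqrt power2_eq_square)
      have main: "renewal_close (arrivals (\<lambda>k. IA k \<omega>) (rate n)) lam T n \<kappa> \<epsilon>"
        if \<omega>: "\<omega> \<in> space M - (A1 \<union> A2)" and pos: "\<forall>k. IA (Suc k) \<omega> > 0" for \<omega>
      proof -
        let ?e = "arrivals (\<lambda>k. IA k \<omega>) (rate n)"
        define x where "x j = IA (Suc j) \<omega>" for j
        define g where "g j = (\<Sum>k=1..j. IA k \<omega> / rate n)" for j
        have rn: "rate n > 0" using rate(2) elim(5) .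
        have g_x: "g j = (\<Sum>i<j. x i) / rate n" for j
          unfolding g_def x_def sum_divide_distrib by (simp add: sum.atLeast1_atMost_eq)
        have W: "\<bar>(\<Sum>i\<in>{a..<b}. x i) - real (b - a)\<bar> \<le> \<epsilon>' * (sqrt n + real (b - a))" if "a \<le> b" "b \<le> k" for a b
          using \<omega> that unfolding A1_def x_def by (force simp: not_less)
        have tight: "\<bar>(\<Sum>i<l. x i) - real l\<bar> \<le> \<kappa>\<^sub>1 * sqrt n" if "l \<le> k" for l
          using \<omega> that unfolding A2_def x_def k by (force simp: not_le less_imp_le)
        have long: "rate n * T < (\<Sum>i<k. x i)"
        proof -
          have "real k - (1 / 2) * (sqrt n + real k) \<le> real k - \<epsilon>' * (sqrt n + real k)"
            using \<epsilon>' by (intro diff_left_mono mult_right_mono) auto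
          also have "\<dots> \<le> (\<Sum>i<k. x i)"
            using W[of 0 k] by (simp add: atLeast0LessThan abs_le_iff)
          finally have 1: "real k / 2 - sqrt n / 2 \<le> (\<Sum>i<k. x i)" by (simp add: algebra_simps)
          have "C * n - 1 < real k" using C unfolding k_def by linarith
          moreover have "C * n = 2 * ((lam + \<beta>) * n * T) + 4 * n" by (simp add: C_def algebra_simps)
          moreover have "rate n * T \<le> (lam + \<beta>) * n * T"
          proof (rule mult_right_mono)
            have "rate n \<le> n * lam + \<beta> * sqrt n" using elim(4) by linarith
            also have "\<dots> \<le> n * lam + \<beta> * n" using sqrt_n \<beta> by (intro add_left_mono mult_left_mono)
            finally show "rate n \<le> (lam + \<beta>) * n" by (simp add: algebra_simps)
          qed (use T in simp)
          moreover have "real n \<ge> 1" using elim(5) by simp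
          ultimately show ?thesis using 1 sqrt_n by linarith
        qed
        have gk: "T < g k" unfolding g_x using long rn by (simp add: pos_less_divide_eq mult.commute)
        have sm: "strict_mono g" "g 0 = 0"
          unfolding g_def using arrivals_iff(1,2)[of "\<lambda>k. IA k \<omega>" "rate n"] pos rn by auto
        have iff: "j \<le> ?e t \<longleftrightarrow> g j \<le> t" if "0 \<le> t" "t \<le> T" for t :: real and j
          unfolding g_def using pos rn that gk
          by (intro arrivals_iff(3)[where k = k]) (auto simp: g_def)
        have iff_x: "j \<le> ?e t \<longleftrightarrow> (\<Sum>i<j. x i) \<le> rate n * t" if "0 \<le> t" "t \<le> T" for t j
          using iff[OF that, of j] rn unfolding g_x by (simp add: pos_divide_le_eq mult.commute)
        have "\<bar>real (?e t) - real (?e s) - n * lam * (t - s)\<bar> \<le> \<epsilon> * (sqrt n + n * (t - s))"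
          if "0 \<le> s" "s \<le> t" "t \<le> T" for s t :: real
          by (rule renewal_noise(1)[OF iff_x long elim(4) rn \<beta> elim(5) W]) (use \<epsilon>' elim that in auto)
        moreover have "\<bar>real (?e t) - n * lam * t\<bar> \<le> \<kappa> * sqrt n" if "0 \<le> t" "t \<le> T" for t :: real
        proof -
          have "\<bar>real (?e t) - n * lam * t\<bar> \<le> (\<kappa>\<^sub>1 + 1 + \<beta> * T) * sqrt n"
            by (rule renewal_noise(2)[OF iff_x long elim(4) rn \<beta> elim(5) tight]) (use that in auto)
          also have "\<dots> \<le> \<kappa> * sqrt n" using \<kappa> by (intro mult_right_mono) (auto simp: \<kappa>\<^sub>0_def)
          finally show ?thesis .
        qed
        ultimately show ?thesis using sm iff unfolding renewal_close_def by blast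
      qed
      show ?case
        by (rule bexI[of _ "A1 \<union> A2"]) (use A prob main in auto)
    qed
  qed
qed

end

context prob_space
begin

lemma service_noise_whp:
  fixes S :: "real \<Rightarrow> 'a \<Rightarrow> nat" and T mu \<delta> :: real
  assumes pois: "poisson_process mu S" and mu: "mu > 0" and T: "T > 0" and \<delta>: "\<delta> > 0"
  obtains \<kappa>\<^sub>0 where "\<kappa>\<^sub>0 \<ge> 1" "\<And>\<kappa> \<epsilon>. \<kappa>\<^sub>0 \<le> \<kappa> \<Longrightarrow> \<epsilon> > 0 \<Longrightarrow> \<forall>\<^sub>F n in sequentially. \<exists>A\<in>events. prob A \<le> \<delta> \<and>
    (\<forall>\<omega>\<in>space M - A. mono_on {0..} (\<lambda>t. S t \<omega>) \<and> S 0 \<omega> = 0 \<longrightarrow>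
      service_close (\<lambda>t. S t \<omega>) mu T n \<kappa> \<epsilon>)"
proof -
  let ?X = "\<lambda>j \<omega>. real (S (real (Suc j)) \<omega> - S (real j) \<omega>)"
  interpret X: iid_nonneg M ?X mu by (rule poisson_increments_iid[OF pois mu])
  \<comment> \<open>The argument of the service process stays within \<open>n * T\<close>; the
    surplus accounts for rounding up to integer times.\<close>
  define C where "C = T + 2"
  have C: "C \<ge> 0" using T by (simp add: C_def)
  obtain \<kappa>\<^sub>1 where \<kappa>\<^sub>1: "\<kappa>\<^sub>1 \<ge> 1" "\<And>\<kappa>' (n::nat). \<kappa>\<^sub>1 \<le> \<kappa>' \<Longrightarrow> n \<ge> 1 \<Longrightarrow>
      prob {\<omega>\<in>space M. \<exists>l. real l \<le> C * n \<and> \<kappa>' * sqrt n \<le> \<bar>(\<Sum>i<l. ?X i \<omega>) - mu * l\<bar>} \<le> \<delta> / 2"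
    by (rule X.partial_sums_tight[of "\<delta> / 2" C]) (use \<delta> C in auto)
  define \<kappa>\<^sub>0 where "\<kappa>\<^sub>0 = \<kappa>\<^sub>1 + mu"
  have \<kappa>\<^sub>0: "\<kappa>\<^sub>0 \<ge> 1" using \<kappa>\<^sub>1(1) mu by (simp add: \<kappa>\<^sub>0_def)
  show ?thesis
  proof (rule that[OF \<kappa>\<^sub>0])
    fix \<kappa> \<epsilon> :: real assume \<kappa>: "\<kappa>\<^sub>0 \<le> \<kappa>" and \<epsilon>: "\<epsilon> > 0"
    define \<epsilon>' where "\<epsilon>' = min (1 / 2) (\<epsilon> / 2)"
    have \<epsilon>': "0 < \<epsilon>'" "2 * \<epsilon>' \<le> 1" "2 * \<epsilon>' \<le> \<epsilon>" using \<epsilon> by (auto simp: \<epsilon>'_def)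
    have "\<forall>\<^sub>F n in sequentially. prob {\<omega>\<in>space M. \<exists>a b. a \<le> b \<and> b \<le> nat \<lfloor>C * real n\<rfloor> \<and>
      \<epsilon>' * (sqrt n + real (b - a)) < \<bar>(\<Sum>i\<in>{a..<b}. ?X i \<omega>) - mu * real (b - a)\<bar>} \<le> \<delta> / 2"
      by (rule X.partial_sums_window) (use \<epsilon>' \<delta> C in auto)
    moreover have "\<forall>\<^sub>F n in sequentially. 2 * (2 * mu + 1) \<le> \<epsilon> * sqrt (real n)"
      using \<epsilon> by real_asymp
    moreover note eventually_ge_at_top[of 1]
    ultimately show "\<forall>\<^sub>F n in sequentially. \<exists>A\<in>events. prob A \<le> \<delta> \<and>
    (\<forall>\<omega>\<in>space M - A. mono_on {0..} (\<lambda>t. S t \<omega>) \<and> S 0 \<omega> = 0 \<longrightarrow>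
      service_close (\<lambda>t. S t \<omega>) mu T n \<kappa> \<epsilon>)"
    proof eventually_elim
      case (elim n)
      define k where "k = nat \<lfloor>C * real n\<rfloor>"
      have k: "real l \<le> C * n \<longleftrightarrow> l \<le> k" for l
        using C by (simp add: k_def le_nat_iff le_floor_iff)
      define A1 where "A1 = {\<omega>\<in>space M. \<exists>a b. a \<le> b \<and> b \<le> k \<and>
        \<epsilon>' * (sqrt n + real (b - a)) < \<bar>(\<Sum>i\<in>{a..<b}. ?X i \<omega>) - mu * real (b - a)\<bar>}"
      define A2 where "A2 = {\<omega>\<in>space M. \<exists>l. real l \<le> C * n \<and> \<kappa>\<^sub>1 * sqrt n \<le> \<bar>(\<Sum>i<l. ?X i \<omega>) - mu * l\<bar>}"
      have A: "A1 \<in> events" "A2 \<in> events" unfolding A1_def A2_def using X.rv by measurable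
      have "prob (A1 \<union> A2) \<le> prob A1 + prob A2" by (rule measure_Un_le[OF A])
      also have "prob A1 \<le> \<delta> / 2" using elim(1) by (simp only: A1_def k_def)
      also have "prob A2 \<le> \<delta> / 2" unfolding A2_def by (rule \<kappa>\<^sub>1(2)) (use elim in auto)
      finally have prob: "prob (A1 \<union> A2) \<le> \<delta>" by simp
      have kT: "n * T + 1 \<le> real k"
      proof -
        have "C * n - 1 < real k" using C unfolding k_def by linarith
        moreover have "C * n = n * T + 2 * n" by (simp add: C_def algebra_simps)
        moreover have "real n \<ge> 1" using elim(3) by simp
        ultimately show ?thesis by linarith
      qed
      have main: "service_close (\<lambda>t. S t \<omega>) mu T n \<kappa> \<epsilon>"
        if \<omega>: "\<omega> \<in> space M - (A1 \<union> A2)" and S: "mono_on {0..} (\<lambda>t. S t \<omega>)" "S 0 \<omega> = 0" for \<omega>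
      proof -
        have W: "\<bar>(\<Sum>i\<in>{a..<b}. ?X i \<omega>) - mu * real (b - a)\<bar> \<le> \<epsilon>' * (sqrt n + real (b - a))" if "a \<le> b" "b \<le> k" for a b
          using \<omega> that unfolding A1_def by (force simp: not_less)
        have tight: "\<bar>(\<Sum>i<l. ?X i \<omega>) - mu * real l\<bar> \<le> \<kappa>\<^sub>1 * sqrt n" if "l \<le> k" for l
          using \<omega> that unfolding A2_def k by (force simp: not_le less_imp_le)
        have "\<bar>real (S y \<omega>) - real (S x \<omega>) - mu * (y - x)\<bar> \<le> \<epsilon> * (sqrt n + (y - x))"
          if "0 \<le> x" "x \<le> y" "y \<le> n * T" for x y :: real
          by (rule service_noise(1)[OF S kT less_imp_le[OF mu] elim(3) W]) (use \<epsilon>' elim that in auto)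
        moreover have "\<bar>real (S x \<omega>) - mu * x\<bar> \<le> \<kappa> * sqrt n" if "0 \<le> x" "x \<le> n * T" for x :: real
        proof -
          have "\<bar>real (S x \<omega>) - mu * x\<bar> \<le> (\<kappa>\<^sub>1 + mu) * sqrt n"
            by (rule service_noise(2)[OF S kT less_imp_le[OF mu] elim(3) tight]) (use that in auto)
          also have "\<dots> \<le> \<kappa> * sqrt n" using \<kappa> by (intro mult_right_mono) (auto simp: \<kappa>\<^sub>0_def)
          finally show ?thesis .
        qed
        ultimately show ?thesis unfolding service_close_def by blast
      qed
      show ?case
        by (rule bexI[of _ "A1 \<union> A2"]) (use A prob main in auto)
    qed
  qed
qed

end

text \<open>The outer measure is an infimum over measurable supersets, so a measurable event of
  small probability that contains the deviation event suffices; \<open>X n\<close> itself may be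
  nonmeasurable.\<close>

lemma converges_to_0_in_probabilityI:
  assumes "prob_space M"
    and "\<And>\<epsilon> \<delta>. \<epsilon> > 0 \<Longrightarrow> \<delta> > 0 \<Longrightarrow> \<forall>\<^sub>F n in sequentially. \<exists>A\<in>sets M. measure M A \<le> \<delta> \<and>
      {\<omega> \<in> space M. X n \<omega> > ereal \<epsilon>} \<subseteq> A"
  shows "converges_to_0_in_probability M X"
  unfolding converges_to_0_in_probability_def
proof (intro allI impI)
  interpret prob_space M by fact
  fix \<epsilon> :: real assume \<epsilon>: "\<epsilon> > 0"
  show "(\<lambda>n. outer_measure_of M {\<omega> \<in> space M. X n \<omega> > ereal \<epsilon>}) \<longlonglongrightarrow> 0"
  proof (rule order_tendstoI)
    fix a :: ennreal assume "0 < a"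
    then obtain b where b: "0 < b" "b < a" using dense by blast
    then obtain \<delta> where \<delta>: "b = ennreal \<delta>" "\<delta> > 0"
      by (cases b) (auto simp: ennreal_less_zero_iff)
    have "\<forall>\<^sub>F n in sequentially. \<exists>A\<in>sets M. measure M A \<le> \<delta> \<and> {\<omega> \<in> space M. X n \<omega> > ereal \<epsilon>} \<subseteq> A"
      by (rule assms(2)[OF \<epsilon> \<delta>(2)])
    then show "\<forall>\<^sub>F n in sequentially. outer_measure_of M {\<omega> \<in> space M. X n \<omega> > ereal \<epsilon>} < a"
    proof eventually_elim
      case (elim n)
      then obtain A where A: "A \<in> sets M" "measure M A \<le> \<delta>" "{\<omega> \<in> space M. X n \<omega> > ereal \<epsilon>} \<subseteq> A" by blast
      have "outer_measure_of M {\<omega> \<in> space M. X n \<omega> > ereal \<epsilon>} \<le> emeasure M A"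
        unfolding outer_measure_of_def using A by (intro INF_lower2[of A]) auto
      also have "\<dots> \<le> b" unfolding emeasure_eq_measure \<delta>(1) using A(2) by (intro ennreal_leI)
      finally show ?case using b(2) by simp
    qed
  qed simp
qed

theorem proposition5p1:
  fixes M :: "'a measure" and M' :: "'b measure"
    and pol :: scheduling
    and lam mu lam_hat rho r :: "'k::{finite,linorder} \<Rightarrow> real"
    and h :: "'k \<Rightarrow> real \<Rightarrow> real"
    and lam_n :: "nat \<Rightarrow> 'k \<Rightarrow> real"
    and IA :: "'k \<Rightarrow> nat \<Rightarrow> 'a \<Rightarrow> real"
    and E :: "nat \<Rightarrow> 'k \<Rightarrow> real \<Rightarrow> 'a \<Rightarrow> nat"
    and S :: "'k \<Rightarrow> real \<Rightarrow> 'a \<Rightarrow> nat"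
    and Q0 Psi0 :: "nat \<Rightarrow> 'k \<Rightarrow> 'a \<Rightarrow> nat"
    and Psi_lim :: "'b \<Rightarrow> (real, 'k) vec"
    and sigma :: "nat \<Rightarrow> 'k profile"
    and Q Psi B D :: "nat \<Rightarrow> 'k scenario \<Rightarrow> 'a \<Rightarrow> 'k process"
    and J :: "nat \<Rightarrow> 'k scenario \<Rightarrow> 'a \<Rightarrow> 'k process"
    and gamma :: "'k \<Rightarrow> real \<Rightarrow> nat \<Rightarrow> 'a \<Rightarrow> ereal"
    and T :: real and i :: 'k
  assumes M: "prob_space M" and M': "prob_space M'"
    \<comment> \<open>parameters\<close>
    and "\<And>i. lam i > 0" and "\<And>i. mu i > 0"
    and rho: "\<And>i. rho i = lam i / mu i" and "(\<Sum>i\<in>UNIV. rho i) = 1"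
    and "\<And>n i. n \<ge> 1 \<Longrightarrow> lam_n n i > 0"
    and "\<And>i. (\<lambda>n. lam_n n i - (real n * lam i + sqrt n * lam_hat i)) \<in> o(\<lambda>n. sqrt n)"
    and "\<And>i. r i > 0"
    and "\<And>i. continuous_on {0..} (h i)" and "\<And>i. strict_mono_on {0..} (h i)" and "\<And>i. h i 0 = 0"
    \<comment> \<open>arrivals\<close>
    and "prob_space.indep_vars M (\<lambda>_. borel) (\<lambda>(i, l). IA i l) (UNIV \<times> {1..})"
    and "\<And>i l. l \<ge> 1 \<Longrightarrow> distr M borel (IA i l) = distr M borel (IA i 1)"
    and "\<And>i l. l \<ge> 1 \<Longrightarrow> AE \<omega> in M. IA i l \<omega> > 0"
    and "\<And>i l. l \<ge> 1 \<Longrightarrow> integrable M (IA i l) \<and> prob_space.expectation M (IA i l) = 1"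
    and "\<And>i l. l \<ge> 1 \<Longrightarrow> integrable M (\<lambda>\<omega>. (IA i l \<omega>)\<^sup>2)"
    and E: "\<And>n i t \<omega>. E n i t \<omega> = arrivals (\<lambda>k. IA i k \<omega>) (lam_n n i) t"
    \<comment> \<open>services\<close>
    and "\<And>i. prob_space.poisson_process M (mu i) (S i)"
    and "prob_space.indep_sets M (\<lambda>i. gen_events M (S i) {0..}) UNIV"
    \<comment> \<open>initial conditions\<close>
    and "\<And>n i. n \<ge> 1 \<Longrightarrow> Q0 n i \<in> measurable M (count_space UNIV)"
    and "\<And>n i. n \<ge> 1 \<Longrightarrow> Psi0 n i \<in> measurable M (count_space UNIV)"
    and "\<And>n. n \<ge> 1 \<Longrightarrow> AE \<omega> in M. (\<Sum>i\<in>UNIV. Psi0 n i \<omega>) \<le> n \<and>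
           ((\<Sum>i\<in>UNIV. Q0 n i \<omega>) > 0 \<longrightarrow> (\<Sum>i\<in>UNIV. Psi0 n i \<omega>) = n)"
    and "Psi_lim \<in> borel_measurable M'" and "AE \<omega> in M'. (\<Sum>i\<in>UNIV. Psi_lim \<omega> $ i) \<le> 0"
    and "converges_in_distribution M
           (\<lambda>n \<omega>. ((\<chi> i. real (Q0 n i \<omega>) / sqrt n), (\<chi> i. (real (Psi0 n i \<omega>) - real n * rho i) / sqrt n)))
           M' (\<lambda>\<omega>. (0, Psi_lim \<omega>))"
    \<comment> \<open>mutual independence of arrivals, services and initial conditions\<close>
    and "\<And>n. n \<ge> 1 \<Longrightarrow> prob_space.indep_sets M
           (\<lambda>m. [gen_events M (\<lambda>(i, t). E n i t) (UNIV \<times> {0..}),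
                 gen_events M (\<lambda>(i, t). S i t) (UNIV \<times> {0..}),
                 gen_events M (case_sum (Q0 n) (Psi0 n)) UNIV] ! m) {..<3}"
    \<comment> \<open>dynamics in each scenario\<close>
    and sigma: "\<And>n. sigma n = threshold_profile lam r h n"
    and "AE \<omega> in M. \<forall>n\<ge>1. \<forall>s\<in>scenarios.
           system_path pol n (\<lambda>i t. E n i t \<omega>) (\<lambda>i t. S i t \<omega>) (\<lambda>i. Q0 n i \<omega>) (\<lambda>i. Psi0 n i \<omega>)
             (scenario_profile (sigma n) s) (Q n s \<omega>) (Psi n s \<omega>) (B n s \<omega>) (D n s \<omega>)"
    and J: "\<And>n s \<omega>. J n s \<omega> =
           joins (\<lambda>i t. E n i t \<omega>)
             (decisions (\<lambda>i t. E n i t \<omega>) (scenario_profile (sigma n) s) (Q n s \<omega>))"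
    and gamma: "\<And>i T n \<omega>. gamma i T n \<omega> =
           (SUP s\<in>scenarios. SUP t\<in>{0..T}. deviation n (lam i) (J n s \<omega> i) (B n s \<omega> i) (Q n s \<omega> i) t)"
    and "T > 0"
  shows "converges_to_0_in_probability M (gamma i T)"
proof -
  interpret prob_space M by fact
  let ?N = "real CARD('k)"
  let ?m = "\<Sum>k\<in>UNIV. mu k"
  note lam_pos = assms(3) and mu_pos = assms(4) and T_pos = assms(32)
  have N: "?N \<ge> 1" by (simp add: Suc_le_eq)
  have m: "?m > 0" using mu_pos by (intro sum_pos) auto
  define U where "U n \<omega> = (\<chi> k. real (Q0 n k \<omega>) / sqrt n)" for n \<omega>
  define V where "V n \<omega> = (\<chi> k. (real (Psi0 n k \<omega>) - real n * rho k) / sqrt n)" for n \<omega>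
  have conv: "converges_in_distribution M (\<lambda>n \<omega>. (U n \<omega>, V n \<omega>)) M' (\<lambda>\<omega>. (0, Psi_lim \<omega>))"
    unfolding U_def V_def by (rule assms(26))
  have meas: "(\<lambda>\<omega>. norm (U n \<omega>)) \<in> borel_measurable M" "(\<lambda>\<omega>. norm (V n \<omega>)) \<in> borel_measurable M"
    if n: "n \<ge> 1" for n
  proof -
    have [measurable]: "(\<lambda>\<omega>. real (Q0 n k \<omega>)) \<in> borel_measurable M"
      "(\<lambda>\<omega>. real (Psi0 n k \<omega>)) \<in> borel_measurable M" for k
      using measurable_compose[OF assms(21)[OF n, of k], of real borel]
        measurable_compose[OF assms(22)[OF n, of k], of real borel] by simp_all
    show "(\<lambda>\<omega>. norm (U n \<omega>)) \<in> borel_measurable M" "(\<lambda>\<omega>. norm (V n \<omega>)) \<in> borel_measurable M"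
      unfolding U_def V_def norm_vec_def L2_set_def by simp_all
  qed
  note tight = converges_in_distribution_tight[OF conv M' assms(24) meas]
  \<comment> \<open>The almost sure properties, for every \<open>n\<close> and every scenario, are
    collected so that one null set \<open>Z\<close> serves for all.\<close>
  define regular where "regular \<omega> \<longleftrightarrow> (\<forall>k l. IA k (Suc l) \<omega> > 0) \<and>
      (\<forall>k. mono_on {0..} (\<lambda>t. S k t \<omega>) \<and> S k 0 \<omega> = 0) \<and>
      (\<forall>n\<ge>1. \<forall>s\<in>scenarios. system_path pol n (\<lambda>i t. E n i t \<omega>) (\<lambda>i t. S i t \<omega>)
         (\<lambda>i. Q0 n i \<omega>) (\<lambda>i. Psi0 n i \<omega>) (scenario_profile (sigma n) s)
         (Q n s \<omega>) (Psi n s \<omega>) (B n s \<omega>) (D n s \<omega>))" for \<omega>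
  have "AE \<omega> in M. regular \<omega>"
  proof -
    have AE_all: "AE \<omega> in M. \<forall>k. P k \<omega>" if "\<And>k. AE \<omega> in M. P k \<omega>" for P :: "'k \<Rightarrow> 'a \<Rightarrow> bool"
      using AE_finite_allI[of "UNIV :: 'k set" P M] that by simp
    have "AE \<omega> in M. \<forall>k. \<forall>l. IA k (Suc l) \<omega> > 0"
      by (intro AE_all AE_all_countable[THEN iffD2] allI assms(15)) simp
    moreover have "AE \<omega> in M. \<forall>k. mono_on {0..} (\<lambda>t. S k t \<omega>) \<and> S k 0 \<omega> = 0"
    proof (rule AE_all)
      fix k
      have "AE \<omega> in M. S k 0 \<omega> = 0 \<and> mono_on {0..} (\<lambda>t. S k t \<omega>) \<and>
          (\<forall>t\<ge>0. continuous (at_right t) (\<lambda>t. S k t \<omega>))"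
        using assms(19)[of k] unfolding poisson_process_def by blast
      then show "AE \<omega> in M. mono_on {0..} (\<lambda>t. S k t \<omega>) \<and> S k 0 \<omega> = 0"
        by eventually_elim blast
    qed
    ultimately show ?thesis using assms(29) unfolding regular_def by eventually_elim blast
  qed
  then obtain Z where Z: "{\<omega>\<in>space M. \<not> regular \<omega>} \<subseteq> Z" "emeasure M Z = 0" "Z \<in> events"
    by (rule AE_E)
  have prob_Z: "prob Z = 0" using Z(2) by (simp add: measure_def)
  show ?thesis
  proof (rule converges_to_0_in_probabilityI[OF M])
    fix \<epsilon> \<delta> :: real assume \<epsilon>: "\<epsilon> > 0" and \<delta>: "\<delta> > 0"
    define \<zeta> where "\<zeta> = min \<epsilon> 1"
    have \<zeta>: "0 < \<zeta>" "\<zeta> \<le> 1" "\<zeta> \<le> \<epsilon>" using \<epsilon> by (auto simp: \<zeta>_def)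
    \<comment> \<open>One share for the arrivals and one for the services of each class, two for the
      initial state; \<open>Z\<close> has probability 0.\<close>
    define \<delta>' where "\<delta>' = \<delta> / (2 * ?N + 2)"
    have \<delta>': "\<delta>' > 0" "2 * ?N * \<delta>' + 2 * \<delta>' = \<delta>"
    proof -
      have pos: "2 * ?N + 2 > 0" using N by linarith
      then show "\<delta>' > 0" using \<delta> unfolding \<delta>'_def by (rule divide_pos_pos[rotated])
      have "(2 * ?N + 2) * \<delta>' = \<delta>" using pos unfolding \<delta>'_def by (metis less_irrefl nonzero_mult_div_cancel_left times_divide_eq_right)
      then show "2 * ?N * \<delta>' + 2 * \<delta>' = \<delta>" by (simp only: distrib_right)
    qed
    define arr_level where "arr_level k \<kappa>\<^sub>0 \<longleftrightarrow> 1 \<le> \<kappa>\<^sub>0 \<and> (\<forall>\<kappa> e. \<kappa>\<^sub>0 \<le> \<kappa> \<longrightarrow> e > 0 \<longrightarrow>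
        (\<forall>\<^sub>F n in sequentially. \<exists>A\<in>events. prob A \<le> \<delta>' \<and>
        (\<forall>\<omega>\<in>space M - A. (\<forall>l. IA k (Suc l) \<omega> > 0) \<longrightarrow> renewal_close (\<lambda>t. E n k t \<omega>) (lam k) (T + 2) n \<kappa> e)))" for k \<kappa>\<^sub>0
    have "\<exists>\<kappa>\<^sub>0. arr_level k \<kappa>\<^sub>0" for k
    proof -
      have iid: "iid_nonneg M (\<lambda>j. IA k (Suc j)) 1"
        by (rule iid_row[OF assms(13) assms(14,15)])
          (use assms(16)[where i = k and l = 1] assms(17)[where i = k and l = 1] in simp_all)
      \<comment> \<open>The coefficient of the \<open>sqrt n\<close> term plus 1 bounds the
        deviation, because the \<open>o(sqrt n)\<close> remainder is eventually at most
        \<open>sqrt n\<close>.\<close>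
      have rate: "\<forall>\<^sub>F n in sequentially. \<bar>lam_n n k - n * lam k\<bar> \<le> (\<bar>lam_hat k\<bar> + 1) * sqrt n"
      proof -
        have "\<forall>\<^sub>F n in sequentially. norm (lam_n n k - (real n * lam k + sqrt n * lam_hat k)) \<le> 1 * norm (sqrt (real n))"
          by (rule landau_o.smallD[OF assms(8)]) simp
        then show ?thesis
        proof eventually_elim
          case (elim n)
          have "\<bar>lam_n n k - n * lam k\<bar> \<le> \<bar>lam_n n k - (real n * lam k + sqrt n * lam_hat k)\<bar> + \<bar>sqrt n * lam_hat k\<bar>"
            by linarith
          also have "\<dots> \<le> sqrt n + \<bar>lam_hat k\<bar> * sqrt n"
            using elim by (simp add: abs_mult mult.commute)
          finally show ?case by (simp add: algebra_simps)
        qed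
      qed
      show ?thesis
      proof (rule arrival_noise_whp[OF iid _ lam_pos rate assms(7) _ \<delta>'(1), where T = "T + 2"], goal_cases)
        case (4 \<kappa>\<^sub>0)
        then show ?case unfolding arr_level_def E by blast
      qed (use T_pos in simp_all)
    qed
    then obtain \<kappa>A where "\<And>k. arr_level k (\<kappa>A k)"
      by metis
    then have \<kappa>A: "\<kappa>A k \<ge> 1"
      "\<kappa>A k \<le> \<kappa> \<Longrightarrow> e > 0 \<Longrightarrow> \<forall>\<^sub>F n in sequentially. \<exists>A\<in>events. prob A \<le> \<delta>' \<and>
        (\<forall>\<omega>\<in>space M - A. (\<forall>l. IA k (Suc l) \<omega> > 0) \<longrightarrow> renewal_close (\<lambda>t. E n k t \<omega>) (lam k) (T + 2) n \<kappa> e)" for k \<kappa> e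
      unfolding arr_level_def by blast+
    define srv_level where "srv_level k \<kappa>\<^sub>0 \<longleftrightarrow> 1 \<le> \<kappa>\<^sub>0 \<and> (\<forall>\<kappa> e. \<kappa>\<^sub>0 \<le> \<kappa> \<longrightarrow> e > 0 \<longrightarrow>
        (\<forall>\<^sub>F n in sequentially. \<exists>A\<in>events. prob A \<le> \<delta>' \<and>
        (\<forall>\<omega>\<in>space M - A. mono_on {0..} (\<lambda>t. S k t \<omega>) \<and> S k 0 \<omega> = 0 \<longrightarrow> service_close (\<lambda>t. S k t \<omega>) (mu k) (T + 2) n \<kappa> e)))" for k \<kappa>\<^sub>0
    have "\<exists>\<kappa>\<^sub>0. srv_level k \<kappa>\<^sub>0" for k
    proof (rule service_noise_whp[OF assms(19)[of k] mu_pos _ \<delta>'(1), where T = "T + 2"], goal_cases)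
      case (2 \<kappa>\<^sub>0)
      then show ?case unfolding srv_level_def by blast
    qed (use T_pos in simp)
    then obtain \<kappa>S where "\<And>k. srv_level k (\<kappa>S k)"
      by metis
    then have \<kappa>S: "\<kappa>S k \<ge> 1"
      "\<kappa>S k \<le> \<kappa> \<Longrightarrow> e > 0 \<Longrightarrow> \<forall>\<^sub>F n in sequentially. \<exists>A\<in>events. prob A \<le> \<delta>' \<and>
        (\<forall>\<omega>\<in>space M - A. mono_on {0..} (\<lambda>t. S k t \<omega>) \<and> S k 0 \<omega> = 0 \<longrightarrow> service_close (\<lambda>t. S k t \<omega>) (mu k) (T + 2) n \<kappa> e)" for k \<kappa> e
      unfolding srv_level_def by blast+
    obtain \<kappa>I where \<kappa>I: "\<forall>\<^sub>F n in sequentially. prob {\<omega>\<in>space M. \<kappa>I \<le> norm (V n \<omega>)} \<le> \<delta>'"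
      using tight(2)[OF _ _ \<delta>'(1)] by blast
    \<comment> \<open>All levels are nonnegative or taken in absolute value, so their sum is a
      common upper bound.\<close>
    define kap where "kap = 1 + (\<Sum>k\<in>UNIV. \<kappa>A k) + (\<Sum>k\<in>UNIV. \<kappa>S k) + \<bar>\<kappa>I\<bar>"
    have kap: "\<kappa>A k \<le> kap" "\<kappa>S k \<le> kap" "\<kappa>I \<le> kap" "1 \<le> kap" for k
    proof -
      have "0 \<le> \<kappa>A k" "0 \<le> \<kappa>S k" for k using \<kappa>A(1)[of k] \<kappa>S(1)[of k] by linarith+
      then have "\<kappa>A k \<le> (\<Sum>k\<in>UNIV. \<kappa>A k)" "\<kappa>S k \<le> (\<Sum>k\<in>UNIV. \<kappa>S k)"
        "0 \<le> (\<Sum>k\<in>UNIV. \<kappa>A k)" "0 \<le> (\<Sum>k\<in>UNIV. \<kappa>S k)"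
        by (auto intro!: member_le_sum sum_nonneg)
      then show "\<kappa>A k \<le> kap" "\<kappa>S k \<le> kap" "\<kappa>I \<le> kap" "1 \<le> kap" by (auto simp: kap_def)
    qed
    define K where "K = path_bound ?N kap ?m (T + 2)"
    have K: "K > 0" unfolding K_def path_bound_def
      using N kap(4) m T_pos by (intro mult_pos_pos add_pos_pos) auto
    have "\<exists>a>0. \<forall>x. 0 \<le> x \<longrightarrow> x \<le> K \<longrightarrow> (h k (x / lam k) \<le> r k \<longleftrightarrow> x \<le> a)" for k
      by (rule threshold_level[OF assms(10,11,12,9) lam_pos K, of k]) blast
    then obtain a where a: "\<And>k. a k > 0"
      "\<And>k x. 0 \<le> x \<Longrightarrow> x \<le> K \<Longrightarrow> h k (x / lam k) \<le> r k \<longleftrightarrow> x \<le> a k"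
      by metis
    \<comment> \<open>The time, in units of \<open>1 / sqrt n\<close>, in which class
      \<open>i\<close> clears a queue of the largest possible scaled length \<open>K\<close>, with a
      margin of 2 in the length.\<close>
    define C where "C = (K + 2) / lam i"
    have C: "C > 0" "K + 2 \<le> lam i * C" using K lam_pos[of i] by (auto simp: C_def)
    have wc: "window_const ?N > 0" using N by (simp add: window_const_def reject_const_def add_pos_nonneg)
    \<comment> \<open>One term for each smallness condition of \<open>sample_bound\<close>; 7
      instead of 6 makes the inequality with \<open>a k\<close> strict.\<close>
    define eps where "eps = min 1 (min (\<zeta> / (window_const ?N * (1 + C)))
      (MIN k. min (lam k / (4 * ?N)) (a k / (7 * ?N))))"
    have eps: "0 < eps" "eps \<le> 1" "window_const ?N * (1 + C) * eps \<le> \<zeta>"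
      "\<And>k. 4 * ?N * eps \<le> lam k" "\<And>k. 6 * ?N * eps < a k"
    proof -
      have "0 < (MIN k. min (lam k / (4 * ?N)) (a k / (7 * ?N)))"
        using N lam_pos a(1) by (subst Min_gr_iff) auto
      then show pos: "0 < eps" using wc C \<zeta> by (auto simp: eps_def)
      show "eps \<le> 1" by (simp add: eps_def)
      have "eps \<le> \<zeta> / (window_const ?N * (1 + C))" by (simp add: eps_def)
      then show "window_const ?N * (1 + C) * eps \<le> \<zeta>"
        using wc C by (simp add: pos_le_divide_eq mult.commute)
      fix k
      have "(MIN k. min (lam k / (4 * ?N)) (a k / (7 * ?N))) \<le> min (lam k / (4 * ?N)) (a k / (7 * ?N))"
        by (rule Min_le) auto
      then have le: "eps \<le> lam k / (4 * ?N)" "eps \<le> a k / (7 * ?N)" by (auto simp: eps_def)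
      show "4 * ?N * eps \<le> lam k" using le(1) N by (simp add: pos_le_divide_eq mult.commute)
      have "7 * ?N * eps \<le> a k" using le(2) N by (simp add: pos_le_divide_eq mult.commute)
      moreover have "0 < ?N * eps" using N pos by simp
      ultimately show "6 * ?N * eps < a k" by linarith
    qed
    have "\<forall>\<^sub>F n in sequentially. \<forall>k\<in>UNIV. \<exists>A\<in>events. prob A \<le> \<delta>' \<and>
        (\<forall>\<omega>\<in>space M - A. (\<forall>l. IA k (Suc l) \<omega> > 0) \<longrightarrow> renewal_close (\<lambda>t. E n k t \<omega>) (lam k) (T + 2) n kap eps)"
      by (intro eventually_ball_finite ballI \<kappa>A(2) kap eps(1)) simp
    moreover have "\<forall>\<^sub>F n in sequentially. \<forall>k\<in>UNIV. \<exists>A\<in>events. prob A \<le> \<delta>' \<and>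
        (\<forall>\<omega>\<in>space M - A. mono_on {0..} (\<lambda>t. S k t \<omega>) \<and> S k 0 \<omega> = 0 \<longrightarrow> service_close (\<lambda>t. S k t \<omega>) (mu k) (T + 2) n kap eps)"
      by (intro eventually_ball_finite ballI \<kappa>S(2) kap eps(1)) simp
    moreover note \<kappa>I
    moreover have "\<forall>\<^sub>F n in sequentially. prob {\<omega>\<in>space M. eps \<le> norm (U n \<omega>)} \<le> \<delta>'"
      by (rule tight(1)[OF _ _ \<delta>'(1) eps(1)])
    moreover have "\<forall>\<^sub>F n in sequentially. 2 \<le> eps * sqrt (real n)"
      "\<forall>\<^sub>F n in sequentially. ?m * K \<le> eps * sqrt (real n)"
      "\<forall>\<^sub>F n in sequentially. C \<le> sqrt (real n)"
    proof -
      have "filterlim (\<lambda>n. eps * sqrt (real n)) at_top sequentially" using eps(1) by real_asymp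
      then show "\<forall>\<^sub>F n in sequentially. 2 \<le> eps * sqrt (real n)"
        "\<forall>\<^sub>F n in sequentially. ?m * K \<le> eps * sqrt (real n)"
        unfolding filterlim_at_top by blast+
      have "filterlim (\<lambda>n. sqrt (real n)) at_top sequentially" by real_asymp
      then show "\<forall>\<^sub>F n in sequentially. C \<le> sqrt (real n)"
        unfolding filterlim_at_top by blast
    qed
    moreover note eventually_ge_at_top[of 1]
    ultimately show "\<forall>\<^sub>F n in sequentially. \<exists>A\<in>events. prob A \<le> \<delta> \<and>
      {\<omega> \<in> space M. gamma i T n \<omega> > ereal \<epsilon>} \<subseteq> A"
    proof eventually_elim
      case (elim n)
      from bchoice[OF elim(1)[unfolded Bex_def]] obtain A where
        "\<And>k. A k \<in> events \<and> prob (A k) \<le> \<delta>' \<and> (\<forall>\<omega>\<in>space M - A k. (\<forall>l. IA k (Suc l) \<omega> > 0) \<longrightarrow> renewal_close (\<lambda>t. E n k t \<omega>) (lam k) (T + 2) n kap eps)"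
        by blast
      then have A: "A k \<in> events" "prob (A k) \<le> \<delta>'"
        "\<omega> \<in> space M - A k \<Longrightarrow> (\<forall>l. IA k (Suc l) \<omega> > 0) \<Longrightarrow> renewal_close (\<lambda>t. E n k t \<omega>) (lam k) (T + 2) n kap eps" for k \<omega>
        by blast+
      from bchoice[OF elim(2)[unfolded Bex_def]] obtain A' where
        "\<And>k. A' k \<in> events \<and> prob (A' k) \<le> \<delta>' \<and> (\<forall>\<omega>\<in>space M - A' k. mono_on {0..} (\<lambda>t. S k t \<omega>) \<and> S k 0 \<omega> = 0 \<longrightarrow> service_close (\<lambda>t. S k t \<omega>) (mu k) (T + 2) n kap eps)"
        by blast
      then have A': "A' k \<in> events" "prob (A' k) \<le> \<delta>'"
        "\<omega> \<in> space M - A' k \<Longrightarrow> mono_on {0..} (\<lambda>t. S k t \<omega>) \<and> S k 0 \<omega> = 0 \<Longrightarrow> service_close (\<lambda>t. S k t \<omega>) (mu k) (T + 2) n kap eps" for k \<omega>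
        by blast+
      define IU where "IU = {\<omega>\<in>space M. eps \<le> norm (U n \<omega>)}"
      define IV where "IV = {\<omega>\<in>space M. \<kappa>I \<le> norm (V n \<omega>)}"
      note n = elim(8)
      have I: "IU \<in> events" "IV \<in> events" "prob IU \<le> \<delta>'" "prob IV \<le> \<delta>'"
        unfolding IU_def IV_def using meas[OF n] elim(3,4) by auto
      let ?bad = "(\<Union>k. A k) \<union> (\<Union>k. A' k) \<union> IU \<union> IV \<union> Z"
      have ev: "(\<Union>k. A k) \<in> events" "(\<Union>k. A' k) \<in> events" using A A' by auto
      have union: "prob (\<Union>k. F k) \<le> ?N * \<delta>'" if "\<And>k. F k \<in> events" "\<And>k. prob (F k) \<le> \<delta>'" for F :: "'k \<Rightarrow> 'a set"
      proof -
        have "prob (\<Union>k. F k) \<le> (\<Sum>k\<in>UNIV. prob (F k))"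
          using that by (intro finite_measure_subadditive_finite) auto
        also have "\<dots> \<le> (\<Sum>k\<in>(UNIV::'k set). \<delta>')" by (intro sum_mono that)
        finally show ?thesis by simp
      qed
      have "prob ?bad \<le> prob (\<Union>k. A k) + prob (\<Union>k. A' k) + prob IU + prob IV + prob Z"
        using ev I Z(3) by (intro order_trans[OF measure_Un_le] add_mono) auto
      also have "\<dots> \<le> ?N * \<delta>' + ?N * \<delta>' + \<delta>' + \<delta>' + 0"
        using union[OF A(1,2)] union[OF A'(1,2)] I prob_Z by (intro add_mono) auto
      also have "\<dots> = \<delta>" using \<delta>'(2) by linarith
      finally have prob_bad: "prob ?bad \<le> \<delta>" .
      have gamma_le: "gamma i T n \<omega> \<le> ereal \<zeta>" if \<omega>: "\<omega> \<in> space M" "\<omega> \<notin> ?bad" for \<omega>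
      proof -
        have reg: "regular \<omega>" using \<omega> Z(1) by auto
        have arr: "renewal_close (\<lambda>t. E n k t \<omega>) (lam k) (T + 2) n kap eps" and srv: "service_close (\<lambda>t. S k t \<omega>) (mu k) (T + 2) n kap eps" for k
          using A(3)[of \<omega> k] A'(3)[of \<omega> k] reg \<omega> by (auto simp: regular_def)
        have "\<exists>g :: nat \<Rightarrow> real. strict_mono g \<and> g 0 = 0 \<and>
          (\<forall>(t::real) j. 0 \<le> t \<longrightarrow> t \<le> T + 2 \<longrightarrow> (j \<le> E n k t \<omega> \<longleftrightarrow> g j \<le> t))" for k
          using arr[of k] unfolding renewal_close_def by blast
        then obtain g :: "'k \<Rightarrow> nat \<Rightarrow> real" where g: "\<And>k. strict_mono (g k)" "\<And>k. g k 0 = 0"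
          "\<And>k (t::real) j. 0 \<le> t \<Longrightarrow> t \<le> T + 2 \<Longrightarrow> j \<le> E n k t \<omega> \<longleftrightarrow> g k j \<le> t"
          by metis
        have sqrt_n: "sqrt n > 0" using n by simp
        have Q0: "real (Q0 n k \<omega>) \<le> eps * sqrt n" for k
        proof -
          have "\<bar>U n \<omega> $ k\<bar> \<le> eps"
            using component_le_norm_cart[of "U n \<omega>" k] \<omega> by (auto simp: IU_def)
          then show ?thesis using sqrt_n by (simp add: U_def pos_divide_le_eq)
        qed
        have Psi0: "\<bar>real (Psi0 n k \<omega>) - n * rho k\<bar> \<le> kap * sqrt n" for k
        proof -
          have "\<bar>V n \<omega> $ k\<bar> \<le> kap"
            using component_le_norm_cart[of "V n \<omega>" k] \<omega> kap(3) by (auto simp: IV_def)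
          then show ?thesis using sqrt_n by (simp add: V_def abs_divide pos_divide_le_eq)
        qed
        show ?thesis
          unfolding gamma J sigma
        proof (rule sample_bound[where g = g and a = a and eps = eps and kap = kap and C = C])
          show "system_path pol n (\<lambda>i t. E n i t \<omega>) (\<lambda>i t. S i t \<omega>) (\<lambda>i. Q0 n i \<omega>) (\<lambda>i. Psi0 n i \<omega>)
             (scenario_profile (threshold_profile lam r h n) s) (Q n s \<omega>) (Psi n s \<omega>) (B n s \<omega>) (D n s \<omega>)"
            if "s \<in> scenarios" for s
            using reg n that unfolding regular_def sigma by blast
          show "mono_on {0..} (\<lambda>t. S k t \<omega>)" "S k 0 \<omega> = 0" for k
            using reg unfolding regular_def by blast+
          show "\<bar>real (E n k t \<omega>) - real (E n k s \<omega>) - n * lam k * (t - s)\<bar> \<le> eps * (sqrt n + n * (t - s))"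
            if "0 \<le> s" "s \<le> t" "t \<le> T + 2" for k and s t :: real
            using arr[of k] that unfolding renewal_close_def by blast
          show "\<bar>real (E n k t \<omega>) - n * lam k * t\<bar> \<le> kap * sqrt n"
            if "0 \<le> t" "t \<le> T + 2" for k and t :: real
            using arr[of k] that unfolding renewal_close_def by blast
          show "\<bar>real (S k y \<omega>) - real (S k x \<omega>) - mu k * (y - x)\<bar> \<le> eps * (sqrt n + (y - x))"
            if "0 \<le> x" "x \<le> y" "y \<le> n * (T + 2)" for k and x y :: real
            using srv[of k] that unfolding service_close_def by blast
          show "\<bar>real (S k x \<omega>) - mu k * x\<bar> \<le> kap * sqrt n"
            if "0 \<le> x" "x \<le> n * (T + 2)" for k and x :: real
            using srv[of k] that unfolding service_close_def by blast
          show "h k (x / lam k) \<le> r k \<longleftrightarrow> x \<le> a k"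
            if "0 \<le> x" "x \<le> path_bound ?N kap ?m (T + 2)" for k and x :: real
            using that by (intro a(2)) (simp_all add: K_def)
          show "?m * path_bound ?N kap ?m (T + 2) \<le> eps * sqrt n" "path_bound ?N kap ?m (T + 2) + 2 \<le> lam i * C"
            using elim(6) C(2) by (simp_all add: K_def)
        qed (use g n T_pos lam_pos mu_pos rho assms(6,9,12) eps kap Q0 Psi0 elim(5,7) \<zeta> in auto)
      qed
      have "{\<omega> \<in> space M. gamma i T n \<omega> > ereal \<epsilon>} \<subseteq> ?bad"
      proof (rule subsetI, rule ccontr)
        fix \<omega> assume \<omega>: "\<omega> \<in> {\<omega> \<in> space M. gamma i T n \<omega> > ereal \<epsilon>}" "\<omega> \<notin> ?bad"
        then have "gamma i T n \<omega> \<le> ereal \<zeta>" by (intro gamma_le) simp_all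
        also have "\<dots> \<le> ereal \<epsilon>" using \<zeta>(3) by simp
        finally have "\<not> ereal \<epsilon> < gamma i T n \<omega>" by (simp only: not_less)
        then show False using \<omega>(1) by blast
      qed
      moreover have "?bad \<in> events" using ev I(1,2) Z(3) by (intro sets.Un)
      ultimately show ?case using prob_bad by blast
    qed
  qed
qed

end
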